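(* Let $\mathcal C$ be a Pontryagin space, let $\Omega$ be an open subset of the open right half-plane $\mathbb C_r=\{z\in\mathbb C:\ {\rm Re}\,z>0\}$, and fix $\alpha\in\Omega$. Let $\mathcal P$ be a reproducing kernel Pontryagin space of $\mathcal C$-valued functions analytic in $\Omega$, with inner product $[\cdot,\cdot]_{\mathcal P}$, such that $\mathcal P$ is invariant under $R_\alpha$ and \[ (2{\rm Re}\,\alpha)[R_\alpha f,R_\alpha f]_{\mathcal P}+[R_\alpha f,f]_{\mathcal P}+[f,R_\alpha f]_{\mathcal P}+2\pi[f(\alpha),f(\alpha)]_{\mathcal C}\le 0\qquad\text{for all } f\in\mathcal P. \] Then every function of $\mathcal P$ has a unique meromorphic extension to $\mathbb C_r$, and there exist a Pontryagin space $\mathcal C_1$ with ${\rm ind}_-(\mathcal C_1)={\rm ind}_-(\mathcal C)$ and a function $S\in\mathcal S_\kappa(\mathcal C_1,\mathcal C)$, where $\kappa={\rm ind}_-(\mathcal P)$, such that the reproducing kernel of $\mathcal P$ is \[ K_S(z,w)=\frac{I_{\mathcal C}-S(z)S(w)^*}{2\pi(z+\overline{w})}. \]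
   Context: A Pontryagin space is a vector space $\mathcal V$ with a Hermitian form $[\cdot,\cdot]$ admitting a decomposition $\mathcal V=\mathcal V_+[+]\mathcal V_-$ into $[\cdot,\cdot]$-orthogonal subspaces with $\mathcal V_+\cap\mathcal V_-=\{0\}$, where $(\mathcal V_+,[\cdot,\cdot])$ and $(\mathcal V_-,-[\cdot,\cdot])$ are Hilbert spaces and $\mathcal V_-$ is finite dimensional; $\dim\mathcal V_-$ (independent of the decomposition) is the index of negativity ${\rm ind}_-(\mathcal V)$. Adjoints are taken with respect to the indefinite forms. An $\mathbf L(\mathcal C)$-valued kernel $K(z,w)$ on a set $\Omega$ has $\kappa$ negative squares if $K(z,w)=K(w,z)^*$ and for all $N$, $w_1,\dots,w_N\in\Omega$, $c_1,\dots,c_N\in\mathcal C$ the Hermitian matrix $([K(w_\ell,w_k)c_k,c_\ell]_{\mathcal C})_{\ell,k}$ has at most $\kappa$ negative eigenvalues, with exactly $\kappa$ for some choice. A reproducing kernel Pontryagin space has a reproducing kernel with $\kappa={\rm ind}_-$ negative squares. For $\alpha\in\mathbb C$ and $f$ analytic near $\alpha$, $(R_\alpha f)(z)=\frac{f(z)-f(\alpha)}{z-\alpha}$ for $z\neq\alpha$ and $(R_\alpha f)(\alpha)=f'(\alpha)$. For Pontryagin spaces $\mathcal D,\mathcal C$ with the same index of negativity, $\mathcal S_\kappa(\mathcal D,\mathcal C)$ (generalized Schur functions of the right half-plane) denotes the $\mathbf L(\mathcal D,\mathcal C)$-valued functions $S$ analytic in some open subset of $\mathbb C_r$ (equivalently,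 meromorphic in $\mathbb C_r$) for which the kernel $\frac{I_{\mathcal C}-S(z)S(w)^*}{2\pi(z+\overline w)}$ has $\kappa$ negative squares on the domain of analyticity of $S$. *)

theory Defs
  imports "HOL-Complex_Analysis.Complex_Analysis" "HOL-Library.Function_Algebras"
    "HOL-Library.Product_Plus" "Jordan_Normal_Form.Char_Poly"
begin

class cvec = ab_group_add +
  fixes cscale :: "complex \<Rightarrow> 'a \<Rightarrow> 'a"
  assumes cscale_add_right: "cscale a (x + y) = cscale a x + cscale a y"
    and cscale_add_left: "cscale (a + b) x = cscale a x + cscale b x"
    and cscale_mult: "cscale a (cscale b x) = cscale (a * b) x"
    and cscale_one: "cscale 1 x = x"

instantiation "fun" :: (type, cvec) cvec
begin
definition cscale_fun :: "complex \<Rightarrow> ('a \<Rightarrow> 'b) \<Rightarrow> 'a \<Rightarrow> 'b"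
  where "cscale_fun a f = (\<lambda>x. cscale a (f x))"
instance
  by standard (auto simp: cscale_fun_def cscale_add_right cscale_add_left cscale_mult cscale_one)
end

instantiation prod :: (cvec, cvec) cvec
begin
definition cscale_prod :: "complex \<Rightarrow> 'a \<times> 'b \<Rightarrow> 'a \<times> 'b"
  where "cscale_prod a p = (cscale a (fst p), cscale a (snd p))"
instance
  by standard (auto simp: cscale_prod_def cscale_add_right cscale_add_left cscale_mult cscale_one)
end

definition csubspace :: "'a::cvec set \<Rightarrow> bool" where
  "csubspace V \<longleftrightarrow> 0 \<in> V \<and> (\<forall>x\<in>V. \<forall>y\<in>V. x + y \<in> V) \<and> (\<forall>a x. x \<in> V \<longrightarrow> cscale a x \<in> V)"

definition cspan :: "'a::cvec set \<Rightarrow> 'a set" where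
  "cspan B = {y. \<exists>F f. finite F \<and> F \<subseteq> B \<and> y = (\<Sum>b\<in>F. cscale (f b) b)}"

definition cindep :: "'a::cvec set \<Rightarrow> bool" where
  "cindep B \<longleftrightarrow> (\<forall>F f. finite F \<and> F \<subseteq> B \<and> (\<Sum>b\<in>F. cscale (f b) b) = 0 \<longrightarrow> (\<forall>b\<in>F. f b = 0))"

definition cdim_is :: "'a::cvec set \<Rightarrow> nat \<Rightarrow> bool" where
  "cdim_is V n \<longleftrightarrow> (\<exists>B. finite B \<and> card B = n \<and> cindep B \<and> cspan B = V)"

definition herm_form :: "'a::cvec set \<Rightarrow> ('a \<Rightarrow> 'a \<Rightarrow> complex) \<Rightarrow> bool" where
  "herm_form V ip \<longleftrightarrow>
     (\<forall>x\<in>V. \<forall>y\<in>V. \<forall>z\<in>V. \<forall>a. ip (cscale a x + y) z = a * ip x z + ip y z) \<and>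
     (\<forall>x\<in>V. \<forall>y\<in>V. ip x y = cnj (ip y x))"

definition hilbert_wrt :: "'a::cvec set \<Rightarrow> ('a \<Rightarrow> 'a \<Rightarrow> complex) \<Rightarrow> bool" where
  "hilbert_wrt V ip \<longleftrightarrow> csubspace V \<and> herm_form V ip \<and>
     (\<forall>x\<in>V. x \<noteq> 0 \<longrightarrow> Re (ip x x) > 0) \<and>
     (\<forall>s. (\<forall>n. s n \<in> V) \<and>
          (\<forall>e>0. \<exists>N. \<forall>m\<ge>N. \<forall>n\<ge>N. Re (ip (s m - s n) (s m - s n)) < e)
        \<longrightarrow> (\<exists>y\<in>V. (\<lambda>n. Re (ip (s n - y) (s n - y))) \<longlonglongrightarrow> 0))"

definition fund_decomp :: "'a::cvec set \<Rightarrow> ('a \<Rightarrow> 'a \<Rightarrow> complex) \<Rightarrow> 'a set \<Rightarrow> 'a set \<Rightarrow> bool" where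
  "fund_decomp V ip Vp Vm \<longleftrightarrow> Vp \<subseteq> V \<and> Vm \<subseteq> V \<and>
     (\<forall>v\<in>V. \<exists>p\<in>Vp. \<exists>m\<in>Vm. v = p + m) \<and> Vp \<inter> Vm = {0} \<and>
     (\<forall>p\<in>Vp. \<forall>m\<in>Vm. ip p m = 0) \<and>
     hilbert_wrt Vp ip \<and> hilbert_wrt Vm (\<lambda>x y. - ip x y) \<and> (\<exists>n. cdim_is Vm n)"

definition pontryagin :: "'a::cvec set \<Rightarrow> ('a \<Rightarrow> 'a \<Rightarrow> complex) \<Rightarrow> bool" where
  "pontryagin V ip \<longleftrightarrow> csubspace V \<and> herm_form V ip \<and> (\<exists>Vp Vm. fund_decomp V ip Vp Vm)"

text \<open>Index of negativity: dim V- (independent of the fundamental decomposition).\<close>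
definition ind_minus :: "'a::cvec set \<Rightarrow> ('a \<Rightarrow> 'a \<Rightarrow> complex) \<Rightarrow> nat" where
  "ind_minus V ip = (THE n. \<exists>Vp Vm. fund_decomp V ip Vp Vm \<and> cdim_is Vm n)"

definition wk_analytic :: "'c::cvec set \<Rightarrow> ('c \<Rightarrow> 'c \<Rightarrow> complex) \<Rightarrow> complex set \<Rightarrow> (complex \<Rightarrow> 'c) \<Rightarrow> bool" where
  "wk_analytic C ip U f \<longleftrightarrow> (\<forall>z\<in>U. f z \<in> C) \<and> (\<forall>c\<in>C. (\<lambda>z. ip (f z) c) holomorphic_on U)"

definition wk_deriv :: "'c::cvec set \<Rightarrow> ('c \<Rightarrow> 'c \<Rightarrow> complex) \<Rightarrow> (complex \<Rightarrow> 'c) \<Rightarrow> complex \<Rightarrow> 'c" where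
  "wk_deriv C ip f a = (THE v. v \<in> C \<and> (\<forall>c\<in>C. deriv (\<lambda>z. ip (f z) c) a = ip v c))"

text \<open>Functions on \<Omega> are represented by their extension by 0 outside \<Omega>.\<close>
definition Rop :: "'c::cvec set \<Rightarrow> ('c \<Rightarrow> 'c \<Rightarrow> complex) \<Rightarrow> complex set \<Rightarrow> complex \<Rightarrow> (complex \<Rightarrow> 'c) \<Rightarrow> complex \<Rightarrow> 'c" where
  "Rop C ip \<Omega> \<alpha> f = (\<lambda>z. if z \<notin> \<Omega> then 0
       else if z = \<alpha> then wk_deriv C ip f \<alpha> else cscale (inverse (z - \<alpha>)) (f z - f \<alpha>))"

definition is_rep_kernel :: "(complex \<Rightarrow> 'c) set \<Rightarrow> ((complex \<Rightarrow> 'c) \<Rightarrow> (complex \<Rightarrow> 'c) \<Rightarrow> complex)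
    \<Rightarrow> 'c::cvec set \<Rightarrow> ('c \<Rightarrow> 'c \<Rightarrow> complex) \<Rightarrow> complex set \<Rightarrow> (complex \<Rightarrow> complex \<Rightarrow> 'c \<Rightarrow> 'c) \<Rightarrow> bool" where
  "is_rep_kernel P ipP C ipC \<Omega> K \<longleftrightarrow>
     (\<forall>w\<in>\<Omega>. \<forall>c\<in>C. (\<lambda>z. if z \<in> \<Omega> then K z w c else 0) \<in> P \<and>
        (\<forall>f\<in>P. ipP f (\<lambda>z. if z \<in> \<Omega> then K z w c else 0) = ipC (f w) c))"

definition wk_meromorphic_on :: "'c::cvec set \<Rightarrow> ('c \<Rightarrow> 'c \<Rightarrow> complex) \<Rightarrow> complex set \<Rightarrow> (complex \<Rightarrow> 'c) \<Rightarrow> complex set \<Rightarrow> bool" where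
  "wk_meromorphic_on C ip U g E \<longleftrightarrow> E \<subseteq> U \<and> (\<forall>z\<in>U. \<not> z islimpt E) \<and>
     wk_analytic C ip (U - E) g \<and>
     (\<forall>e\<in>E. \<exists>n::nat. \<exists>r>0. \<exists>h. ball e r \<subseteq> U \<and> wk_analytic C ip (ball e r) h \<and>
        (\<forall>z\<in>ball e r - {e}. h z = cscale ((z - e) ^ n) (g z)))"

definition right_half_plane :: "complex set" where
  "right_half_plane = {z. Re z > 0}"

definition is_adjoint :: "'d::cvec set \<Rightarrow> ('d \<Rightarrow> 'd \<Rightarrow> complex) \<Rightarrow> 'c::cvec set \<Rightarrow> ('c \<Rightarrow> 'c \<Rightarrow> complex)
    \<Rightarrow> ('d \<Rightarrow> 'c) \<Rightarrow> ('c \<Rightarrow> 'd) \<Rightarrow> bool" where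
  "is_adjoint D ipD C ipC T T' \<longleftrightarrow> (\<forall>c\<in>C. T' c \<in> D) \<and> (\<forall>x\<in>D. \<forall>c\<in>C. ipC (T x) c = ipD x (T' c))"

text \<open>Bounded linear operator D \<rightarrow> C (everywhere defined linear operators with an adjoint
  are exactly the bounded ones, by the closed graph theorem).\<close>
definition bounded_op :: "'d::cvec set \<Rightarrow> ('d \<Rightarrow> 'd \<Rightarrow> complex) \<Rightarrow> 'c::cvec set \<Rightarrow> ('c \<Rightarrow> 'c \<Rightarrow> complex)
    \<Rightarrow> ('d \<Rightarrow> 'c) \<Rightarrow> bool" where
  "bounded_op D ipD C ipC T \<longleftrightarrow> (\<forall>x\<in>D. T x \<in> C) \<and>
     (\<forall>x\<in>D. \<forall>y\<in>D. \<forall>a. T (cscale a x + y) = cscale a (T x) + T y) \<and>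
     (\<exists>T'. is_adjoint D ipD C ipC T T')"

definition adj :: "'d::cvec set \<Rightarrow> ('d \<Rightarrow> 'd \<Rightarrow> complex) \<Rightarrow> 'c::cvec set \<Rightarrow> ('c \<Rightarrow> 'c \<Rightarrow> complex)
    \<Rightarrow> ('d \<Rightarrow> 'c) \<Rightarrow> ('c \<Rightarrow> 'd)" where
  "adj D ipD C ipC T = (SOME T'. is_adjoint D ipD C ipC T T')"

definition num_neg_eig :: "complex mat \<Rightarrow> nat" where
  "num_neg_eig M = (\<Sum>a\<in>{a. poly (char_poly M) a = 0 \<and> Im a = 0 \<and> Re a < 0}. order a (char_poly M))"

definition gram_mat :: "('c \<Rightarrow> 'c \<Rightarrow> complex) \<Rightarrow> (complex \<Rightarrow> complex \<Rightarrow> 'c \<Rightarrow> 'c)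
    \<Rightarrow> nat \<Rightarrow> (nat \<Rightarrow> complex) \<Rightarrow> (nat \<Rightarrow> 'c) \<Rightarrow> complex mat" where
  "gram_mat ipC k N ws cs = mat N N (\<lambda>(l, j). ipC (k (ws l) (ws j) (cs j)) (cs l))"

definition neg_squares :: "'c::cvec set \<Rightarrow> ('c \<Rightarrow> 'c \<Rightarrow> complex) \<Rightarrow> complex set
    \<Rightarrow> (complex \<Rightarrow> complex \<Rightarrow> 'c \<Rightarrow> 'c) \<Rightarrow> nat \<Rightarrow> bool" where
  "neg_squares C ipC U k \<kappa> \<longleftrightarrow>
     (\<forall>z\<in>U. \<forall>w\<in>U. \<forall>c\<in>C. k z w c \<in> C) \<and>
     (\<forall>z\<in>U. \<forall>w\<in>U. \<forall>c\<in>C. \<forall>d\<in>C. ipC (k z w c) d = ipC c (k w z d)) \<and>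
     (\<forall>N ws cs. (\<forall>i<N. ws i \<in> U \<and> cs i \<in> C) \<longrightarrow> num_neg_eig (gram_mat ipC k N ws cs) \<le> \<kappa>) \<and>
     (\<exists>N ws cs. (\<forall>i<N. ws i \<in> U \<and> cs i \<in> C) \<and> num_neg_eig (gram_mat ipC k N ws cs) = \<kappa>)"

definition KS :: "'d::cvec set \<Rightarrow> ('d \<Rightarrow> 'd \<Rightarrow> complex) \<Rightarrow> 'c::cvec set \<Rightarrow> ('c \<Rightarrow> 'c \<Rightarrow> complex)
    \<Rightarrow> (complex \<Rightarrow> 'd \<Rightarrow> 'c) \<Rightarrow> complex \<Rightarrow> complex \<Rightarrow> 'c \<Rightarrow> 'c" where
  "KS D ipD C ipC S z w c =
     cscale (inverse (2 * complex_of_real pi * (z + cnj w))) (c - S z (adj D ipD C ipC (S w) c))"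

definition gen_schur :: "nat \<Rightarrow> 'd::cvec set \<Rightarrow> ('d \<Rightarrow> 'd \<Rightarrow> complex) \<Rightarrow> 'c::cvec set \<Rightarrow> ('c \<Rightarrow> 'c \<Rightarrow> complex)
    \<Rightarrow> (complex \<Rightarrow> 'd \<Rightarrow> 'c) \<Rightarrow> complex set \<Rightarrow> bool" where
  "gen_schur \<kappa> D ipD C ipC S U \<longleftrightarrow>
     pontryagin D ipD \<and> pontryagin C ipC \<and> ind_minus D ipD = ind_minus C ipC \<and>
     open U \<and> U \<noteq> {} \<and> U \<subseteq> right_half_plane \<and>
     (\<forall>z\<in>U. bounded_op D ipD C ipC (S z)) \<and>
     (\<forall>d\<in>D. wk_analytic C ipC U (\<lambda>z. S z d)) \<and>
     neg_squares C ipC U (KS D ipD C ipC S) \<kappa>"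

end

theory Submission
  imports Defs "Jordan_Normal_Form.Schur_Decomposition"
begin

text \<open>
  Put a = Re \<open>\<alpha>\<close> and \<open>A = I + 2a R\<^sub>\<alpha>\<close>. The inequality says that \<open>G f = (A f, \<surd>(4\<pi>a) f(\<alpha>))\<close> is a
  contraction from P into \<open>M = P \<oplus> C\<close>. By inertia the defect \<open>T = I - G G\<^sup>*\<close> then has exactly
  \<open>ind\<^sub>-(C)\<close> negative squares, so it is the kernel of a Pontryagin space \<open>C\<^sub>1 \<subseteq> M\<close> of that index,
  characterized by \<open>[u, T m] = [u, m]\<^sub>M\<close>. The function \<open>S(z)(p, c) = c + \<surd>(\<pi>/a) (z - \<alpha>) p(z)\<close> on
  \<open>C\<^sub>1\<close> is the characteristic function of the resulting coisometric colligation with the resolvent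
  eliminated, hence defined on all of \<open>\<Omega>\<close>; its adjoint at w is T applied to the adjoint of the same
  formula on M, and \<open>G\<^sup>*\<close> maps the latter vectors to multiples of kernel functions.

  For the extension, approximating the negative part of P by combinations of kernel functions shows
  that A is bounded, and then that it is a Hilbert space contraction up to finite rank.
  Hence \<open>(I - \<lambda> A)\<^sup>-\<^sup>1\<close> is meromorphic in the unit disc, and
  \<open>f(z) = [(I - (z - \<alpha>) R\<^sub>\<alpha>)\<^sup>-\<^sup>1 f](\<alpha>)\<close> with \<open>\<lambda> = (z - \<alpha>) / (z + cnj \<alpha>)\<close> extends f.
\<close>

section \<open>Hermitian spaces and the law of inertia\<close>

text \<open>Multiplying the inequality by \<open>2a\<close> and completing the square gives
  \<open>[A f, A f] + 4\<pi>a [f(\<alpha>), f(\<alpha>)] \<le> [f, f]\<close>; this is the origin of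
  A and of the weight \<open>\<surd>(4\<pi>a)\<close>. The factor \<open>\<surd>(\<pi>/a)\<close> in
  S is the one for which the terms in f(\<alpha>) cancel in \<open>S(z) G f\<close>. With the Cayley
  parameter \<lambda>, \<open>I - \<lambda> A\<close> is a scalar multiple of
  \<open>I - (z - \<alpha>) R\<close>, and the value of \<open>(I - (z - \<alpha>) R) y\<close> at z
  is y(\<alpha>): the extension needs evaluation at one fixed point only.

  The obstacle is that a contraction between indefinite spaces need not come with a norm bound, and
  none is given for R. Boundedness of A and then its adjoint have to be extracted from the density
  of kernel functions and the finiteness of the indices. Square roots and spectral decompositions of
  operators are avoided: indices are compared through maximal negative families, and eigenvalues
  occur only for finite Gram matrices.\<close>

interpretation cv: vector_space "cscale :: complex \<Rightarrow> 'a::cvec \<Rightarrow> 'a"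
  by unfold_locales (simp_all add: cscale_add_right cscale_add_left cscale_mult cscale_one)

lemma csubspace_iff: "csubspace V \<longleftrightarrow> cv.subspace V"
  by (auto simp: csubspace_def cv.subspace_def)

lemma cspan_eq_span: "cspan B = cv.span B"
  by (auto simp: cspan_def cv.span_explicit)

lemma cindep_iff: "cindep B \<longleftrightarrow> cv.independent B"
  unfolding cindep_def cv.dependent_explicit by blast

lemma cdim_is_dim: "cdim_is V n \<Longrightarrow> cv.dim V = n"
  unfolding cdim_is_def cspan_eq_span cindep_iff by (metis cv.dim_span_eq_card_independent)

lemma fun_sum_apply: "(\<Sum>i\<in>I. f i) z = (\<Sum>i\<in>I. (f i z :: 'b::comm_monoid_add))"
  by (induction I rule: infinite_finite_induct) auto

text \<open>If \<open>g i = g j\<close> with \<open>i \<noteq> j\<close>, the coefficients 1 and -1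
  at these places give a nontrivial relation; so the indexed condition also yields injectivity, and
  index bounds can be compared with cardinalities of images.\<close>

lemma cv_independent_family:
  assumes "\<And>c. (\<Sum>j<(l::nat). cscale (c j) (g j)) = 0 \<Longrightarrow> \<forall>j<l. c j = 0"
  shows "inj_on g {..<l}" "cv.independent (g ` {..<l})"
proof -
  show inj: "inj_on g {..<l}"
  proof (rule inj_onI, rule ccontr)
    fix i j assume ij: "i \<in> {..<l}" "j \<in> {..<l}" "g i = g j" "i \<noteq> j"
    define c :: "nat \<Rightarrow> complex" where "c = (\<lambda>k. if k = i then 1 else if k = j then -1 else 0)"
    have "(\<Sum>k<l. cscale (c k) (g k)) = (\<Sum>k\<in>{i,j}. cscale (c k) (g k))"
      by (rule sum.mono_neutral_right) (use ij in \<open>auto simp: c_def\<close>)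
    also have "\<dots> = 0" using ij by (auto simp: c_def cscale_one)
    finally show False using assms[of c] ij by (auto simp: c_def)
  qed
  show "cv.independent (g ` {..<l})"
  proof (rule cv.independent_if_scalars_zero)
    show "finite (g ` {..<l})" by simp
    fix f x assume "(\<Sum>x\<in>g ` {..<l}. cscale (f x) x) = 0" and x: "x \<in> g ` {..<l}"
    then have "(\<Sum>j<l. cscale (f (g j)) (g j)) = 0" by (simp add: sum.reindex[OF inj])
    from assms[OF this] show "f x = 0" using x by auto
  qed
qed

text \<open>Several forms live on the same carrier set, so norm, convergence and the Cauchy property
  all take the form as a parameter.\<close>

definition fnorm :: "('a \<Rightarrow> 'a \<Rightarrow> complex) \<Rightarrow> 'a \<Rightarrow> real" where
  "fnorm ip x = sqrt (Re (ip x x))"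

definition fconv :: "('a::cvec \<Rightarrow> 'a \<Rightarrow> complex) \<Rightarrow> (nat \<Rightarrow> 'a) \<Rightarrow> 'a \<Rightarrow> bool" where
  "fconv ip s y \<longleftrightarrow> (\<lambda>n. fnorm ip (s n - y)) \<longlonglongrightarrow> 0"

definition fcauchy :: "('a::cvec \<Rightarrow> 'a \<Rightarrow> complex) \<Rightarrow> (nat \<Rightarrow> 'a) \<Rightarrow> bool" where
  "fcauchy ip s \<longleftrightarrow> (\<forall>e>0. \<exists>N. \<forall>m\<ge>N. \<forall>n\<ge>N. fnorm ip (s m - s n) < e)"

definition negfam :: "'a::cvec set \<Rightarrow> ('a \<Rightarrow> 'a \<Rightarrow> complex) \<Rightarrow> nat \<Rightarrow> (nat \<Rightarrow> 'a) \<Rightarrow> bool" where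
  "negfam V ip n e \<longleftrightarrow> (\<forall>i<n. e i \<in> V) \<and> (\<forall>i<n. \<forall>j<n. ip (e i) (e j) = (if i = j then -1 else 0))"

text \<open>The form with its sign flipped on the span of \<open>e\<close>. Since each
  \<open>e i\<close> has square -1, the component of x in this span is minus the sum of the
  \<open>ip x (e i)\<close> multiples of \<open>e i\<close>; subtracting its contribution twice
  produces the plus sign.\<close>

definition hform :: "('a \<Rightarrow> 'a \<Rightarrow> complex) \<Rightarrow> nat \<Rightarrow> (nat \<Rightarrow> 'a) \<Rightarrow> 'a \<Rightarrow> 'a \<Rightarrow> complex" where
  "hform ip n e x y = ip x y + 2 * (\<Sum>i<n. ip x (e i) * ip (e i) y)"

text \<open>Nonnegativity of the flipped form says that no negative vector is orthogonal to the
  family. This certificate of maximality also makes sense in degenerate or incomplete spaces, such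
  as spans of finitely many vectors or a defect form.\<close>

definition maxneg :: "'a::cvec set \<Rightarrow> ('a \<Rightarrow> 'a \<Rightarrow> complex) \<Rightarrow> nat \<Rightarrow> (nat \<Rightarrow> 'a) \<Rightarrow> bool" where
  "maxneg V ip n e \<longleftrightarrow> negfam V ip n e \<and> (\<forall>x\<in>V. 0 \<le> Re (hform ip n e x x))"

locale herm_space =
  fixes V :: "'a::cvec set" and ip :: "'a \<Rightarrow> 'a \<Rightarrow> complex"
  assumes sub: "csubspace V" and herm: "herm_form V ip"
begin

lemma zero_mem[simp]: "0 \<in> V" using sub by (auto simp: csubspace_def)
lemma add_mem[simp]: "x \<in> V \<Longrightarrow> y \<in> V \<Longrightarrow> x + y \<in> V" using sub by (auto simp: csubspace_def)
lemma scale_mem[simp]: "x \<in> V \<Longrightarrow> cscale a x \<in> V" using sub by (auto simp: csubspace_def)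
lemma minus_mem[simp]: "x \<in> V \<Longrightarrow> - x \<in> V" using scale_mem[of x "-1"] by simp
lemma diff_mem[simp]: "x \<in> V \<Longrightarrow> y \<in> V \<Longrightarrow> x - y \<in> V" using add_mem[of x "-y"] by simp
lemma sum_mem[simp]: "\<forall>i\<in>I. f i \<in> V \<Longrightarrow> sum f I \<in> V"
  by (induction I rule: infinite_finite_induct) auto
lemma subspaceV: "cv.subspace V" using sub by (simp add: csubspace_iff)

lemma lin: "x \<in> V \<Longrightarrow> y \<in> V \<Longrightarrow> z \<in> V \<Longrightarrow> ip (cscale a x + y) z = a * ip x z + ip y z"
  using herm unfolding herm_form_def by blast
lemma sym: "x \<in> V \<Longrightarrow> y \<in> V \<Longrightarrow> ip x y = cnj (ip y x)"
  using herm unfolding herm_form_def by blast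

lemma add_left[simp]: "x \<in> V \<Longrightarrow> y \<in> V \<Longrightarrow> z \<in> V \<Longrightarrow> ip (x + y) z = ip x z + ip y z"
  using lin[of x y z 1] by (simp add: cscale_one)
lemma zero_left[simp]: "z \<in> V \<Longrightarrow> ip 0 z = 0"
  using add_left[of 0 0 z] by simp
lemma scale_left[simp]: "x \<in> V \<Longrightarrow> z \<in> V \<Longrightarrow> ip (cscale a x) z = a * ip x z"
  using lin[of x 0 z a] by simp
lemma minus_left[simp]: "x \<in> V \<Longrightarrow> z \<in> V \<Longrightarrow> ip (- x) z = - ip x z"
  using scale_left[of x z "-1"] by simp
lemma diff_left[simp]: "x \<in> V \<Longrightarrow> y \<in> V \<Longrightarrow> z \<in> V \<Longrightarrow> ip (x - y) z = ip x z - ip y z"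
  using add_left[of x "-y" z] by simp
lemma sum_left[simp]: "\<forall>i\<in>I. f i \<in> V \<Longrightarrow> z \<in> V \<Longrightarrow> ip (sum f I) z = (\<Sum>i\<in>I. ip (f i) z)"
  by (induction I rule: infinite_finite_induct) auto

lemma add_right[simp]: "x \<in> V \<Longrightarrow> y \<in> V \<Longrightarrow> z \<in> V \<Longrightarrow> ip z (x + y) = ip z x + ip z y"
  by (subst (1 2 3) sym) auto
lemma zero_right[simp]: "z \<in> V \<Longrightarrow> ip z 0 = 0"
  by (subst sym) auto
lemma scale_right[simp]: "x \<in> V \<Longrightarrow> z \<in> V \<Longrightarrow> ip z (cscale a x) = cnj a * ip z x"
  by (subst (1 2) sym) auto
lemma minus_right[simp]: "x \<in> V \<Longrightarrow> z \<in> V \<Longrightarrow> ip z (- x) = - ip z x"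
  by (subst (1 2) sym) auto
lemma diff_right[simp]: "x \<in> V \<Longrightarrow> y \<in> V \<Longrightarrow> z \<in> V \<Longrightarrow> ip z (x - y) = ip z x - ip z y"
  by (subst (1 2 3) sym) auto
lemma sum_right[simp]: "\<forall>i\<in>I. f i \<in> V \<Longrightarrow> z \<in> V \<Longrightarrow> ip z (sum f I) = (\<Sum>i\<in>I. ip z (f i))"
  by (induction I rule: infinite_finite_induct) auto

lemma self_real: "x \<in> V \<Longrightarrow> ip x x = complex_of_real (Re (ip x x))"
  using sym[of x x] by (metis Reals_cnj_iff of_real_Re)

lemma herm_space_sub: "csubspace W \<Longrightarrow> W \<subseteq> V \<Longrightarrow> herm_space W ip"
  using herm unfolding herm_space_def herm_form_def subset_eq by blast

lemma mult_sym: "x \<in> V \<Longrightarrow> y \<in> V \<Longrightarrow> ip x y * ip y x = complex_of_real ((cmod (ip x y))\<^sup>2)"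
  by (subst (2) sym) (auto simp: complex_norm_square simp del: of_real_power)

lemma scale_real_self: "x \<in> V \<Longrightarrow> ip (cscale (of_real r) x) (cscale (of_real r) x) = of_real (r * r * Re (ip x x))"
  using self_real[of x] by (simp add: mult.assoc)

lemma hform_herm: 
  assumes "\<forall>i<n. e i \<in> V" shows "herm_space V (hform ip n e)"
proof unfold_locales
  show "csubspace V" by (rule sub)
  have *: "hform ip n e x y = cnj (hform ip n e y x)" if "x \<in> V" "y \<in> V" for x y
    unfolding hform_def using that assms sym[of x y]
    by (auto simp: cnj_sum sym[of x "e _"] sym[of "e _" y] intro!: sum.cong)
  show "herm_form V (hform ip n e)"
    unfolding herm_form_def
  proof (intro conjI ballI allI)
    fix x y z a assume "x \<in> V" "y \<in> V" "z \<in> V"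
    then show "hform ip n e (cscale a x + y) z = a * hform ip n e x z + hform ip n e y z"
      using assms by (auto simp: hform_def algebra_simps sum.distrib sum_distrib_left)
  qed (use * in blast)
qed

lemma hform_self: 
  assumes "\<forall>i<n. e i \<in> V" "x \<in> V" 
  shows "hform ip n e x x = ip x x + 2 * of_real (\<Sum>i<n. (cmod (ip x (e i)))\<^sup>2)"
  unfolding hform_def using assms by (simp add: mult_sym del: of_real_power)

lemma hform_e: 
  assumes "negfam V ip n e" "j < n" "x \<in> V" 
  shows "hform ip n e x (e j) = - ip x (e j)"
proof -
  have "(\<Sum>i<n. ip x (e i) * ip (e i) (e j)) = (\<Sum>i<n. if i = j then - ip x (e j) else 0)"
    using assms by (intro sum.cong) (auto simp: negfam_def)
  then show ?thesis using assms(2) by (simp add: hform_def)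
qed

text \<open>The projection off the family adds the sum instead of subtracting it because the vectors
  \<open>e i\<close> have square -1.\<close>

lemma proj_orth:
  assumes "negfam V ip n e" "x \<in> V" "j < n"
  shows "ip (x + (\<Sum>i<n. cscale (ip x (e i)) (e i))) (e j) = 0"
proof -
  have "(\<Sum>i<n. ip x (e i) * ip (e i) (e j)) = (\<Sum>i<n. if i = j then - ip x (e j) else 0)"
    using assms by (intro sum.cong) (auto simp: negfam_def)
  then show ?thesis using assms by (simp add: negfam_def)
qed

lemma proj_self:
  assumes "negfam V ip n e" "x \<in> V"
  defines "y \<equiv> x + (\<Sum>i<n. cscale (ip x (e i)) (e i))"
  shows "ip y y = ip x x + of_real (\<Sum>i<n. (cmod (ip x (e i)))\<^sup>2)"
proof -
  have e: "\<And>i. i < n \<Longrightarrow> e i \<in> V" using assms(1) by (auto simp: negfam_def)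
  have y: "y \<in> V" unfolding y_def using assms(2) e by auto
  have "ip y y = ip y x + (\<Sum>i<n. cnj (ip x (e i)) * ip y (e i))"
    by (subst (2) y_def) (use assms(2) e y in \<open>simp del: sum_left\<close>)
  also have "(\<Sum>i<n. cnj (ip x (e i)) * ip y (e i)) = 0"
    unfolding y_def using proj_orth[OF assms(1,2)] by (intro sum.neutral) auto
  also have "ip y x = ip x x + (\<Sum>i<n. ip x (e i) * ip (e i) x)"
    unfolding y_def using assms e by simp
  finally show ?thesis using e assms(2) by (simp add: mult_sym del: of_real_power)
qed

lemma negfam_comb:
  assumes "negfam V ip n e" "j < n"
  shows "ip (\<Sum>i<n. cscale (c i) (e i)) (e j) = - c j"
proof -
  have "(\<Sum>i<n. c i * ip (e i) (e j)) = (\<Sum>i<n. if i = j then - c j else 0)"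
    using assms by (intro sum.cong) (auto simp: negfam_def)
  then show ?thesis using assms by (simp add: negfam_def)
qed

lemma negfam_comb_self:
  assumes "negfam V ip n e"
  shows "Re (ip (\<Sum>i<n. cscale (c i) (e i)) (\<Sum>i<n. cscale (c i) (e i))) = - (\<Sum>i<n. (cmod (c i))\<^sup>2)"
proof -
  have e: "\<And>i. i < n \<Longrightarrow> e i \<in> V" using assms(1) by (auto simp: negfam_def)
  let ?x = "\<Sum>i<n. cscale (c i) (e i)"
  have "ip ?x ?x = (\<Sum>j<n. cnj (c j) * ip ?x (e j))"
    by (subst sum_right) (use e in \<open>auto intro!: sum.cong simp del: sum_left\<close>)
  also have "\<dots> = (\<Sum>j<n. - of_real ((cmod (c j))\<^sup>2))"
    by (intro sum.cong refl) (use negfam_comb[OF assms] in \<open>simp add: complex_norm_square mult.commute del: sum_left of_real_power\<close>)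
  finally show ?thesis by (simp add: sum_negf del: sum_left sum_right)
qed

lemma negfam_independent:
  assumes "negfam V ip n e"
  shows "inj_on e {..<n}" "cv.independent (e ` {..<n})"
proof -
  have "\<forall>j<n. c j = 0" if "(\<Sum>j<n. cscale (c j) (e j)) = 0" for c
  proof (intro allI impI)
    fix j assume j: "j < n"
    have "e j \<in> V" using assms j by (auto simp: negfam_def)
    then show "c j = 0" using negfam_comb[OF assms j, of c] that by simp
  qed
  from cv_independent_family[OF this] show "inj_on e {..<n}" "cv.independent (e ` {..<n})" by blast+
qed

text \<open>Project the span of \<open>f\<close> onto the span of \<open>e\<close>. A vector in the
  kernel is orthogonal to every \<open>e i\<close>, so its square is nonnegative by maximality; as a
  combination of the \<open>f j\<close> its square is minus a sum of squares. Hence the projection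
  is injective and dimensions can be compared.\<close>

theorem inertia:
  assumes e: "maxneg V ip k e" and f: "negfam V ip l f"
  shows "l \<le> k"
proof -
  have en: "negfam V ip k e" using e by (simp add: maxneg_def)
  have eV: "\<And>i. i < k \<Longrightarrow> e i \<in> V" using en by (auto simp: negfam_def)
  have fV: "\<And>i. i < l \<Longrightarrow> f i \<in> V" using f by (auto simp: negfam_def)
  define g where "g j = (\<Sum>i<k. cscale (ip (f j) (e i)) (e i))" for j
  have "\<forall>j<l. c j = 0" if c: "(\<Sum>j<l. cscale (c j) (g j)) = 0" for c
  proof -
    define x where "x = (\<Sum>j<l. cscale (c j) (f j))"
    have x: "x \<in> V" unfolding x_def using fV by auto
    have ipx: "ip x (e i) = (\<Sum>j<l. c j * ip (f j) (e i))" if "i < k" for i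
      unfolding x_def using fV eV that by simp
    have "0 = (\<Sum>j<l. \<Sum>i<k. cscale (c j * ip (f j) (e i)) (e i))"
      using c by (simp add: g_def cv.scale_sum_right cscale_mult)
    also have "\<dots> = (\<Sum>i<k. \<Sum>j<l. cscale (c j * ip (f j) (e i)) (e i))" by (rule sum.swap)
    also have "\<dots> = (\<Sum>i<k. cscale (ip x (e i)) (e i))"
      by (intro sum.cong refl) (simp add: cv.scale_sum_left ipx)
    finally have z: "(\<Sum>i<k. cscale (ip x (e i)) (e i)) = 0" by simp
    have o: "ip x (e j) = 0" if "j < k" for j
      using negfam_comb[OF en that, of "\<lambda>i. ip x (e i)"] z eV that by (simp del: sum_left)
    then have "hform ip k e x x = ip x x"
      by (simp add: hform_def)
    then have "0 \<le> Re (ip x x)" using e x by (auto simp: maxneg_def)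
    moreover have "Re (ip x x) = - (\<Sum>i<l. (cmod (c i))\<^sup>2)"
      unfolding x_def by (rule negfam_comb_self[OF f])
    ultimately have "(\<Sum>i<l. (cmod (c i))\<^sup>2) = 0"
      using sum_nonneg[of "{..<l}" "\<lambda>i. (cmod (c i))\<^sup>2"] by simp
    then show ?thesis by (subst (asm) sum_nonneg_eq_0_iff) auto
  qed
  from cv_independent_family[OF this]
  have inj: "inj_on g {..<l}" and ind: "cv.independent (g ` {..<l})" by blast+
  have "g ` {..<l} \<subseteq> cv.span (e ` {..<k})"
    unfolding g_def by (intro image_subsetI cv.span_sum cv.span_scale cv.span_base) auto
  from cv.independent_span_bound[OF _ ind this] have "card (g ` {..<l}) \<le> card (e ` {..<k})" by simp
  also have "\<dots> \<le> k" using card_image_le[of "{..<k}" e] by simp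
  finally show ?thesis by (simp add: card_image[OF inj])
qed

lemma inertia_eq: "maxneg V ip k e \<Longrightarrow> maxneg V ip l f \<Longrightarrow> k = l"
  using inertia[of k e l f] inertia[of l f k e] by (auto simp: maxneg_def)

text \<open>The component y of x orthogonal to the family has a square at most that of x in the
  flipped form, so y is negative and can be normalized and appended.\<close>

lemma negfam_extend:
  assumes e: "negfam V ip k e" and x: "x \<in> V" and neg: "Re (hform ip k e x x) < 0"
  shows "\<exists>e'. negfam V ip (Suc k) e'"
proof -
  have eV: "\<And>i. i < k \<Longrightarrow> e i \<in> V" using e by (auto simp: negfam_def)
  define y where "y = x + (\<Sum>i<k. cscale (ip x (e i)) (e i))"
  have y: "y \<in> V" unfolding y_def using x eV by auto
  have o: "ip y (e j) = 0" "ip (e j) y = 0" if "j < k" for j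
    using proj_orth[OF e x that] sym[OF eV[OF that] y] by (auto simp: y_def)
  have "Re (ip y y) = Re (ip x x) + (\<Sum>i<k. (cmod (ip x (e i)))\<^sup>2)"
    unfolding y_def by (simp add: proj_self[OF e x] del: add_left sum_left)
  moreover have "Re (hform ip k e x x) = Re (ip x x) + 2 * (\<Sum>i<k. (cmod (ip x (e i)))\<^sup>2)"
    using hform_self[of k e x] eV x by simp
  moreover have "(\<Sum>i<k. (cmod (ip x (e i)))\<^sup>2) \<ge> 0" by (intro sum_nonneg) auto
  ultimately have yneg: "Re (ip y y) < 0" using neg by linarith
  define r where "r = sqrt (- Re (ip y y))"
  have r: "r > 0" "r * r = - Re (ip y y)" using yneg by (auto simp: r_def)
  define u where "u = cscale (of_real (1 / r)) y"
  have u: "u \<in> V" using y by (simp add: u_def)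
  have "Re (ip y y) = - (r * r)" using r by simp
  then have "(1 / r) * (1 / r) * Re (ip y y) = -1" using r(1) by simp
  then have uu: "ip u u = -1" unfolding u_def scale_real_self[OF y] by simp
  have "negfam V ip (Suc k) (e(k := u))"
    unfolding negfam_def using e eV u uu o y by (auto simp: less_Suc_eq u_def negfam_def)
  then show ?thesis by blast
qed

text \<open>The bound on lengths provides a longest family, which is maximal since
  \<open>negfam_extend\<close> would otherwise lengthen it.\<close>

lemma maxneg_exists:
  assumes "\<And>k e. negfam V ip k e \<Longrightarrow> k \<le> b"
  shows "\<exists>k e. maxneg V ip k e"
proof -
  have "\<exists>e. negfam V ip 0 e" by (simp add: negfam_def)
  then have "\<exists>k. (\<exists>e. negfam V ip k e) \<and> (\<forall>l. (\<exists>e. negfam V ip l e) \<longrightarrow> l \<le> k)"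
    by (rule ex_has_greatest_nat[of "\<lambda>k. \<exists>e. negfam V ip k e" 0 "\<lambda>k. k" "Suc b"]) (use assms in \<open>auto simp: less_Suc_eq_le\<close>)
  then obtain k where k: "\<exists>e. negfam V ip k e" and max: "\<And>l. \<exists>e. negfam V ip l e \<Longrightarrow> l \<le> k"
    by auto
  from k obtain e where e: "negfam V ip k e" by blast
  have "maxneg V ip k e"
    unfolding maxneg_def using e negfam_extend[OF e] max[of "Suc k"] by (meson Suc_n_not_le_n not_le)
  then show ?thesis by blast
qed

end

section \<open>Positive semidefinite forms: seminorm, convergence, Cauchy sequences\<close>

locale psd_space = herm_space +
  assumes nonneg: "x \<in> V \<Longrightarrow> 0 \<le> Re (ip x x)"
begin

lemma sq_fnorm: "x \<in> V \<Longrightarrow> (fnorm ip x)\<^sup>2 = Re (ip x x)" by (simp add: fnorm_def nonneg)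
lemma fnorm_nonneg[simp]: "x \<in> V \<Longrightarrow> 0 \<le> fnorm ip x" by (simp add: fnorm_def nonneg)

lemma sq_add: "x \<in> V \<Longrightarrow> y \<in> V \<Longrightarrow> Re (ip (x + y) (x + y)) = Re (ip x x) + 2 * Re (ip x y) + Re (ip y y)"
  using sym[of y x] by simp
lemma sq_diff: "x \<in> V \<Longrightarrow> y \<in> V \<Longrightarrow> Re (ip (x - y) (x - y)) = Re (ip x x) - 2 * Re (ip x y) + Re (ip y y)"
  using sym[of y x] by simp

text \<open>Nonnegativity of the square of \<open>x - t r y\<close>, with \<open>r = ip x y\<close>
  and t real, is a quadratic inequality in t. As y may be a nonzero null vector, the case of
  vanishing \<open>ip y y\<close> is separate.\<close>

lemma cauchy_schwarz_sq: 
  assumes x: "x \<in> V" and y: "y \<in> V" 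
  shows "(cmod (ip x y))\<^sup>2 \<le> Re (ip x x) * Re (ip y y)"
proof -
  define r where "r = ip x y"
  have key: "0 \<le> Re (ip x x) - 2 * t * (cmod r)\<^sup>2 + t\<^sup>2 * (cmod r)\<^sup>2 * Re (ip y y)" for t :: real
  proof -
    have "0 \<le> Re (ip (x - cscale (of_real t * r) y) (x - cscale (of_real t * r) y))"
      by (intro nonneg) (use x y in auto)
    also have "\<dots> = Re (ip x x) - 2 * Re (cnj (of_real t * r) * r) + Re ((of_real t * r) * cnj (of_real t * r) * ip y y)"
      by (subst sq_diff) (use x y in \<open>auto simp: r_def mult_ac simp del: times_complex.sel complex_cnj_mult\<close>)
    also have "cnj (of_real t * r) * r = of_real (t * (cmod r)\<^sup>2)"
      by (simp add: complex_norm_square mult.commute del: of_real_power)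
    also have "(of_real t * r) * cnj (of_real t * r) = of_real (t\<^sup>2 * (cmod r)\<^sup>2)"
      by (subst complex_norm_square[symmetric]) (simp add: norm_mult power_mult_distrib)
    finally show ?thesis by simp
  qed
  show ?thesis
  proof (cases "Re (ip y y) = 0")
    case True
    have "cmod r = 0"
    proof (rule ccontr)
      assume "cmod r \<noteq> 0"
      then have p: "(cmod r)\<^sup>2 > 0" by simp
      \<comment> \<open>Without the quadratic term, this t turns the bound into
        \<open>- Re (ip x x) - 2\<close>, a negative number.\<close>
      have "0 \<le> Re (ip x x) - 2 * ((Re (ip x x) + 1) / (cmod r)\<^sup>2) * (cmod r)\<^sup>2"
        using key[of "(Re (ip x x) + 1) / (cmod r)\<^sup>2"] True by simp
      also have "\<dots> = - Re (ip x x) - 2" using p by (simp add: field_simps)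
      finally show False using nonneg[OF x] by simp
    qed
    then show ?thesis using True by (simp add: r_def)
  next
    case False
    then have q: "Re (ip y y) > 0" using nonneg[OF y] by simp
    \<comment> \<open>The value of t that minimizes the quadratic expression.\<close>
    have "0 \<le> Re (ip x x) - (cmod r)\<^sup>2 / Re (ip y y)"
      using key[of "1 / Re (ip y y)"] q by (simp add: power2_eq_square field_simps)
    then show ?thesis using q by (simp add: field_simps r_def)
  qed
qed

lemma cauchy_schwarz: "x \<in> V \<Longrightarrow> y \<in> V \<Longrightarrow> cmod (ip x y) \<le> fnorm ip x * fnorm ip y"
  by (rule power2_le_imp_le) (use cauchy_schwarz_sq[of x y] in \<open>auto simp: power_mult_distrib sq_fnorm\<close>)

lemma fnorm_scale: "x \<in> V \<Longrightarrow> fnorm ip (cscale a x) = cmod a * fnorm ip x"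
proof -
  assume x: "x \<in> V"
  have "Re (ip (cscale a x) (cscale a x)) = Re ((a * cnj a) * ip x x)" using x by (simp add: mult_ac)
  also have "a * cnj a = of_real ((cmod a)\<^sup>2)" by (rule complex_norm_square[symmetric])
  finally show ?thesis by (simp add: fnorm_def real_sqrt_mult del: of_real_power)
qed
lemma fnorm_zero[simp]: "fnorm ip 0 = 0" by (simp add: fnorm_def)
lemma fnorm_uminus[simp]: "x \<in> V \<Longrightarrow> fnorm ip (- x) = fnorm ip x" by (simp add: fnorm_def)
lemma fnorm_commute: "x \<in> V \<Longrightarrow> y \<in> V \<Longrightarrow> fnorm ip (x - y) = fnorm ip (y - x)"
  using fnorm_uminus[of "x - y"] by simp

lemma fnorm_triangle: 
  assumes "x \<in> V" "y \<in> V" shows "fnorm ip (x + y) \<le> fnorm ip x + fnorm ip y"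
proof (rule power2_le_imp_le)
  have "Re (ip x y) \<le> fnorm ip x * fnorm ip y"
    using cauchy_schwarz[OF assms] complex_Re_le_cmod[of "ip x y"] by linarith
  then show "(fnorm ip (x + y))\<^sup>2 \<le> (fnorm ip x + fnorm ip y)\<^sup>2"
    using assms sq_add[OF assms] by (simp add: sq_fnorm power2_sum)
qed (use assms in auto)

lemma fnorm_triangle_diff: "x \<in> V \<Longrightarrow> y \<in> V \<Longrightarrow> fnorm ip (x - y) \<le> fnorm ip x + fnorm ip y"
  using fnorm_triangle[of x "-y"] by simp
lemma fnorm_triangle3: "x \<in> V \<Longrightarrow> y \<in> V \<Longrightarrow> z \<in> V \<Longrightarrow> fnorm ip (x - z) \<le> fnorm ip (x - y) + fnorm ip (y - z)"
  using fnorm_triangle[of "x - y" "y - z"] by simp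
lemma fnorm_sum: "(\<And>i. i \<in> I \<Longrightarrow> f i \<in> V) \<Longrightarrow> fnorm ip (sum f I) \<le> (\<Sum>i\<in>I. fnorm ip (f i))"
proof (induction I rule: infinite_finite_induct)
  case (insert x F)
  then show ?case using fnorm_triangle[of "f x" "sum f F"] by (simp add: add_left_mono order_trans)
qed auto

lemma fconv_ip:
  assumes s: "\<And>n. s n \<in> V" "fconv ip s y" "y \<in> V" and t: "\<And>n. t n \<in> V" "fconv ip t w" "w \<in> V"
  shows "(\<lambda>n. ip (s n) (t n)) \<longlonglongrightarrow> ip y w"
proof -
  have eq: "ip (s n) (t n) - ip y w = ip (s n - y) (t n - w) + ip (s n - y) w + ip y (t n - w)" for n
    using s(1)[of n] s(3) t(1)[of n] t(3) by (simp add: algebra_simps)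
  have "(\<lambda>n. fnorm ip (s n - y) * fnorm ip (t n - w) + fnorm ip (s n - y) * fnorm ip w + fnorm ip y * fnorm ip (t n - w)) \<longlonglongrightarrow> 0 * 0 + 0 * fnorm ip w + fnorm ip y * 0"
    using s(2) t(2) unfolding fconv_def by (intro tendsto_intros)
  then have lim: "(\<lambda>n. fnorm ip (s n - y) * fnorm ip (t n - w) + fnorm ip (s n - y) * fnorm ip w + fnorm ip y * fnorm ip (t n - w)) \<longlonglongrightarrow> 0"
    by simp
  have "norm (ip (s n) (t n) - ip y w) \<le> fnorm ip (s n - y) * fnorm ip (t n - w) + fnorm ip (s n - y) * fnorm ip w + fnorm ip y * fnorm ip (t n - w)" for n
    unfolding eq using s t by (intro norm_triangle_le add_mono cauchy_schwarz) auto
  then have "(\<lambda>n. ip (s n) (t n) - ip y w) \<longlonglongrightarrow> 0"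
    by (intro Lim_null_comparison[OF _ lim] always_eventually allI)
  then show ?thesis by (rule LIM_zero_cancel)
qed

lemma fconv_const: "y \<in> V \<Longrightarrow> fconv ip (\<lambda>_. y) y" by (simp add: fconv_def)

lemma fconv_add: 
  assumes "\<And>n. s n \<in> V" "fconv ip s y" "y \<in> V" "\<And>n. t n \<in> V" "fconv ip t w" "w \<in> V"
  shows "fconv ip (\<lambda>n. s n + t n) (y + w)"
  unfolding fconv_def
proof (rule real_tendsto_sandwich[OF _ _ tendsto_const])
  show "(\<lambda>n. fnorm ip (s n - y) + fnorm ip (t n - w)) \<longlonglongrightarrow> 0"
    using tendsto_add[OF assms(2,5)[unfolded fconv_def]] by simp
  have "fnorm ip (s n + t n - (y + w)) \<le> fnorm ip (s n - y) + fnorm ip (t n - w)" for n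
    using fnorm_triangle[of "s n - y" "t n - w"] assms by (simp add: algebra_simps)
  then show "\<forall>\<^sub>F n in sequentially. fnorm ip (s n + t n - (y + w)) \<le> fnorm ip (s n - y) + fnorm ip (t n - w)" by simp
qed (use assms in auto)

lemma fconv_scale: 
  assumes "\<And>n. s n \<in> V" "fconv ip s y" "y \<in> V"
  shows "fconv ip (\<lambda>n. cscale a (s n)) (cscale a y)"
proof -
  have "fnorm ip (cscale a (s n) - cscale a y) = cmod a * fnorm ip (s n - y)" for n
    using fnorm_scale[of "s n - y" a] assms by (simp add: cv.scale_right_diff_distrib)
  then show ?thesis using tendsto_mult_left[OF assms(2)[unfolded fconv_def], of "cmod a"] by (simp add: fconv_def)
qed

lemma fconv_cauchy: 
  assumes "\<And>n. s n \<in> V" "fconv ip s y" "y \<in> V" shows "fcauchy ip s"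
  unfolding fcauchy_def
proof (intro allI impI)
  fix e :: real assume "e > 0"
  then have "\<forall>\<^sub>F n in sequentially. fnorm ip (s n - y) < e / 2"
    using assms(2) by (intro order_tendstoD) (auto simp: fconv_def)
  then obtain N where N: "\<And>n. n \<ge> N \<Longrightarrow> fnorm ip (s n - y) < e / 2" by (auto simp: eventually_sequentially)
  have "fnorm ip (s m - s n) < e" if "m \<ge> N" "n \<ge> N" for m n
    using fnorm_triangle3[of "s m" y "s n"] fnorm_commute[of y "s n"] N[of m] N[of n] that assms by force
  then show "\<exists>N. \<forall>m\<ge>N. \<forall>n\<ge>N. fnorm ip (s m - s n) < e" by blast
qed

lemma fcauchy_bounded:
  assumes "\<And>n. s n \<in> V" "fcauchy ip s" shows "\<exists>B. \<forall>n. fnorm ip (s n) \<le> B"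
proof -
  have "\<exists>N. \<forall>m\<ge>N. \<forall>n\<ge>N. fnorm ip (s m - s n) < 1"
    using assms(2) unfolding fcauchy_def by simp
  then obtain N where N: "\<And>m n. m \<ge> N \<Longrightarrow> n \<ge> N \<Longrightarrow> fnorm ip (s m - s n) < 1" by auto
  have "fnorm ip (s n) \<le> Max ((\<lambda>n. fnorm ip (s n)) ` {..N}) + 1" for n
  proof (cases "n \<le> N")
    case True
    then have "fnorm ip (s n) \<le> Max ((\<lambda>n. fnorm ip (s n)) ` {..N})" by (intro Max_ge) auto
    then show ?thesis by simp
  next
    case False
    have "fnorm ip (s N) \<le> Max ((\<lambda>n. fnorm ip (s n)) ` {..N})" by (intro Max_ge) auto
    moreover have "fnorm ip (s n) \<le> fnorm ip (s n - s N) + fnorm ip (s N)"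
      using fnorm_triangle[of "s n - s N" "s N"] assms by simp
    moreover have "fnorm ip (s n - s N) < 1" using N False by simp
    ultimately show ?thesis by linarith
  qed
  then show ?thesis by blast
qed

end

section \<open>Hilbert spaces given by a form on a set of vectors\<close>

locale hilb =
  fixes V :: "'a::cvec set" and ip :: "'a \<Rightarrow> 'a \<Rightarrow> complex"
  assumes hilbert: "hilbert_wrt V ip"

sublocale hilb \<subseteq> psd_space V ip
proof
  show s: "csubspace V" "herm_form V ip" using hilbert by (auto simp: hilbert_wrt_def)
  interpret herm_space V ip by unfold_locales (fact s)+
  show "0 \<le> Re (ip x x)" if "x \<in> V" for x
    using hilbert that by (cases "x = 0") (auto simp: hilbert_wrt_def less_imp_le)
qed

text \<open>Mediates between the squared norms in \<open>hilbert_wrt\<close> and the seminorm, for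
  which the triangle inequality is available.\<close>

lemma sq_fcauchy_iff:
  assumes "psd_space V ip" "\<And>n. s n \<in> V"
  shows "fcauchy ip s \<longleftrightarrow> (\<forall>e>0. \<exists>N. \<forall>m\<ge>N. \<forall>n\<ge>N. Re (ip (s m - s n) (s m - s n)) < e)"
proof -
  interpret psd_space V ip by fact
  have n: "Re (ip (s m - s n) (s m - s n)) = (fnorm ip (s m - s n))\<^sup>2" for m n
    using assms(2) by (subst sq_fnorm) auto
  show ?thesis unfolding fcauchy_def n
  proof safe
    fix e :: real assume e: "e > 0" "\<forall>e>0. \<exists>N. \<forall>m\<ge>N. \<forall>n\<ge>N. fnorm ip (s m - s n) < e"
    from e(1) have "sqrt e > 0" by simp
    with e(2) obtain N where N: "\<forall>m\<ge>N. \<forall>n\<ge>N. fnorm ip (s m - s n) < sqrt e" by blast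
    have "(fnorm ip (s m - s n))\<^sup>2 < e" if "m \<ge> N" "n \<ge> N" for m n
      using N that assms(2) power_strict_mono[of "fnorm ip (s m - s n)" "sqrt e" 2] e(1) by force
    then show "\<exists>N. \<forall>m\<ge>N. \<forall>n\<ge>N. (fnorm ip (s m - s n))\<^sup>2 < e" by blast
  next
    fix e :: real assume e: "e > 0" "\<forall>e>0. \<exists>N. \<forall>m\<ge>N. \<forall>n\<ge>N. (fnorm ip (s m - s n))\<^sup>2 < e"
    then obtain N where N: "\<forall>m\<ge>N. \<forall>n\<ge>N. (fnorm ip (s m - s n))\<^sup>2 < e\<^sup>2" by (meson zero_less_power)
    have "fnorm ip (s m - s n) < e" if "m \<ge> N" "n \<ge> N" for m n
      using N that e(1) by (meson less_imp_le power_less_imp_less_base)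
    then show "\<exists>N. \<forall>m\<ge>N. \<forall>n\<ge>N. fnorm ip (s m - s n) < e" by blast
  qed
qed

lemma sq_fconv_iff:
  assumes "psd_space V ip" "\<And>n. s n \<in> V" "y \<in> V"
  shows "fconv ip s y \<longleftrightarrow> (\<lambda>n. Re (ip (s n - y) (s n - y))) \<longlonglongrightarrow> 0"
proof -
  interpret psd_space V ip by fact
  have n: "Re (ip (s n - y) (s n - y)) = (fnorm ip (s n - y))\<^sup>2" for n
    using assms(2,3) by (subst sq_fnorm) auto
  show ?thesis unfolding fconv_def n using tendsto_power[of "\<lambda>n. fnorm ip (s n - y)" 0 sequentially 2]
    tendsto_real_sqrt[of "\<lambda>n. (fnorm ip (s n - y))\<^sup>2" 0 sequentially] assms by auto
qed

lemma hilbI: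
  assumes psd: "psd_space V ip"
    and pos: "\<And>x. x \<in> V \<Longrightarrow> Re (ip x x) = 0 \<Longrightarrow> x = 0"
    and complete: "\<And>s. (\<And>n. s n \<in> V) \<Longrightarrow> fcauchy ip s \<Longrightarrow> \<exists>y\<in>V. fconv ip s y"
  shows "hilb V ip"
proof -
  interpret psd_space V ip by fact
  have "0 < Re (ip x x)" if "x \<in> V" "x \<noteq> 0" for x
    using pos[OF that(1)] nonneg[OF that(1)] that(2) by force
  moreover have "\<exists>y\<in>V. (\<lambda>n. Re (ip (s n - y) (s n - y))) \<longlonglongrightarrow> 0"
    if s: "\<forall>n. s n \<in> V" and c: "\<forall>e>0. \<exists>N. \<forall>m\<ge>N. \<forall>n\<ge>N. Re (ip (s m - s n) (s m - s n)) < e" for s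
  proof -
    have "fcauchy ip s" using sq_fcauchy_iff[OF psd, of s] s c by simp
    then obtain y where "y \<in> V" "fconv ip s y" using complete[of s] s by auto
    then show ?thesis using sq_fconv_iff[OF psd, of s y] s by auto
  qed
  ultimately show ?thesis
    unfolding hilb_def hilbert_wrt_def using sub herm by blast
qed

context hilb begin

lemma definite: "x \<in> V \<Longrightarrow> Re (ip x x) = 0 \<Longrightarrow> x = 0"
  using hilbert by (force simp: hilbert_wrt_def)
lemma definite_fnorm: "x \<in> V \<Longrightarrow> fnorm ip x = 0 \<Longrightarrow> x = 0"
  using definite[of x] sq_fnorm[of x] by simp
lemma complete: 
  assumes s: "\<And>n. s n \<in> V" and c: "fcauchy ip s" shows "\<exists>y\<in>V. fconv ip s y"
proof -
  have c': "\<forall>e>0. \<exists>N. \<forall>m\<ge>N. \<forall>n\<ge>N. Re (ip (s m - s n) (s m - s n)) < e"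
    using c sq_fcauchy_iff[OF psd_space_axioms, of s, OF s] by simp
  have "\<forall>s. (\<forall>n. s n \<in> V) \<and> (\<forall>e>0. \<exists>N. \<forall>m\<ge>N. \<forall>n\<ge>N. Re (ip (s m - s n) (s m - s n)) < e)
        \<longrightarrow> (\<exists>y\<in>V. (\<lambda>n. Re (ip (s n - y) (s n - y))) \<longlonglongrightarrow> 0)"
    using hilbert unfolding hilbert_wrt_def by (elim conjE)
  from spec[OF this, of s] obtain y where "y \<in> V" "(\<lambda>n. Re (ip (s n - y) (s n - y))) \<longlonglongrightarrow> 0" using s c' by auto
  then show ?thesis using sq_fconv_iff[OF psd_space_axioms, of s y] s by auto
qed
lemma fconv_unique:
  assumes "\<And>n. s n \<in> V" "fconv ip s y" "y \<in> V" "fconv ip s w" "w \<in> V" shows "y = w"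
proof -
  have "fnorm ip (y - w) \<le> fnorm ip (s n - y) + fnorm ip (s n - w)" for n
    using fnorm_triangle3[of y "s n" w] fnorm_commute[of y "s n"] assms by simp
  moreover have "(\<lambda>n. fnorm ip (s n - y) + fnorm ip (s n - w)) \<longlonglongrightarrow> 0 + 0"
    using assms unfolding fconv_def by (intro tendsto_intros)
  ultimately have "fnorm ip (y - w) \<le> 0" using LIMSEQ_le_const[of _ 0 "fnorm ip (y - w)"] by simp
  moreover have "0 \<le> fnorm ip (y - w)" using assms by simp
  ultimately have "fnorm ip (y - w) = 0" by linarith
  then show ?thesis using definite_fnorm[of "y - w"] assms by simp
qed

end

section \<open>Fundamental decompositions and orthogonal projection\<close>

lemma herm_spaceI:
  assumes "csubspace V"
    and "\<And>x y z a. x \<in> V \<Longrightarrow> y \<in> V \<Longrightarrow> z \<in> V \<Longrightarrow> ip (cscale a x + y) z = a * ip x z + ip y z"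
    and "\<And>x y. x \<in> V \<Longrightarrow> y \<in> V \<Longrightarrow> ip x y = cnj (ip y x)"
  shows "herm_space V ip"
  using assms unfolding herm_space_def herm_form_def by blast

text \<open>Forms are total functions, so two forms that agree on W are still different objects;
  completeness has to be transported.\<close>

lemma hilb_cong:
  assumes "hilb W h" "\<And>x y. x \<in> W \<Longrightarrow> y \<in> W \<Longrightarrow> h' x y = h x y" shows "hilb W h'"
proof -
  interpret hilb W h by fact
  have hs: "herm_space W h'"
  proof (rule herm_spaceI[OF sub])
    show "h' x y = cnj (h' y x)" if "x \<in> W" "y \<in> W" for x y
      unfolding assms(2)[OF that] assms(2)[OF that(2,1)] by (rule sym[OF that])
  qed (simp add: assms(2))
  have psd: "psd_space W h'"
    using hs nonneg assms(2) by (simp add: psd_space_def psd_space_axioms_def)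
  have fn: "fnorm h' x = fnorm h x" if "x \<in> W" for x using that assms(2) by (simp add: fnorm_def)
  show ?thesis
  proof (rule hilbI[OF psd])
    show "x = 0" if "x \<in> W" "Re (h' x x) = 0" for x using definite that assms(2) by simp
    fix s assume s: "\<And>n. s n \<in> W" "fcauchy h' s"
    then have "fcauchy h s" by (simp add: fcauchy_def fn)
    from complete[OF s(1) this] s(1) show "\<exists>y\<in>W. fconv h' s y" by (auto simp: fconv_def fn)
  qed
qed

context hilb begin

lemma hilb_closed_subspace:
  assumes "csubspace W" "W \<subseteq> V" 
    and "\<And>s y. (\<And>n. s n \<in> W) \<Longrightarrow> y \<in> V \<Longrightarrow> fconv ip s y \<Longrightarrow> y \<in> W"
  shows "hilb W ip"
proof (rule hilbI)
  interpret W: herm_space W ip using herm_space_sub[OF assms(1,2)] .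
  show "psd_space W ip" by unfold_locales (use nonneg assms(2) in blast)
  show "x = 0" if "x \<in> W" "Re (ip x x) = 0" for x using that definite assms(2) by blast
  show "\<exists>y\<in>W. fconv ip s y" if "\<And>n. s n \<in> W" "fcauchy ip s" for s
    using complete[of s] that assms(2,3) by blast
qed

lemma orth_complement_closed:
  assumes "Z \<subseteq> V" "\<And>n. s n \<in> V" "\<And>n z. z \<in> Z \<Longrightarrow> ip (s n) z = 0" "y \<in> V" "fconv ip s y" "z \<in> Z"
  shows "ip y z = 0"
proof -
  have z: "z \<in> V" using assms by blast
  have "(\<lambda>n. ip (s n) z) \<longlonglongrightarrow> ip y z"
    using fconv_ip[OF assms(2,5,4) _ fconv_const z] z by simp
  then show ?thesis using assms(3)[OF assms(6)] by (simp add: LIMSEQ_const_iff)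
qed

lemma hilb_orth_complement:
  assumes "Z \<subseteq> V" shows "hilb {x \<in> V. \<forall>z\<in>Z. ip x z = 0} ip"
proof (rule hilb_closed_subspace)
  show "csubspace {x \<in> V. \<forall>z\<in>Z. ip x z = 0}"
    using assms by (auto simp: csubspace_def subset_eq)
  fix s y assume "\<And>n. s n \<in> {x \<in> V. \<forall>z\<in>Z. ip x z = 0}" "y \<in> V" "fconv ip s y"
  then show "y \<in> {x \<in> V. \<forall>z\<in>Z. ip x z = 0}"
    using orth_complement_closed[OF assms, of s y] by blast
qed auto

text \<open>X may fail to be closed, so the foot y of the perpendicular is delivered as a limit of a
  sequence in X, namely of one that minimizes the distance to v.\<close>

lemma orth_projection:
  assumes X: "csubspace X" "X \<subseteq> V" and v: "v \<in> V"
  shows "\<exists>s y. (\<forall>n::nat. s n \<in> X) \<and> y \<in> V \<and> fconv ip s y \<and> (\<forall>x\<in>X. ip (v - y) x = 0)"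
proof -
  interpret X: herm_space X ip using herm_space_sub[OF X] .
  define Q where "Q x = Re (ip x x)" for x
  have Q0: "0 \<le> Q x" if "x \<in> V" for x using that nonneg by (simp add: Q_def)
  define d where "d = (INF x\<in>X. Q (v - x))"
  have XV: "x \<in> V" if "x \<in> X" for x using that X by blast
  have bdd: "bdd_below ((\<lambda>x. Q (v - x)) ` X)" 
    by (rule bdd_belowI[of _ 0]) (use Q0 XV v in auto)
  have dle: "d \<le> Q (v - x)" if "x \<in> X" for x
    unfolding d_def by (rule cINF_lower[OF bdd that])
  have "\<exists>x\<in>X. Q (v - x) < d + 1 / (Suc k)" for k
  proof -
    have "(INF x\<in>X. Q (v - x)) < d + 1 / (Suc k)" by (simp add: d_def)
    then show ?thesis using cINF_less_iff[OF _ bdd] X.zero_mem by blast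
  qed
  then obtain s where s: "\<And>k. s k \<in> X" "\<And>k. Q (v - s k) < d + 1 / (Suc k)" by metis
  have sV: "s k \<in> V" for k using s XV by blast
  \<comment> \<open>The midpoint of \<open>s m\<close> and \<open>s k\<close> lies in X, so its
    squared distance from v is at least d; the parallelogram identity turns this into a bound on the
    squared distance of \<open>s m\<close> and \<open>s k\<close>.\<close>
  have par: "Q (s m - s k) \<le> 2 / Suc m + 2 / Suc k" for m k
  proof -
    let ?a = "v - s m" and ?b = "v - s k"
    have "Q (?b - ?a) = 2 * Q ?a + 2 * Q ?b - Q (?a + ?b)"
      unfolding Q_def using sV v by (simp add: algebra_simps)
    moreover have "Q (?a + ?b) = 4 * Q (v - cscale (1/2) (s m + s k))"
    proof -
      have "v + v = cscale 2 v" using cscale_add_left[of 1 1 v] by (simp add: cscale_one)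
      then have "?a + ?b = cscale 2 (v - cscale (1/2) (s m + s k))"
        by (simp add: cv.scale_right_diff_distrib cscale_mult cscale_one algebra_simps)
      then show ?thesis unfolding Q_def using sV v by (simp del: add_left diff_left add_right diff_right)
    qed
    moreover have "d \<le> Q (v - cscale (1/2) (s m + s k))"
      by (intro dle X.scale_mem X.add_mem s)
    moreover have "?b - ?a = s m - s k" by simp
    ultimately have "Q (s m - s k) \<le> 2 * Q ?a + 2 * Q ?b - 4 * d" by (simp only:)
    moreover have "2 / real (Suc m) = 2 * (1 / real (Suc m))" "2 / real (Suc k) = 2 * (1 / real (Suc k))" by simp_all
    ultimately show ?thesis using s(2)[of m] s(2)[of k] by linarith
  qed
  have "fcauchy ip s"
    unfolding sq_fcauchy_iff[OF psd_space_axioms sV] Q_def[symmetric]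
  proof (intro allI impI)
    fix e :: real assume e: "e > 0"
    obtain N :: nat where N0: "4 / e < real N" using reals_Archimedean2 by blast
    have "0 < 4 / e" using e by simp
    then have N1: "0 < real N" using N0 by linarith
    then have N: "N > 0" "1 / real N < e / 4" using N0 e by (simp_all add: field_simps)
    have "Q (s m - s k) < e" if "m \<ge> N" "k \<ge> N" for m k
    proof -
      have "1 / real (Suc m) \<le> 1 / real N" "1 / real (Suc k) \<le> 1 / real N" using that N by (auto intro!: divide_left_mono)
      then show ?thesis using par[of m k] N(2) by simp
    qed
    then show "\<exists>N. \<forall>m\<ge>N. \<forall>n\<ge>N. Q (s m - s n) < e" by blast
  qed
  from complete[OF sV this] obtain y where y: "y \<in> V" "fconv ip s y" by blast
  define w where "w = v - y"
  have w: "w \<in> V" using v y by (simp add: w_def)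
  have lim: "(\<lambda>k. Q (v - s k - u)) \<longlonglongrightarrow> Q (w - u)" if u: "u \<in> V" for u
  proof -
    have c: "fconv ip (\<lambda>k. v - s k - u) (w - u)"
    proof -
      have "fnorm ip (v - s k - u - (w - u)) = fnorm ip (s k - y)" for k
        using fnorm_commute[of y "s k"] sV y by (simp add: w_def algebra_simps)
      then show ?thesis using y(2) by (simp add: fconv_def)
    qed
    have "(\<lambda>k. ip (v - s k - u) (v - s k - u)) \<longlonglongrightarrow> ip (w - u) (w - u)"
      by (rule fconv_ip) (use c w u v sV in auto)
    from tendsto_Re[OF this] show ?thesis by (simp only: Q_def)
  qed
  have Qw: "Q w \<le> d"
  proof (rule LIMSEQ_le)
    show "(\<lambda>k. Q (v - s k)) \<longlonglongrightarrow> Q w" using lim[of 0] by simp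
    have "(\<lambda>k. d + inverse (real (Suc k))) \<longlonglongrightarrow> d + 0"
      by (intro tendsto_intros LIMSEQ_inverse_real_of_nat)
    then show "(\<lambda>k. d + 1 / Suc k) \<longlonglongrightarrow> d" by (simp add: field_simps)
    show "\<exists>N. \<forall>n\<ge>N. Q (v - s n) \<le> d + 1 / Suc n" using s(2) by (meson less_imp_le)
  qed
  have "ip w x = 0" if x: "x \<in> X" for x
  proof (rule ccontr)
    assume r: "ip w x \<noteq> 0"
    have xV: "x \<in> V" using x XV by blast
    \<comment> \<open>Moving y by \<open>t * ip w x\<close> along x changes the squared distance
      from v by \<open>t |ip w x|^2 (t Q x - 2)\<close>, which is negative for this t and
      contradicts minimality.\<close>
    define t where "t = 1 / (Q x + 1)"
    have t: "t > 0" "t * Q x < 1" using Q0[OF xV] by (auto simp: t_def field_simps)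
    let ?u = "cscale (of_real t * ip w x) x"
    have "d \<le> Q (w - ?u)"
    proof (rule LIMSEQ_le_const[OF lim])
      show "?u \<in> V" using xV by simp
      have "d \<le> Q (v - s k - ?u)" for k
        using dle[of "s k + ?u"] s(1)[of k] x by (simp add: algebra_simps)
      then show "\<exists>N. \<forall>n\<ge>N. d \<le> Q (v - s n - ?u)" by blast
    qed
    also have "Q (w - ?u) = Q w - 2 * Re (ip w ?u) + Q ?u"
      unfolding Q_def using w xV by (intro sq_diff) auto
    also have "ip w ?u = of_real t * (ip w x * cnj (ip w x))" using w xV by (simp add: mult_ac)
    also have "\<dots> = of_real (t * (cmod (ip w x))\<^sup>2)" by (simp add: complex_norm_square[symmetric] del: of_real_power)
    also have "Q ?u = (t * cmod (ip w x))\<^sup>2 * Q x"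
      using fnorm_scale[OF xV, of "of_real t * ip w x"] sq_fnorm[OF xV] sq_fnorm[of ?u] xV
      by (simp add: Q_def power_mult_distrib norm_mult)
    finally have "0 \<le> - 2 * (t * (cmod (ip w x))\<^sup>2) + (t * cmod (ip w x))\<^sup>2 * Q x" using Qw by simp
    also have "\<dots> = t * (cmod (ip w x))\<^sup>2 * (t * Q x - 2)" by (simp add: power2_eq_square algebra_simps)
    finally have "0 \<le> t * (cmod (ip w x))\<^sup>2 * (t * Q x - 2)" .
    moreover have "t * (cmod (ip w x))\<^sup>2 > 0" using t r by simp
    ultimately show False using t(2) by (simp add: zero_le_mult_iff)
  qed
  then show ?thesis using s(1) y unfolding w_def by blast
qed

lemma dense_if_orth_trivial:
  assumes X: "csubspace X" "X \<subseteq> V" and v: "v \<in> V"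
    and triv: "\<And>y. y \<in> V \<Longrightarrow> (\<And>x. x \<in> X \<Longrightarrow> ip y x = 0) \<Longrightarrow> y = 0"
  shows "\<exists>s. (\<forall>n::nat. s n \<in> X) \<and> fconv ip s v"
proof -
  obtain s y where s: "\<forall>n::nat. s n \<in> X" "y \<in> V" "fconv ip s y" "\<forall>x\<in>X. ip (v - y) x = 0"
    using orth_projection[OF assms(1-3)] by blast
  have "v - y = 0" by (rule triv) (use s v in auto)
  then show ?thesis using s by auto
qed

text \<open>Subtracting from a vector off the kernel of \<phi> its projection to the kernel leaves a
  vector z orthogonal to the kernel; a multiple of z represents \<phi> because the kernel has
  codimension one.\<close>

lemma riesz:
  assumes add: "\<And>x y a. x \<in> V \<Longrightarrow> y \<in> V \<Longrightarrow> \<phi> (cscale a x + y) = a * \<phi> x + \<phi> y"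
    and bound: "\<And>x. x \<in> V \<Longrightarrow> cmod (\<phi> x) \<le> c * fnorm ip x"
  shows "\<exists>y\<in>V. \<forall>x\<in>V. \<phi> x = ip x y"
proof (cases "\<forall>x\<in>V. \<phi> x = 0")
  case True then show ?thesis using zero_right by (intro bexI[of _ 0]) auto
next
  case False
  then obtain v where v: "v \<in> V" "\<phi> v \<noteq> 0" by blast
  have p0: "\<phi> 0 = 0" using add[of 0 0 1] by (simp add: cscale_one)
  have padd: "\<phi> (x + y) = \<phi> x + \<phi> y" if "x \<in> V" "y \<in> V" for x y using add[OF that, of 1] by (simp add: cscale_one)
  have psc: "\<phi> (cscale a x) = a * \<phi> x" if "x \<in> V" for a x using add[OF that zero_mem, of a] p0 by simp
  have pdiff: "\<phi> (x - y) = \<phi> x - \<phi> y" if "x \<in> V" "y \<in> V" for x y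
    using padd[of x "cscale (-1) y"] psc[of y "-1"] that by simp
  define X where "X = {x \<in> V. \<phi> x = 0}"
  have X: "csubspace X" "X \<subseteq> V" using p0 padd psc by (auto simp: X_def csubspace_def)
  obtain s y where s: "\<forall>n::nat. s n \<in> X" "y \<in> V" "fconv ip s y" "\<forall>x\<in>X. ip (v - y) x = 0"
    using orth_projection[OF X v(1)] by blast
  have sV: "s n \<in> V" "\<phi> (s n) = 0" for n using s(1) by (auto simp: X_def)
  \<comment> \<open>y is only a limit of kernel vectors; the bound on \<phi> keeps it in the
    kernel.\<close>
  have "\<phi> y = 0"
  proof -
    have "norm (\<phi> y) \<le> c * fnorm ip (s n - y)" for n
      using bound[of "s n - y"] pdiff[of "s n" y] sV s(2) by simp
    moreover have "(\<lambda>n. c * fnorm ip (s n - y)) \<longlonglongrightarrow> c * 0"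
      using s(3) unfolding fconv_def by (intro tendsto_intros)
    ultimately have "norm (\<phi> y) \<le> 0" using LIMSEQ_le_const[of "\<lambda>n. c * fnorm ip (s n - y)" 0 "norm (\<phi> y)"] by simp
    then show ?thesis by simp
  qed
  define z where "z = v - y"
  have z: "z \<in> V" "\<phi> z \<noteq> 0" using v s pdiff by (auto simp: z_def \<open>\<phi> y = 0\<close>)
  have zz: "ip z z \<noteq> 0" using definite[OF z(1)] z p0 by (metis zero_complex.simps(1))
  have main: "ip x z = (\<phi> x / \<phi> z) * ip z z" if x: "x \<in> V" for x
  proof -
    have "x - cscale (\<phi> x / \<phi> z) z \<in> X" using x z by (simp add: X_def pdiff psc)
    then have "ip z (x - cscale (\<phi> x / \<phi> z) z) = 0" using s(4) by (simp add: z_def)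
    then have "ip (x - cscale (\<phi> x / \<phi> z) z) z = 0" using sym[of "x - cscale (\<phi> x / \<phi> z) z" z] x z by simp
    then show ?thesis using x z by simp
  qed
  show ?thesis
  proof (intro bexI[of _ "cscale (cnj (\<phi> z / ip z z)) z"] ballI)
    fix x assume x: "x \<in> V"
    have "ip x (cscale (cnj (\<phi> z / ip z z)) z) = \<phi> z / ip z z * ip x z" using x z by simp
    also have "\<dots> = \<phi> x" unfolding main[OF x] using z zz by simp
    finally show "\<phi> x = ip x (cscale (cnj (\<phi> z / ip z z)) z)" by simp
  qed (use z in auto)
qed

end

text \<open>A fundamental decomposition is encoded by an orthonormal family e with respect to the negated
  form: V- is the span of e, V+ its orthogonal complement, \<open>hform\<close> the associated Hilbert space inner
  product and \<open>Jop\<close> the fundamental symmetry.\<close>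
definition Jop :: "('a::cvec \<Rightarrow> 'a \<Rightarrow> complex) \<Rightarrow> nat \<Rightarrow> (nat \<Rightarrow> 'a) \<Rightarrow> 'a \<Rightarrow> 'a" where
  "Jop ip n e y = y + cscale 2 (\<Sum>i<n. cscale (ip y (e i)) (e i))"

locale pont = herm_space V ip for V :: "'a::cvec set" and ip +
  fixes n :: nat and e :: "nat \<Rightarrow> 'a"
  assumes neg: "negfam V ip n e" and hilb_hform: "hilb V (hform ip n e)"

sublocale pont \<subseteq> H: hilb V "hform ip n e" by (rule hilb_hform)

context pont begin

abbreviation "h \<equiv> hform ip n e"
abbreviation "J \<equiv> Jop ip n e"

lemma maxneg: "maxneg V ip n e" using neg H.nonneg by (simp add: maxneg_def)
lemma e_mem: "i < n \<Longrightarrow> e i \<in> V" using neg by (simp add: negfam_def)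

lemma J_mem[simp]: "y \<in> V \<Longrightarrow> J y \<in> V" using e_mem by (simp add: Jop_def)

lemma ip_J: "x \<in> V \<Longrightarrow> y \<in> V \<Longrightarrow> ip x (J y) = h x y"
  using e_mem sym[of y "e _"] by (simp add: Jop_def hform_def sum_distrib_left mult_ac)
lemma J_add: "x \<in> V \<Longrightarrow> y \<in> V \<Longrightarrow> J (cscale a x + y) = cscale a (J x) + J y"
  using e_mem by (simp add: Jop_def cscale_add_right cscale_add_left cscale_mult sum.distrib cv.scale_sum_right mult_ac)
lemma J_e: "j < n \<Longrightarrow> x \<in> V \<Longrightarrow> ip (J x) (e j) = - ip x (e j)"
proof -
  assume j: "j < n" and x: "x \<in> V"
  have "ip (J x) (e j) = ip x (e j) + 2 * ip (\<Sum>i<n. cscale (ip x (e i)) (e i)) (e j)"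
    unfolding Jop_def using e_mem j x by (simp del: sum_left)
  then show ?thesis using negfam_comb[OF neg j, of "\<lambda>i. ip x (e i)"] by simp
qed
lemma JJ[simp]: "x \<in> V \<Longrightarrow> J (J x) = x"
proof -
  assume x: "x \<in> V"
  have "J (J x) = J x + cscale 2 (\<Sum>i<n. cscale (- ip x (e i)) (e i))"
    using J_e x by (subst Jop_def) simp
  also have "\<dots> = x" by (simp add: Jop_def sum_negf)
  finally show ?thesis .
qed
lemma h_J: "x \<in> V \<Longrightarrow> y \<in> V \<Longrightarrow> h x (J y) = ip x y" using ip_J[of x "J y"] by simp
lemma J_norm: "x \<in> V \<Longrightarrow> fnorm h (J x) = fnorm h x"
proof -
  assume x: "x \<in> V"
  have "h (J x) (J x) = ip (J x) x" using h_J x by simp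
  also have "\<dots> = cnj (ip x (J x))" using x by (intro sym) auto
  also have "\<dots> = cnj (h x x)" using ip_J x by simp
  finally show ?thesis by (simp add: fnorm_def)
qed
lemma ip_bound: "x \<in> V \<Longrightarrow> y \<in> V \<Longrightarrow> cmod (ip x y) \<le> fnorm h x * fnorm h y"
  using H.cauchy_schwarz[of x "J y"] J_norm[of y] h_J[of x y] by simp
lemma nondeg: "x \<in> V \<Longrightarrow> (\<And>y. y \<in> V \<Longrightarrow> ip x y = 0) \<Longrightarrow> x = 0"
  using H.definite[of x] ip_J[of x x] by simp
lemma eqI: "x \<in> V \<Longrightarrow> y \<in> V \<Longrightarrow> (\<And>z. z \<in> V \<Longrightarrow> ip x z = ip y z) \<Longrightarrow> x = y"
  using nondeg[of "x - y"] by simp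

lemma h_self: "x \<in> V \<Longrightarrow> (fnorm h x)\<^sup>2 = Re (ip x x) + 2 * (\<Sum>i<n. (cmod (ip x (e i)))\<^sup>2)"
  using H.sq_fnorm[of x] hform_self[of n e x] e_mem by simp

lemma fconv_ip': 
  assumes s: "\<And>n. s n \<in> V" "fconv h s y" "y \<in> V" and t: "\<And>n. t n \<in> V" "fconv h t w" "w \<in> V"
  shows "(\<lambda>n. ip (s n) (t n)) \<longlonglongrightarrow> ip y w"
proof -
  have "J (t n) - J w = J (t n - w)" for n using J_add[OF t(3) t(1)[of n], of "-1"] by simp
  then have "fconv h (\<lambda>n. J (t n)) (J w)" using t J_norm by (simp add: fconv_def)
  from H.fconv_ip[OF s _ this] show ?thesis using s t by (simp add: h_J)
qed

lemma ip_self_le: "x \<in> V \<Longrightarrow> Re (ip x x) \<le> (fnorm h x)\<^sup>2"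
  using h_self[of x] by (simp add: sum_nonneg)

text \<open>Represent the functional by the Hilbert form, then apply \<open>J\<close> to the
  representing vector.\<close>

lemma riesz_ip:
  assumes add: "\<And>x y a. x \<in> V \<Longrightarrow> y \<in> V \<Longrightarrow> \<phi> (cscale a x + y) = a * \<phi> x + \<phi> y"
    and bound: "\<And>x. x \<in> V \<Longrightarrow> cmod (\<phi> x) \<le> c * fnorm h x"
  shows "\<exists>y\<in>V. \<forall>x\<in>V. \<phi> x = ip x y"
proof -
  obtain y where "y \<in> V" "\<forall>x\<in>V. \<phi> x = h x y" using H.riesz[OF assms] by blast
  then show ?thesis using ip_J[of _ y] by (intro bexI[of _ "J y"]) auto
qed

lemma fund_decomp_exists: "\<exists>Vp Vm. fund_decomp V ip Vp Vm \<and> cdim_is Vm n"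
proof -
  define Vp where "Vp = {x \<in> V. \<forall>z\<in>e ` {..<n}. h x z = 0}"
  define Vm where "Vm = cv.span (e ` {..<n})"
  have hp: "hilb Vp h" unfolding Vp_def using e_mem by (intro H.hilb_orth_complement) auto
  have Vp': "Vp = {x \<in> V. \<forall>i<n. ip x (e i) = 0}"
    unfolding Vp_def using hform_e[OF neg] by auto
  have hVp: "h x y = ip x y" if "x \<in> Vp" "y \<in> Vp" for x y
    using that by (simp add: Vp' hform_def)
  have VmV: "Vm \<subseteq> V" unfolding Vm_def using e_mem by (intro cv.span_minimal subspaceV) auto
  have Vpm0: "ip x m = 0" if x: "x \<in> Vp" and m: "m \<in> Vm" for x m
  proof -
    have "Vm \<subseteq> {m \<in> V. ip x m = 0}"
      unfolding Vm_def using x e_mem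
      by (intro cv.span_minimal) (auto simp: Vp' cv.subspace_def)
    then show ?thesis using m by blast
  qed
  have split: "(x + (\<Sum>i<n. cscale (ip x (e i)) (e i))) \<in> Vp" if "x \<in> V" for x
    using proj_orth[OF neg that] that e_mem by (simp add: Vp' del: add_left sum_left)
  have in_Vm: "(\<Sum>i<n. cscale (a i) (e i)) \<in> Vm" for a
    unfolding Vm_def by (intro cv.span_sum cv.span_scale cv.span_base) auto
  have subm: "csubspace Vm" by (simp add: Vm_def csubspace_iff cv.subspace_span)
  \<comment> \<open>Exhibiting \<open>Vm\<close> as the \<open>h\<close>-orthogonal complement of
    \<open>Vp\<close> makes it complete for the same reason as any orthogonal complement.\<close>
  have Vm_alt: "Vm = {x \<in> V. \<forall>z\<in>Vp. h x z = 0}"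
  proof (intro equalityI subsetI)
    fix m assume m: "m \<in> Vm"
    have "h m z = 0" if z: "z \<in> Vp" for z
    proof -
      have "h m z = cnj (h z m)" using H.sym[of m z] m z VmV by (auto simp: Vp_def)
      also have "h z m = ip z m" using z by (simp add: hform_def Vp')
      finally show ?thesis using Vpm0[OF z m] by simp
    qed
    then show "m \<in> {x \<in> V. \<forall>z\<in>Vp. h x z = 0}" using m VmV by blast
  next
    fix x assume x: "x \<in> {x \<in> V. \<forall>z\<in>Vp. h x z = 0}"
    define m where "m = (\<Sum>i<n. cscale (ip x (e i)) (e i))"
    have xV: "x \<in> V" using x by blast
    have y: "x + m \<in> Vp" using split[OF xV] by (simp add: m_def)
    have mV: "m \<in> Vm" "m \<in> V" using in_Vm VmV by (auto simp: m_def)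
    have "ip m (x + m) = 0" using Vpm0[OF y mV(1)] sym[of m "x + m"] xV mV by simp
    then have "h m (x + m) = 0" using y by (simp add: hform_def Vp' sym[of "e _" "x + m"] e_mem xV mV del: add_left add_right)
    moreover have "h x (x + m) = 0" using x y by blast
    ultimately have "h (x + m) (x + m) = 0" using xV mV by (simp del: H.add_right)
    then have "x + m = 0" using H.definite[of "x + m"] xV mV by simp
    then have "x = - m" by (simp add: eq_neg_iff_add_eq_0)
    then show "x \<in> Vm" using mV(1) subm by (simp add: csubspace_iff cv.subspace_neg)
  qed
  have hm: "hilb Vm h" unfolding Vm_alt by (rule H.hilb_orth_complement) (auto simp: Vp_def)
  have hVm: "- ip x y = h x y" if "x \<in> Vm" "y \<in> Vm" for x y
  proof -
    have xV: "x \<in> V" and yV: "y \<in> V" using that VmV by auto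
    define m where "m = (\<Sum>i<n. cscale (ip y (e i)) (e i))"
    have m: "m \<in> Vm" using in_Vm by (simp add: m_def)
    have mV: "m \<in> V" using m VmV by blast
    have y: "y + m \<in> Vp" using split[OF yV] by (simp add: m_def)
    have "ip (y + m) x = 0" using Vpm0[OF y] that by blast
    then have "ip x (y + m) = 0" using sym[of x "y + m"] xV yV mV by simp
    then have "ip x y = - ip x m" using xV yV mV by (simp add: eq_neg_iff_add_eq_0)
    also have "ip x m = (\<Sum>i<n. ip x (e i) * ip (e i) y)"
      unfolding m_def using xV yV e_mem sym[of "e _" y] by (simp add: mult.commute)
    finally show ?thesis by (simp add: hform_def)
  qed
  have "hilb Vp ip" by (rule hilb_cong[OF hp]) (simp add: hVp)
  moreover have "hilb Vm (\<lambda>x y. - ip x y)" by (rule hilb_cong[OF hm]) (rule hVm)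
  moreover have cd: "cdim_is Vm n"
    unfolding cdim_is_def cindep_iff cspan_eq_span Vm_def using negfam_independent[OF neg]
    by (intro exI[of _ "e ` {..<n}"]) (auto simp: card_image)
  moreover have "\<exists>p\<in>Vp. \<exists>m\<in>Vm. v = p + m" if v: "v \<in> V" for v
  proof -
    have "v = (v + (\<Sum>i<n. cscale (ip v (e i)) (e i))) + (\<Sum>i<n. cscale (- ip v (e i)) (e i))"
      by (simp add: sum_negf)
    then show ?thesis using split[OF v] in_Vm[of "\<lambda>i. - ip v (e i)"] by (intro bexI)
  qed
  moreover have "Vp \<inter> Vm = {0}"
  proof (intro equalityI subsetI)
    fix x assume "x \<in> Vp \<inter> Vm"
    then have "ip x x = 0" "h x x = ip x x" "x \<in> V" using Vpm0 hVp VmV by auto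
    then show "x \<in> {0}" using H.definite[of x] by simp
  next
    fix x :: 'a assume "x \<in> {0}"
    then show "x \<in> Vp \<inter> Vm" using subm by (auto simp: Vp' csubspace_def e_mem)
  qed
  ultimately have "fund_decomp V ip Vp Vm"
    unfolding fund_decomp_def using VmV Vpm0 by (auto simp: hilb_def Vp_def)
  then show ?thesis using cd by blast
qed

end

text \<open>The family is a maximal negative one inside \<open>Vm\<close>; linear independence
  bounds its length by n, and completeness for its \<open>hform\<close> is inherited from the two
  components of the decomposition.\<close>

lemma pont_of_fund_decomp:
  assumes "csubspace V" "herm_form V ip" and fd: "fund_decomp V ip Vp Vm" and cd: "cdim_is Vm n"
  shows "\<exists>e. pont V ip n e"
proof -
  interpret herm_space V ip by unfold_locales fact+
  have VpV: "Vp \<subseteq> V" and VmV: "Vm \<subseteq> V" and orth: "\<And>p m. p \<in> Vp \<Longrightarrow> m \<in> Vm \<Longrightarrow> ip p m = 0"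
    and dec: "\<And>v. v \<in> V \<Longrightarrow> \<exists>p\<in>Vp. \<exists>m\<in>Vm. v = p + m"
    and hp: "hilb Vp ip" and hm: "hilb Vm (\<lambda>x y. - ip x y)"
    using fd by (auto simp: fund_decomp_def hilb_def)
  interpret P: hilb Vp ip by fact
  interpret M: hilb Vm "\<lambda>x y. - ip x y" by fact
  interpret M': herm_space Vm ip by (rule herm_space_sub[OF M.sub VmV])
  obtain B where B: "finite B" "card B = n" "cv.independent B" "cv.span B = Vm"
    using cd by (auto simp: cdim_is_def cindep_iff cspan_eq_span)
  have "k \<le> n" if "negfam Vm ip k f" for k f
  proof -
    have "f ` {..<k} \<subseteq> cv.span B" using that B by (auto simp: negfam_def)
    from cv.independent_span_bound[OF B(1) M'.negfam_independent(2)[OF that] this]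
    show ?thesis using B by (simp add: card_image[OF M'.negfam_independent(1)[OF that]])
  qed
  then obtain k e where mx: "maxneg Vm ip k e" using M'.maxneg_exists[of n] by blast
  then have ne: "negfam Vm ip k e" by (simp add: maxneg_def)
  have em: "e i \<in> Vm" "e i \<in> V" if "i < k" for i using ne that VmV by (auto simp: negfam_def)
  \<comment> \<open>The remainder y has nonnegative square by maximality of the family and
    nonpositive square as an element of \<open>Vm\<close>, so it vanishes: the family spans
    \<open>Vm\<close>.\<close>
  have exp: "x = - (\<Sum>i<k. cscale (ip x (e i)) (e i))" if x: "x \<in> Vm" for x
  proof -
    define y where "y = x + (\<Sum>i<k. cscale (ip x (e i)) (e i))"
    have y: "y \<in> Vm" unfolding y_def using x em by simp
    have "ip y (e j) = 0" if "j < k" for j unfolding y_def using M'.proj_orth[OF ne x that] .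
    then have "hform ip k e y y = ip y y" by (simp add: hform_def)
    then have "0 \<le> Re (ip y y)" using mx y by (auto simp: maxneg_def)
    then have "y = 0" using M.nonneg[OF y] M.definite[OF y] by simp
    then show ?thesis by (simp add: y_def eq_neg_iff_add_eq_0)
  qed
  have "Vm \<subseteq> cv.span (e ` {..<k})"
  proof
    fix x assume "x \<in> Vm"
    then have "x = - (\<Sum>i<k. cscale (ip x (e i)) (e i))" by (rule exp)
    moreover have "- (\<Sum>i<k. cscale (ip x (e i)) (e i)) \<in> cv.span (e ` {..<k})"
      by (intro cv.span_neg cv.span_sum cv.span_scale cv.span_base) auto
    ultimately show "x \<in> cv.span (e ` {..<k})" by simp
  qed
  then have "cv.dim Vm = k"
    using M'.negfam_independent[OF ne] em(1) by (intro cv.dim_unique[of "e ` {..<k}"]) (auto simp: card_image)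
  then have kn: "k = n" using cdim_is_dim[OF cd] by simp
  have neV: "negfam V ip n e" using ne em kn by (auto simp: negfam_def)
  have hVm: "hform ip n e x y = - ip x y" if x: "x \<in> Vm" and y: "y \<in> Vm" for x y
  proof -
    have "ip x y = ip x (- (\<Sum>i<k. cscale (ip y (e i)) (e i)))" using exp[OF y] by simp
    also have "\<dots> = - (\<Sum>i<k. ip x (e i) * ip (e i) y)"
      using x y em VmV M'.sym[of "e _" y] by (simp add: mult.commute)
    finally show ?thesis by (simp add: hform_def kn)
  qed
  have orth': "ip m p = 0" if "p \<in> Vp" "m \<in> Vm" for p m
    using orth[OF that] sym[of m p] that VpV VmV by auto
  let ?h = "hform ip n e"
  interpret H0: herm_space V ?h by (rule hform_herm) (use em kn in auto)
  \<comment> \<open>The flipped form is the Hilbert form of the direct sum of \<open>Vp\<close> and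
    \<open>Vm\<close>, so norms of components and of sums control each other.\<close>
  have hsum: "?h (p + m) (p + m) = ip p p - ip m m" if p: "p \<in> Vp" and m: "m \<in> Vm" for p m
  proof -
    have pV: "p \<in> V" "m \<in> V" using p m VpV VmV by auto
    have z: "ip p (e i) = 0" if "i < n" for i using orth[OF p] em that kn by blast
    have "?h p p = ip p p" "?h p m = 0" using z orth[OF p m] by (simp_all add: hform_def)
    moreover have "?h m p = 0" using \<open>?h p m = 0\<close> H0.sym[of m p] pV by simp
    ultimately show ?thesis using hVm[OF m m] pV by simp
  qed
  have psd: "psd_space V ?h"
  proof unfold_locales
    fix x assume "x \<in> V"
    then obtain p m where "p \<in> Vp" "m \<in> Vm" "x = p + m" using dec by blast
    then show "0 \<le> Re (?h x x)" using hsum[of p m] P.nonneg[of p] M.nonneg[of m] by simp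
  qed
  interpret H: psd_space V ?h by fact
  have fnp: "fnorm ip p \<le> fnorm ?h (p + m)" and fnm: "fnorm (\<lambda>x y. - ip x y) m \<le> fnorm ?h (p + m)" 
    if p: "p \<in> Vp" and m: "m \<in> Vm" for p m
    unfolding fnorm_def using hsum[OF p m] P.nonneg[OF p] M.nonneg[OF m] by auto
  have fnh: "fnorm ?h (p + m) \<le> fnorm ip p + fnorm (\<lambda>x y. - ip x y) m"
    if p: "p \<in> Vp" and m: "m \<in> Vm" for p m
  proof -
    have "fnorm ?h (p + m) \<le> fnorm ?h p + fnorm ?h m" using p m VpV VmV by (intro H.fnorm_triangle) auto
    moreover have "fnorm ?h p = fnorm ip p" using hsum[OF p M.zero_mem] em by (simp add: fnorm_def VmV)
    moreover have "fnorm ?h m = fnorm (\<lambda>x y. - ip x y) m" using hVm[OF m m] by (simp add: fnorm_def)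
    ultimately show ?thesis by simp
  qed
  have "hilb V ?h"
  proof (rule hilbI[OF psd])
    fix x assume x: "x \<in> V" "Re (?h x x) = 0"
    then obtain p m where pm: "p \<in> Vp" "m \<in> Vm" "x = p + m" using dec by blast
    then have "Re (ip p p) + Re (- ip m m) = 0" using x hsum by simp
    then have "Re (ip p p) = 0" "Re (- ip m m) = 0" using P.nonneg[OF pm(1)] M.nonneg[OF pm(2)] by auto
    then show "x = 0" using P.definite[OF pm(1)] M.definite[OF pm(2)] pm(3) by simp
  next
    fix s assume s: "\<And>n. s n \<in> V" "fcauchy ?h s"
    have "\<forall>k. \<exists>p m. p \<in> Vp \<and> m \<in> Vm \<and> s k = p + m" using dec[OF s(1)] by blast
    then obtain p m where pm: "\<And>k. p k \<in> Vp" "\<And>k. m k \<in> Vm" "\<And>k. s k = p k + m k" by metis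
    have d: "s i - s j = (p i - p j) + (m i - m j)" for i j by (simp add: pm(3))
    have "fcauchy ip p" "fcauchy (\<lambda>x y. - ip x y) m"
      using s(2) fnp[OF P.diff_mem M.diff_mem, OF pm(1) pm(1) pm(2) pm(2)] 
        fnm[OF P.diff_mem M.diff_mem, OF pm(1) pm(1) pm(2) pm(2)]
      unfolding fcauchy_def d by (meson le_less_trans)+
    then obtain p0 m0 where l: "p0 \<in> Vp" "fconv ip p p0" "m0 \<in> Vm" "fconv (\<lambda>x y. - ip x y) m m0"
      using P.complete[of p] M.complete[of m] pm by blast
    have "fconv ?h s (p0 + m0)"
      unfolding fconv_def
    proof (rule real_tendsto_sandwich[OF _ _ tendsto_const])
      show "(\<lambda>k. fnorm ip (p k - p0) + fnorm (\<lambda>x y. - ip x y) (m k - m0)) \<longlonglongrightarrow> 0"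
        using tendsto_add[OF l(2,4)[unfolded fconv_def]] by simp
      have "fnorm ?h (s k - (p0 + m0)) \<le> fnorm ip (p k - p0) + fnorm (\<lambda>x y. - ip x y) (m k - m0)" for k
        using fnh[OF P.diff_mem M.diff_mem, OF pm(1) l(1) pm(2) l(3)] by (simp add: pm(3) algebra_simps)
      then show "\<forall>\<^sub>F k in sequentially. fnorm ?h (s k - (p0 + m0)) \<le> fnorm ip (p k - p0) + fnorm (\<lambda>x y. - ip x y) (m k - m0)" by simp
      have "p0 + m0 \<in> V" using l VpV VmV by (intro add_mem) blast+
      then show "\<forall>\<^sub>F k in sequentially. 0 \<le> fnorm ?h (s k - (p0 + m0))" using s by simp
    qed
    then show "\<exists>y\<in>V. fconv ?h s y" using l VpV VmV add_mem by blast
  qed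
  then show ?thesis using neV by (intro exI[of _ e]) (unfold_locales, auto simp: hilb_def)
qed

lemma pontryagin_imp_pont: 
  assumes "pontryagin V ip" shows "\<exists>n e. pont V ip n e"
proof -
  obtain Vp Vm where s: "csubspace V" "herm_form V ip" and fd: "fund_decomp V ip Vp Vm"
    using assms by (auto simp: pontryagin_def)
  then obtain n where "cdim_is Vm n" by (auto simp: fund_decomp_def)
  from pont_of_fund_decomp[OF s fd this] show ?thesis by blast
qed

lemma (in pont) pontryagin: "pontryagin V ip"
  using fund_decomp_exists sub herm by (auto simp: pontryagin_def)

text \<open>Uniqueness in the definite description is the law of inertia, as every decomposition
  yields a maximal negative family of the length of its negative part.\<close>

lemma (in pont) ind_minus: "ind_minus V ip = n"
  unfolding ind_minus_def
proof (rule the_equality)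
  show "\<exists>Vp Vm. fund_decomp V ip Vp Vm \<and> cdim_is Vm n" by (rule fund_decomp_exists)
  fix k assume "\<exists>Vp Vm. fund_decomp V ip Vp Vm \<and> cdim_is Vm k"
  then obtain f where "pont V ip k f" using pont_of_fund_decomp[OF sub herm] by blast
  then show "k = n" using inertia_eq[OF pont.maxneg maxneg] by blast
qed

section \<open>Negative squares of Gram matrices\<close>

text \<open>Through the function instance, coordinate vectors of type
  \<open>nat \<Rightarrow> complex\<close> become vectors of class \<open>cvec\<close>, so that the
  lemmas on Hermitian spaces apply to them.\<close>

instantiation complex :: cvec
begin
definition cscale_complex :: "complex \<Rightarrow> complex \<Rightarrow> complex" where "cscale_complex = (*)"
instance by standard (auto simp: cscale_complex_def algebra_simps)
end

section \<open>Orthonormalization along a flag and diagonalization of Hermitian matrices\<close>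

definition onfam :: "'a::cvec set \<Rightarrow> ('a \<Rightarrow> 'a \<Rightarrow> complex) \<Rightarrow> nat \<Rightarrow> (nat \<Rightarrow> 'a) \<Rightarrow> bool" where
  "onfam V ip n u \<longleftrightarrow> (\<forall>i<n. u i \<in> V) \<and> (\<forall>i<n. \<forall>j<n. ip (u i) (u j) = (if i = j then 1 else 0))"

context herm_space begin

lemma onfam_comb:
  assumes "onfam V ip n u" "j < n"
  shows "ip (\<Sum>i<n. cscale (c i) (u i)) (u j) = c j"
proof -
  have "(\<Sum>i<n. c i * ip (u i) (u j)) = (\<Sum>i<n. if i = j then c j else 0)"
    using assms by (intro sum.cong) (auto simp: onfam_def)
  then show ?thesis using assms by (simp add: onfam_def)
qed

text \<open>The span of every initial segment is preserved, not only the total span, because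
  triangularity of an operator refers to the whole flag.\<close>

lemma gram_schmidt:
  assumes pos: "\<And>x. x \<in> V \<Longrightarrow> x \<noteq> 0 \<Longrightarrow> 0 < Re (ip x x)"
    and p: "\<And>j. j < m \<Longrightarrow> p j \<in> V"
    and ind: "\<And>j. j < m \<Longrightarrow> p j \<notin> cv.span (p ` {..<j})"
  shows "\<exists>u. onfam V ip m u \<and> (\<forall>j\<le>m. cv.span (u ` {..<j}) = cv.span (p ` {..<j}))"
  using p ind
proof (induction m)
  case 0
  show ?case by (simp add: onfam_def)
next
  case (Suc m)
  then obtain u where u: "onfam V ip m u" and sp: "\<And>j. j \<le> m \<Longrightarrow> cv.span (u ` {..<j}) = cv.span (p ` {..<j})"
    by (metis less_SucI)
  have uV: "u i \<in> V" if "i < m" for i using u that by (simp add: onfam_def)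
  define s where "s = (\<Sum>i<m. cscale (ip (p m) (u i)) (u i))"
  define r where "r = p m - s"
  have sV: "s \<in> V" unfolding s_def using uV by simp
  have pV: "p m \<in> V" using Suc.prems by simp
  have rV: "r \<in> V" using sV pV by (simp add: r_def)
  have ss: "s \<in> cv.span (u ` {..<m})"
    unfolding s_def by (intro cv.span_sum cv.span_scale cv.span_base) auto
  have r0: "r \<noteq> 0" using ss sp[of m] Suc.prems(2)[of m] by (auto simp: r_def)
  have ro: "ip r (u j) = 0" if "j < m" for j
    using onfam_comb[OF u that, of "\<lambda>i. ip (p m) (u i)"] uV[OF that] sV pV by (simp add: r_def s_def del: sum_left)
  have ro': "ip (u j) r = 0" if "j < m" for j
  proof -
    have "ip (u j) r = cnj (ip r (u j))" using rV uV that by (intro sym)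
    then show ?thesis using ro[OF that] by simp
  qed
  define c where "c = sqrt (Re (ip r r))"
  have c: "c > 0" "c * c = Re (ip r r)" using pos[OF rV r0] by (simp_all add: c_def)
  define w where "w = cscale (of_real (1 / c)) r"
  have wV: "w \<in> V" using rV by (simp add: w_def)
  have "(1 / c) * (1 / c) * Re (ip r r) = 1" by (subst c(2)[symmetric]) (use c(1) in simp)
  then have ww: "ip w w = 1" unfolding w_def scale_real_self[OF rV] by (simp only: of_real_1)
  define u' where "u' = u(m := w)"
  have "onfam V ip (Suc m) u'"
    unfolding onfam_def using u uV wV ww ro ro' rV by (auto simp: u'_def less_Suc_eq w_def onfam_def)
  moreover have "cv.span (u' ` {..<j}) = cv.span (p ` {..<j})" if j: "j \<le> Suc m" for j
  proof (cases "j \<le> m")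
    case True
    then have "u' ` {..<j} = u ` {..<j}" by (auto simp: u'_def)
    then show ?thesis using sp[OF True] by simp
  next
    case False
    then have j: "j = Suc m" using j by simp
    have im: "u' ` {..<j} = insert w (u ` {..<m})" "p ` {..<j} = insert (p m) (p ` {..<m})"
      unfolding j lessThan_Suc by (auto simp: u'_def)
    have inc: "cv.span (u ` {..<m}) \<subseteq> cv.span (insert w (u ` {..<m}))" by (intro cv.span_mono subset_insertI)
    have inc2: "cv.span (u ` {..<m}) \<subseteq> cv.span (insert (p m) (p ` {..<m}))"
      unfolding sp[OF order_refl] by (intro cv.span_mono subset_insertI)+
    have "w \<in> cv.span (insert (p m) (p ` {..<m}))"
      unfolding w_def r_def using subsetD[OF inc2 ss] by (intro cv.span_scale cv.span_diff) (auto intro: cv.span_base)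
    moreover have "p m \<in> cv.span (insert w (u ` {..<m}))"
    proof -
      have pm: "p m = cscale (of_real c) w + s" using c by (simp add: w_def r_def cscale_mult cscale_one)
      show ?thesis using subsetD[OF inc ss] by (subst pm) (intro cv.span_add cv.span_scale, auto intro: cv.span_base)
    qed
    ultimately show ?thesis unfolding im
      using inc inc2 sp[of m] cv.span_superset[of "u ` {..<m}"] cv.span_superset[of "p ` {..<m}"]
      by (intro equalityI cv.span_minimal cv.subspace_span) auto
  qed
  ultimately show ?case by blast
qed

lemma span_lessThan_comb: 
  assumes "x \<in> cv.span (u ` {..<(n::nat)})" shows "\<exists>c. x = (\<Sum>i<n. cscale (c i) (u i))"
proof -
  have "cv.span (u ` {..<n}) \<subseteq> {x. \<exists>c. x = (\<Sum>i<n. cscale (c i) (u i))}"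
  proof (rule cv.span_minimal)
    show "u ` {..<n} \<subseteq> {x. \<exists>c. x = (\<Sum>i<n. cscale (c i) (u i))}"
    proof safe
      fix j assume "j < n"
      then have "u j = (\<Sum>i<n. cscale (if i = j then 1 else 0) (u i))"
        by (simp add: if_distrib[of "\<lambda>a. cscale a _"] cscale_one cong: if_cong)
      then show "\<exists>c. u j = (\<Sum>i<n. cscale (c i) (u i))" by (intro exI[of _ "\<lambda>i. if i = j then 1 else 0"])
    qed
    show "cv.subspace {x. \<exists>c. x = (\<Sum>i<n. cscale (c i) (u i))}"
    proof (rule cv.subspaceI)
      show "0 \<in> {x. \<exists>c. x = (\<Sum>i<n. cscale (c i) (u i))}" by (auto intro!: exI[of _ "\<lambda>_. 0"])
    next
      fix x y assume "x \<in> {x. \<exists>c. x = (\<Sum>i<n. cscale (c i) (u i))}" "y \<in> {x. \<exists>c. x = (\<Sum>i<n. cscale (c i) (u i))}"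
      then obtain c d where "x = (\<Sum>i<n. cscale (c i) (u i))" "y = (\<Sum>i<n. cscale (d i) (u i))" by blast
      then have "x + y = (\<Sum>i<n. cscale (c i + d i) (u i))" by (simp add: cscale_add_left sum.distrib)
      then show "x + y \<in> {x. \<exists>c. x = (\<Sum>i<n. cscale (c i) (u i))}" by (intro CollectI exI)
    next
      fix x a assume "x \<in> {x. \<exists>c. x = (\<Sum>i<n. cscale (c i) (u i))}"
      then obtain c where "x = (\<Sum>i<n. cscale (c i) (u i))" by blast
      then have "cscale a x = (\<Sum>i<n. cscale (a * c i) (u i))" by (simp add: cv.scale_sum_right)
      then show "cscale a x \<in> {x. \<exists>c. x = (\<Sum>i<n. cscale (c i) (u i))}" by (intro CollectI exI)
    qed
  qed
  then show ?thesis using assms by blast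
qed

text \<open>A self-adjoint operator that is triangular along a flag is diagonal in the
  orthonormalized flag: the vector \<open>T (u j)\<close> minus \<open>b j\<close> times
  \<open>u j\<close> lies in the span of the earlier vectors by triangularity and is orthogonal to
  them by self-adjointness.\<close>

lemma selfadjoint_flag_diagonal:
  assumes pos: "\<And>x. x \<in> V \<Longrightarrow> x \<noteq> 0 \<Longrightarrow> 0 < Re (ip x x)"
    and p: "\<And>j. j < m \<Longrightarrow> p j \<in> V"
    and ind: "\<And>j. j < m \<Longrightarrow> p j \<notin> cv.span (p ` {..<j})"
    and T: "\<And>x. x \<in> V \<Longrightarrow> T x \<in> V" "\<And>x y a. x \<in> V \<Longrightarrow> y \<in> V \<Longrightarrow> T (cscale a x + y) = cscale a (T x) + T y"
    and sa: "\<And>x y. x \<in> V \<Longrightarrow> y \<in> V \<Longrightarrow> ip (T x) y = ip x (T y)"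
    and tri: "\<And>j. j < m \<Longrightarrow> T (p j) - cscale (b j) (p j) \<in> cv.span (p ` {..<j})"
  shows "\<exists>u. onfam V ip m u \<and> cv.span (u ` {..<m}) = cv.span (p ` {..<m}) \<and> (\<forall>j<m. T (u j) = cscale (b j) (u j))"
proof -
  obtain u where u: "onfam V ip m u" and sp: "\<And>j. j \<le> m \<Longrightarrow> cv.span (u ` {..<j}) = cv.span (p ` {..<j})"
    using gram_schmidt[OF pos p ind] by blast
  have uV: "u i \<in> V" if "i < m" for i using u that by (simp add: onfam_def)
  have FV: "cv.span (u ` {..<j}) \<subseteq> V" if "j \<le> m" for j
    using uV that by (intro cv.span_minimal subspaceV) auto
  have T0: "T 0 = 0" using T(2)[of 0 0 1] by (simp add: cscale_one)
  have Tadd: "T (x + y) = T x + T y" if "x \<in> V" "y \<in> V" for x y using T(2)[OF that, of 1] by (simp add: cscale_one)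
  have Tsc: "T (cscale a x) = cscale a (T x)" if "x \<in> V" for a x using T(2)[OF that zero_mem, of a] T0 by simp
  \<comment> \<open>Transfers triangularity from the given basis to all vectors of each flag space;
    the strong induction supplies invariance of the smaller spaces.\<close>
  have flag: "T x - cscale (b j) x \<in> cv.span (u ` {..<j})" if j: "j < m" and x: "x \<in> cv.span (u ` {..<Suc j})" for j x
    using j x
  proof (induction j arbitrary: x rule: less_induct)
    case (less j)
    let ?F = "cv.span (u ` {..<j})"
    have mono: "cv.span (u ` {..<Suc i}) \<subseteq> ?F" if "i < j" for i
      using that by (intro cv.span_mono) auto
    have inv: "T y \<in> ?F" if "i < j" "y \<in> cv.span (u ` {..<Suc i})" for y i
    proof -
      have "T y - cscale (b i) y \<in> cv.span (u ` {..<i})" using less.IH[OF that(1)] that less.prems by simp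
      also have "\<dots> \<subseteq> ?F" using that by (intro cv.span_mono) auto
      finally have "(T y - cscale (b i) y) + cscale (b i) y \<in> ?F"
        using mono[OF that(1)] that(2) by (intro cv.span_add cv.span_scale) auto
      then show ?thesis by simp
    qed
    have "cv.span (p ` {..<Suc j}) \<subseteq> {x \<in> V. T x - cscale (b j) x \<in> ?F}"
    proof (rule cv.span_minimal)
      show "p ` {..<Suc j} \<subseteq> {x \<in> V. T x - cscale (b j) x \<in> ?F}"
      proof safe
        fix i assume i: "i < Suc j"
        then show "p i \<in> V" using p less.prems by simp
        show "T (p i) - cscale (b j) (p i) \<in> ?F"
        proof (cases "i = j")
          case True then show ?thesis using tri sp[of j] less.prems by simp
        next
          case False
          then have i: "i < j" using i by simp
          have pi: "p i \<in> cv.span (u ` {..<Suc i})" using sp[of "Suc i"] i less.prems by (simp add: cv.span_base)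
          then show ?thesis using inv[OF i pi] mono[OF i] by (intro cv.span_diff cv.span_scale) auto
        qed
      qed
      show "cv.subspace {x \<in> V. T x - cscale (b j) x \<in> ?F}"
      proof (rule cv.subspaceI)
        show "0 \<in> {x \<in> V. T x - cscale (b j) x \<in> ?F}" by (simp add: T0 cv.span_zero)
      next
        fix x y assume "x \<in> {x \<in> V. T x - cscale (b j) x \<in> ?F}" "y \<in> {x \<in> V. T x - cscale (b j) x \<in> ?F}"
        then have a: "x \<in> V" "y \<in> V" "T x - cscale (b j) x \<in> ?F" "T y - cscale (b j) y \<in> ?F" by auto
        show "x + y \<in> {x \<in> V. T x - cscale (b j) x \<in> ?F}"
          using a(1,2) cv.span_add[OF a(3,4)] Tadd[OF a(1,2)] by (simp add: cscale_add_right algebra_simps)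
      next
        fix c x assume "x \<in> {x \<in> V. T x - cscale (b j) x \<in> ?F}"
        then have a: "x \<in> V" "T x - cscale (b j) x \<in> ?F" by auto
        show "cscale c x \<in> {x \<in> V. T x - cscale (b j) x \<in> ?F}"
          using a(1) cv.span_scale[OF a(2), of c] Tsc[OF a(1)] by (simp add: cv.scale_right_diff_distrib mult.commute)
      qed
    qed
    then show ?case using less.prems sp[of "Suc j"] by auto
  qed
  have "T (u j) = cscale (b j) (u j)" if j: "j < m" for j
  proof -
    define w where "w = T (u j) - cscale (b j) (u j)"
    have w: "w \<in> cv.span (u ` {..<j})" unfolding w_def using j by (intro flag cv.span_base) auto
    have wV: "w \<in> V" using w FV[of j] j by auto
    have wi: "ip w (u i) = 0" if i: "i < j" for i
    proof -
      have "T (u i) - cscale (b i) (u i) \<in> cv.span (u ` {..<i})" using i j by (intro flag cv.span_base) auto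
      then obtain c where c: "T (u i) - cscale (b i) (u i) = (\<Sum>k<i. cscale (c k) (u k))" using span_lessThan_comb by blast
      have im: "i < m" using i j by simp
      \<comment> \<open>\<open>T (u i)\<close> stays in the span of the first \<open>i + 1\<close>
        vectors, which is orthogonal to \<open>u j\<close>.\<close>
      have "ip (u j) (T (u i)) = ip (u j) ((\<Sum>k<i. cscale (c k) (u k)) + cscale (b i) (u i))" by (simp add: c[symmetric])
      also have "\<dots> = (\<Sum>k<i. cnj (c k) * ip (u j) (u k)) + cnj (b i) * ip (u j) (u i)"
        using uV i j by simp
      also have "\<dots> = 0" using u i j by (simp add: onfam_def)
      finally have "ip (T (u j)) (u i) = 0" using sa[of "u j" "u i"] uV[OF j] uV[OF im] by simp
      then show ?thesis using uV[OF j] uV[OF im] T(1) u i j by (simp add: w_def onfam_def)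
    qed
    obtain c where c: "w = (\<Sum>k<j. cscale (c k) (u k))" using span_lessThan_comb w by blast
    have "ip w w = (\<Sum>k<j. cnj (c k) * ip w (u k))" by (subst (2) c) (use wV uV j in \<open>simp\<close>)
    then have "ip w w = 0" using wi by simp
    then have "w = 0" using pos[OF wV] by force
    then show ?thesis by (simp add: w_def)
  qed
  then show ?thesis using u sp[of m] by blast
qed

end

text \<open>Sequences vanishing from N on serve as the coordinate space, since the dimension N is a
  variable and cannot be part of a type.\<close>

definition cn_space :: "nat \<Rightarrow> (nat \<Rightarrow> complex) set" where "cn_space N = {a. \<forall>i\<ge>N. a i = 0}"
definition cn_ip :: "nat \<Rightarrow> (nat \<Rightarrow> complex) \<Rightarrow> (nat \<Rightarrow> complex) \<Rightarrow> complex" where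
  "cn_ip N a b = (\<Sum>i<N. a i * cnj (b i))"

lemma cn_herm_space: "herm_space (cn_space N) (cn_ip N)"
proof (rule herm_spaceI)
  show "csubspace (cn_space N)" by (auto simp: csubspace_def cn_space_def cscale_fun_def cscale_complex_def)
qed (auto simp: cn_ip_def cscale_fun_def cscale_complex_def sum.distrib sum_distrib_left algebra_simps)

lemma cn_ip_pos:
  assumes "a \<in> cn_space N" "a \<noteq> 0" shows "0 < Re (cn_ip N a a)"
proof -
  obtain i where i: "a i \<noteq> 0" using assms(2) by (auto simp: fun_eq_iff)
  then have "i < N" using assms(1) by (auto simp: cn_space_def not_le[symmetric])
  have "Re (cn_ip N a a) = (\<Sum>i<N. (cmod (a i))\<^sup>2)"
    by (simp add: cn_ip_def complex_norm_square[symmetric] del: of_real_power)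
  also have "\<dots> > 0" by (rule sum_pos2[of _ i]) (use i \<open>i < N\<close> in auto)
  finally show ?thesis .
qed

text \<open>In a triangular similarity \<open>M = P B Q\<close> the columns of P form a flag on
  which M acts triangularly with diagonal \<open>ds\<close>. Orthonormalizing this flag diagonalizes
  M and keeps the list \<open>ds\<close>, hence also the multiplicities in the characteristic
  polynomial.\<close>

lemma unitary_diagonalization:
  assumes M: "M \<in> carrier_mat N N" and herm: "\<And>i j. i < N \<Longrightarrow> j < N \<Longrightarrow> M $$ (i, j) = cnj (M $$ (j, i))"
  shows "\<exists>u ds. length ds = N \<and> char_poly M = (\<Prod>d\<leftarrow>ds. [:- d, 1:]) \<and> onfam (cn_space N) (cn_ip N) N u \<and>
    cv.span (u ` {..<N}) = cn_space N \<and> (\<forall>j<N. \<forall>l<N. (\<Sum>i<N. M $$ (l, i) * u j i) = ds ! j * u j l)"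
proof -
  interpret E: herm_space "cn_space N" "cn_ip N" by (rule cn_herm_space)
  obtain ds where ds: "char_poly M = (\<Prod>d\<leftarrow>ds. [:- d, 1:])" "length ds = N"
    using char_poly_factorized[OF M] by blast
  obtain B P Q where dec: "schur_decomposition M ds = (B, P, Q)" by (cases "schur_decomposition M ds")
  have sim: "similar_mat_wit M B P Q" and ut: "upper_triangular B" and dg: "diag_mat B = ds"
    using schur_decomposition[OF M ds(1) dec] by auto
  have car: "B \<in> carrier_mat N N" "P \<in> carrier_mat N N" "Q \<in> carrier_mat N N" 
    and PQ: "P * Q = 1\<^sub>m N" "Q * P = 1\<^sub>m N" "M = P * B * Q"
    using sim M by (auto simp: similar_mat_wit_def Let_def)
  have MP: "M * P = P * B"
  proof -
    have "M * P = P * B * (Q * P)" unfolding PQ(3) using car by (simp add: assoc_mult_mat[of _ N N _ N _ N])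
    then show ?thesis using car PQ(2) by simp
  qed
  define p where "p j = (\<lambda>i. if i < N then P $$ (i, j) else 0)" for j
  define T where "T a = (\<lambda>l. if l < N then (\<Sum>i<N. M $$ (l, i) * a i) else 0)" for a
  have pV: "p j \<in> cn_space N" for j by (simp add: p_def cn_space_def)
  have comb: "(\<Sum>j\<in>I. cscale (c j) (p j)) i = (\<Sum>j\<in>I. c j * (if i < N then P $$ (i, j) else 0))" for c i I
    by (simp add: fun_sum_apply cscale_fun_def cscale_complex_def p_def)
  \<comment> \<open>Multiplication by the inverse Q recovers the coefficients of a combination of
    the columns of P.\<close>
  have zero: "\<forall>j<N. c j = 0" if c: "(\<Sum>j<N. cscale (c j) (p j)) = 0" for c
  proof (intro allI impI)
    fix k assume k: "k < N"
    have "0 = (\<Sum>i<N. Q $$ (k, i) * (\<Sum>j<N. cscale (c j) (p j)) i)" by (simp add: c)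
    also have "\<dots> = (\<Sum>i<N. \<Sum>j<N. (Q $$ (k, i) * P $$ (i, j)) * c j)"
      unfolding comb by (intro sum.cong refl) (simp add: sum_distrib_left mult_ac)
    also have "\<dots> = (\<Sum>j<N. (\<Sum>i<N. Q $$ (k, i) * P $$ (i, j)) * c j)"
      by (subst sum.swap) (simp add: sum_distrib_right)
    also have "\<dots> = (\<Sum>j<N. (Q * P) $$ (k, j) * c j)"
      using car k by (intro sum.cong refl) (simp add: scalar_prod_def lessThan_atLeast0)
    also have "\<dots> = (\<Sum>j<N. if j = k then c k else 0)" unfolding PQ(2) using k by (intro sum.cong refl) auto
    also have "\<dots> = c k" using k by simp
    finally show "c k = 0" by simp
  qed
  have inj: "inj_on p {..<N}" and indep: "cv.independent (p ` {..<N})" using cv_independent_family[OF zero] by blast+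
  have ind: "p j \<notin> cv.span (p ` {..<j})" if j: "j < N" for j
  proof
    assume "p j \<in> cv.span (p ` {..<j})"
    moreover have "p ` {..<j} \<subseteq> p ` {..<N} - {p j}" using j inj by (auto simp: inj_on_def)
    ultimately have "p j \<in> cv.span (p ` {..<N} - {p j})" using cv.span_mono by blast
    then show False using indep j by (auto simp: cv.dependent_def)
  qed
  have TV: "T x \<in> cn_space N" for x by (simp add: T_def cn_space_def)
  have Tlin: "T (cscale a x + y) = cscale a (T x) + T y" for a x y
    by (auto simp: T_def fun_eq_iff cscale_fun_def cscale_complex_def sum.distrib sum_distrib_left algebra_simps)
  have sa: "cn_ip N (T x) y = cn_ip N x (T y)" for x y
  proof -
    have "cn_ip N (T x) y = (\<Sum>l<N. \<Sum>i<N. M $$ (l, i) * x i * cnj (y l))"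
      by (simp add: cn_ip_def T_def sum_distrib_right)
    also have "\<dots> = (\<Sum>i<N. \<Sum>l<N. M $$ (l, i) * x i * cnj (y l))" by (rule sum.swap)
    also have "\<dots> = (\<Sum>i<N. \<Sum>l<N. x i * cnj (M $$ (i, l) * y l))"
    proof (intro sum.cong refl)
      fix i l assume "i \<in> {..<N}" "l \<in> {..<N}"
      then have "M $$ (l, i) = cnj (M $$ (i, l))" by (intro herm) auto
      then show "M $$ (l, i) * x i * cnj (y l) = x i * cnj (M $$ (i, l) * y l)" by simp
    qed
    also have "\<dots> = cn_ip N x (T y)" by (simp add: cn_ip_def T_def sum_distrib_left)
    finally show ?thesis .
  qed
  have Tp: "T (p j) = (\<Sum>i\<le>j. cscale (B $$ (i, j)) (p i))" if j: "j < N" for j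
  proof
    fix l
    show "T (p j) l = (\<Sum>i\<le>j. cscale (B $$ (i, j)) (p i)) l"
    proof (cases "l < N")
      case True
      have "T (p j) l = (M * P) $$ (l, j)" using True j car M by (simp add: T_def p_def scalar_prod_def lessThan_atLeast0)
      also have "\<dots> = (\<Sum>i<N. P $$ (l, i) * B $$ (i, j))" unfolding MP using True j car by (simp add: scalar_prod_def lessThan_atLeast0)
      also have "\<dots> = (\<Sum>i\<le>j. P $$ (l, i) * B $$ (i, j))"
        using ut car j by (intro sum.mono_neutral_right) (auto simp: upper_triangular_def)
      finally show ?thesis using True by (simp add: comb mult.commute)
    qed (simp add: T_def comb)
  qed
  have tri: "T (p j) - cscale (ds ! j) (p j) \<in> cv.span (p ` {..<j})" if j: "j < N" for j
  proof -
    have "ds ! j = B $$ (j, j)" using j car dg by (auto simp: diag_mat_def)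
    then have "T (p j) - cscale (ds ! j) (p j) = (\<Sum>i<j. cscale (B $$ (i, j)) (p i))"
      using Tp[OF j] by (simp add: lessThan_Suc_atMost[symmetric])
    then show ?thesis by (simp only:) (intro cv.span_sum cv.span_scale cv.span_base, auto)
  qed
  obtain u where u: "onfam (cn_space N) (cn_ip N) N u" "cv.span (u ` {..<N}) = cv.span (p ` {..<N})"
    "\<And>j. j < N \<Longrightarrow> T (u j) = cscale (ds ! j) (u j)"
    using E.selfadjoint_flag_diagonal[OF cn_ip_pos, of N p T "\<lambda>j. ds ! j"] pV ind TV Tlin sa tri by blast
  have "cv.span (p ` {..<N}) = cn_space N"
  proof (intro equalityI subsetI)
    fix a assume a: "a \<in> cn_space N"
    have "a = (\<Sum>j<N. cscale (\<Sum>k<N. Q $$ (j, k) * a k) (p j))"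
    proof
      fix i
      show "a i = (\<Sum>j<N. cscale (\<Sum>k<N. Q $$ (j, k) * a k) (p j)) i"
      proof (cases "i < N")
        case True
        have "(\<Sum>j<N. cscale (\<Sum>k<N. Q $$ (j, k) * a k) (p j)) i = (\<Sum>j<N. \<Sum>k<N. (P $$ (i, j) * Q $$ (j, k)) * a k)"
          unfolding comb using True by (intro sum.cong refl) (simp add: sum_distrib_left mult_ac)
        also have "\<dots> = (\<Sum>k<N. (\<Sum>j<N. P $$ (i, j) * Q $$ (j, k)) * a k)"
          by (subst sum.swap) (simp add: sum_distrib_right)
        also have "\<dots> = (\<Sum>k<N. (P * Q) $$ (i, k) * a k)"
          using car True by (intro sum.cong refl) (simp add: scalar_prod_def lessThan_atLeast0)
        also have "\<dots> = (\<Sum>k<N. if k = i then a i else 0)" unfolding PQ(1) using True by (intro sum.cong refl) auto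
        finally show ?thesis using True by simp
      qed (use a in \<open>simp add: comb cn_space_def\<close>)
    qed
    then show "a \<in> cv.span (p ` {..<N})"
      using cv.span_sum[of "{..<N}" "\<lambda>j. cscale (\<Sum>k<N. Q $$ (j, k) * a k) (p j)" "p ` {..<N}"]
      by (simp add: cv.span_scale cv.span_base)
  next
    fix a assume "a \<in> cv.span (p ` {..<N})"
    then show "a \<in> cn_space N" using cv.span_minimal[of "p ` {..<N}" "cn_space N"] E.subspaceV pV by blast
  qed
  moreover have "(\<Sum>i<N. M $$ (l, i) * u j i) = ds ! j * u j l" if "j < N" "l < N" for j l
    using fun_cong[OF u(3)[OF that(1)], of l] that by (simp add: T_def cscale_fun_def cscale_complex_def)
  ultimately show ?thesis using ds u by blast
qed

lemma order_linear_factors: "Polynomial.order a (\<Prod>d\<leftarrow>ds. [:- d, 1:]) = count_list ds (a::complex)"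
proof (induction ds)
  case (Cons d ds)
  have nz: "(\<Prod>d\<leftarrow>ds. [:- d, 1:]) \<noteq> 0" by (auto simp: prod_list_zero_iff)
  have o: "Polynomial.order a [:- d, 1:] = (if d = a then 1 else 0)"
    using order_power_n_n[of d 1] by (auto intro: order_0I)
  have "Polynomial.order a (\<Prod>d\<leftarrow>d # ds. [:- d, 1:]) = Polynomial.order a [:- d, 1:] + Polynomial.order a (\<Prod>d\<leftarrow>ds. [:- d, 1:])"
    using order_mult[of "[:- d, 1:]" "\<Prod>d\<leftarrow>ds. [:- d, 1:]" a] nz by (simp del: mult_pCons_left)
  then show ?case using Cons.IH by (simp only: o) simp
qed simp

text \<open>Root orders count repetitions in \<open>ds\<close>, and the sets of positions belonging
  to distinct roots are disjoint.\<close>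

lemma num_neg_eig_factored:
  assumes "char_poly M = (\<Prod>d\<leftarrow>ds. [:- d, 1:])" "\<And>d. d \<in> set ds \<Longrightarrow> Im d = 0"
  shows "num_neg_eig M = card {j. j < length ds \<and> Re (ds ! j) < 0}"
proof -
  let ?A = "{a. poly (char_poly M) a = 0 \<and> Im a = 0 \<and> Re a < 0}"
  have A: "?A = {a \<in> set ds. Re a < 0}"
    unfolding assms(1) using assms(2) by (auto simp: poly_prod_list prod_list_zero_iff)
  have cnt: "count_list ds a = card {j. j < length ds \<and> ds ! j = a}" for a
    unfolding count_list_eq_length_filter length_filter_conv_card by (rule arg_cong[of _ _ card]) auto
  have "num_neg_eig M = (\<Sum>a\<in>?A. card {j. j < length ds \<and> ds ! j = a})"
    unfolding num_neg_eig_def unfolding assms(1) order_linear_factors cnt ..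
  also have "\<dots> = card (\<Union>a\<in>?A. {j. j < length ds \<and> ds ! j = a})"
    unfolding A by (rule card_UN_disjoint[symmetric]) auto
  also have "(\<Union>a\<in>?A. {j. j < length ds \<and> ds ! j = a}) = {j. j < length ds \<and> Re (ds ! j) < 0}"
    unfolding A by auto
  finally show ?thesis .
qed

text \<open>The bridge from eigenvalue counts to inertia. Orthonormal eigenvectors of the Gram
  matrix, used as coefficients, give combinations \<open>x j\<close> of the \<open>v i\<close> that
  are mutually orthogonal for \<open>ip\<close> and have the eigenvalues \<open>ds ! j\<close> as
  squares. The normalized negative ones form a maximal family, even when the \<open>v i\<close> are
  dependent.\<close>

theorem (in herm_space) gram_maxneg:
  assumes v: "\<And>i. i < N \<Longrightarrow> v i \<in> V"
  shows "\<exists>e. maxneg (cv.span (v ` {..<N})) ip (num_neg_eig (mat N N (\<lambda>(l, j). ip (v j) (v l)))) e"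
proof -
  define M where "M = mat N N (\<lambda>(l, j). ip (v j) (v l))"
  have Mc: "M \<in> carrier_mat N N" by (simp add: M_def)
  have Mij: "M $$ (l, j) = ip (v j) (v l)" if "l < N" "j < N" for l j using that by (simp add: M_def)
  have Mh: "M $$ (i, j) = cnj (M $$ (j, i))" if "i < N" "j < N" for i j
    unfolding Mij[OF that] Mij[OF that(2,1)] using v that by (intro sym) auto
  obtain u ds where ds: "length ds = N" "char_poly M = (\<Prod>d\<leftarrow>ds. [:- d, 1:])"
    and u: "onfam (cn_space N) (cn_ip N) N u" "cv.span (u ` {..<N}) = cn_space N" 
      "\<And>j l. j < N \<Longrightarrow> l < N \<Longrightarrow> (\<Sum>i<N. M $$ (l, i) * u j i) = ds ! j * u j l"
    using unitary_diagonalization[OF Mc Mh] by blast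
  interpret E: herm_space "cn_space N" "cn_ip N" by (rule cn_herm_space)
  define x where "x j = (\<Sum>i<N. cscale (u j i) (v i))" for j
  have xV: "x j \<in> V" for j unfolding x_def using v by simp
  have xx: "ip (x j) (x k) = (if j = k then ds ! j else 0)" if jk: "j < N" "k < N" for j k
  proof -
    have "ip (x j) (x k) = (\<Sum>l<N. cnj (u k l) * ip (x j) (v l))"
      by (subst x_def[of k]) (use v xV in simp)
    also have "\<dots> = (\<Sum>l<N. cnj (u k l) * (\<Sum>i<N. M $$ (l, i) * u j i))"
      by (intro sum.cong refl) (use v in \<open>simp add: x_def Mij mult.commute\<close>)
    also have "\<dots> = ds ! j * cn_ip N (u j) (u k)"
      using u(3)[OF jk(1)] by (simp add: cn_ip_def sum_distrib_left mult_ac)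
    finally show ?thesis using u(1) jk by (simp add: onfam_def)
  qed
  have dreal: "Im (ds ! j) = 0" if "j < N" for j
    using self_real[OF xV[of j]] xx[OF that that] by (metis Im_complex_of_real)
  have num: "num_neg_eig M = card {j. j < N \<and> Re (ds ! j) < 0}"
    using num_neg_eig_factored[OF ds(2)] dreal ds(1) by (metis in_set_conv_nth)
  define k where "k = num_neg_eig M"
  define Ng where "Ng = {j. j < N \<and> Re (ds ! j) < 0}"
  have "finite Ng" by (simp add: Ng_def)
  then obtain f where f: "bij_betw f {..<k} Ng"
    using ex_bij_betw_nat_finite[of Ng] num by (auto simp: k_def Ng_def lessThan_atLeast0)
  have fN: "f i < N" "Re (ds ! f i) < 0" if "i < k" for i
    using f that by (auto simp: bij_betw_def Ng_def)
  have finj: "f i = f j \<longleftrightarrow> i = j" if "i < k" "j < k" for i j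
    using f that by (auto simp: bij_betw_def inj_on_def)
  define r where "r j = sqrt (- Re (ds ! j))" for j
  define e where "e i = cscale (of_real (1 / r (f i))) (x (f i))" for i
  let ?Y = "cv.span (v ` {..<N})"
  have YV: "?Y \<subseteq> V" using v by (intro cv.span_minimal subspaceV) auto
  have xY: "x j \<in> ?Y" for j unfolding x_def by (intro cv.span_sum cv.span_scale cv.span_base) auto
  have eY: "e i \<in> ?Y" for i unfolding e_def by (intro cv.span_scale xY)
  have r: "r (f i) > 0" "r (f i) * r (f i) = - Re (ds ! f i)" if "i < k" for i using fN[OF that] by (simp_all add: r_def)
  have dr: "ds ! f i = - of_real (r (f i) * r (f i))" if "i < k" for i
    using r[OF that] dreal[OF fN(1)[OF that]] by (simp add: complex_eq_iff)
  have neg: "negfam ?Y ip k e"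
    unfolding negfam_def
  proof (intro conjI allI impI eY)
    fix i j assume ij: "i < k" "j < k"
    have "ip (e i) (e j) = of_real (1 / r (f i)) * (of_real (1 / r (f j)) * ip (x (f i)) (x (f j)))"
      using xV by (simp add: e_def)
    also have "\<dots> = (if i = j then -1 else 0)"
      using xx[OF fN(1)[OF ij(1)] fN(1)[OF ij(2)]] finj[OF ij] dr[OF ij(1)] r(1)[OF ij(1)] by auto
    finally show "ip (e i) (e j) = (if i = j then -1 else 0)" .
  qed
  have "0 \<le> Re (hform ip k e y y)" if y: "y \<in> ?Y" for y
  proof -
    obtain a where a: "y = (\<Sum>i<N. cscale (a i) (v i))" using span_lessThan_comb[OF y] by blast
    \<comment> \<open>Padding by zero puts the coefficients into \<open>cn_space N\<close>, where
      they expand in the eigenvectors.\<close>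
    define a' where "a' = (\<lambda>i. if i < N then a i else 0)"
    have "a' \<in> cv.span (u ` {..<N})" unfolding u(2) by (simp add: a'_def cn_space_def)
    then obtain b where b: "a' = (\<Sum>j<N. cscale (b j) (u j))" using E.span_lessThan_comb by blast
    have "y = (\<Sum>i<N. cscale (a' i) (v i))" unfolding a by (intro sum.cong) (auto simp: a'_def)
    also have "\<dots> = (\<Sum>i<N. \<Sum>j<N. cscale (b j * u j i) (v i))"
      unfolding b by (simp add: fun_sum_apply cscale_fun_def cscale_complex_def cv.scale_sum_left)
    also have "\<dots> = (\<Sum>j<N. cscale (b j) (x j))"
      by (subst sum.swap) (simp add: x_def cv.scale_sum_right)
    finally have yx: "y = (\<Sum>j<N. cscale (b j) (x j))" .
    have yV: "y \<in> V" using y YV by blast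
    have yj: "ip y (x j) = b j * ds ! j" if j: "j < N" for j
    proof -
      have "ip y (x j) = (\<Sum>i<N. b i * ip (x i) (x j))" unfolding yx using xV by simp
      also have "\<dots> = (\<Sum>i<N. if i = j then b j * ds ! j else 0)" using xx j by (intro sum.cong refl) auto
      finally show ?thesis using j by simp
    qed
    have "ip y y = (\<Sum>j<N. cnj (b j) * ip y (x j))" by (subst (2) yx) (use xV yV in simp)
    also have "\<dots> = (\<Sum>j<N. of_real ((cmod (b j))\<^sup>2) * ds ! j)"
      by (intro sum.cong refl) (simp add: yj complex_norm_square del: of_real_power)
    finally have "Re (ip y y) = (\<Sum>j<N. (cmod (b j))\<^sup>2 * Re (ds ! j))" by (simp del: of_real_power)
    \<comment> \<open>Adding this sum twice to \<open>ip y y\<close> reverses the sign of exactly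
      the terms with negative eigenvalue.\<close>
    moreover have "(\<Sum>i<k. (cmod (ip y (e i)))\<^sup>2) = (\<Sum>j\<in>Ng. - ((cmod (b j))\<^sup>2 * Re (ds ! j)))"
    proof -
      have "(cmod (ip y (e i)))\<^sup>2 = - ((cmod (b (f i)))\<^sup>2 * Re (ds ! f i))" if i: "i < k" for i
      proof -
        have "ip y (e i) = of_real (1 / r (f i)) * (b (f i) * ds ! f i)"
          using xV yV yj[OF fN(1)[OF i]] by (simp add: e_def)
        also have "\<dots> = - of_real (r (f i)) * b (f i)" unfolding dr[OF i] using r(1)[OF i] by simp
        finally have "(cmod (ip y (e i)))\<^sup>2 = (r (f i) * r (f i)) * (cmod (b (f i)))\<^sup>2"
          using r(1)[OF i] by (simp add: norm_mult power_mult_distrib power2_eq_square)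
        then show ?thesis using r(2)[OF i] by simp
      qed
      then have "(\<Sum>i<k. (cmod (ip y (e i)))\<^sup>2) = (\<Sum>i<k. - ((cmod (b (f i)))\<^sup>2 * Re (ds ! f i)))" by simp
      also have "\<dots> = (\<Sum>j\<in>Ng. - ((cmod (b j))\<^sup>2 * Re (ds ! j)))"
        by (rule sum.reindex_bij_betw[OF f])
      finally show ?thesis .
    qed
    moreover have "Re (hform ip k e y y) = Re (ip y y) + 2 * (\<Sum>i<k. (cmod (ip y (e i)))\<^sup>2)"
      by (subst hform_self) (use eY YV yV in auto)
    moreover have "(\<Sum>j<N. (cmod (b j))\<^sup>2 * Re (ds ! j)) = (\<Sum>j\<in>Ng. (cmod (b j))\<^sup>2 * Re (ds ! j)) + (\<Sum>j\<in>{..<N}-Ng. (cmod (b j))\<^sup>2 * Re (ds ! j))"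
      using sum.subset_diff[of Ng "{..<N}"] by (simp add: Ng_def subset_eq add.commute)
    moreover have "0 \<le> (\<Sum>j\<in>{..<N}-Ng. (cmod (b j))\<^sup>2 * Re (ds ! j))" by (intro sum_nonneg) (auto simp: Ng_def)
    moreover have "0 \<le> (\<Sum>j\<in>Ng. - ((cmod (b j))\<^sup>2 * Re (ds ! j)))"
      by (intro sum_nonneg) (auto simp: Ng_def mult_nonneg_nonpos)
    ultimately show ?thesis by (simp add: sum_negf)
  qed
  then show ?thesis using neg unfolding maxneg_def k_def M_def by blast
qed

section \<open>The Hilbert space with a positive kernel operator\<close>

context psd_space begin

lemma fcauchy_comb:
  assumes s: "\<And>n. s n \<in> V" "fcauchy ip s" and t: "\<And>n. t n \<in> V" "fcauchy ip t"
  shows "fcauchy ip (\<lambda>n. cscale a (s n) + t n)"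
  unfolding fcauchy_def
proof (intro allI impI)
  fix e :: real assume e: "e > 0"
  define d where "d = e / (2 * (cmod a + 1))"
  have a1: "cmod a + 1 > 0" by (smt (verit) norm_ge_zero)
  have d: "d > 0" "(cmod a + 1) * d = e / 2" using e a1 by (auto simp: d_def field_simps)
  obtain N1 where N1: "\<And>m n. m \<ge> N1 \<Longrightarrow> n \<ge> N1 \<Longrightarrow> fnorm ip (s m - s n) < d" using s(2) d(1) unfolding fcauchy_def by metis
  obtain N2 where N2: "\<And>m n. m \<ge> N2 \<Longrightarrow> n \<ge> N2 \<Longrightarrow> fnorm ip (t m - t n) < e / 2" using t(2) e unfolding fcauchy_def by (metis half_gt_zero)
  have "fnorm ip (cscale a (s m) + t m - (cscale a (s n) + t n)) < e" if "m \<ge> max N1 N2" "n \<ge> max N1 N2" for m n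
  proof -
    have eq: "cscale a (s m) + t m - (cscale a (s n) + t n) = cscale a (s m - s n) + (t m - t n)"
      by (simp add: cv.scale_right_diff_distrib)
    have "fnorm ip (cscale a (s m) + t m - (cscale a (s n) + t n)) \<le> cmod a * fnorm ip (s m - s n) + fnorm ip (t m - t n)"
      unfolding eq using fnorm_triangle[of "cscale a (s m - s n)" "t m - t n"] fnorm_scale[of "s m - s n" a] s(1) t(1) by simp
    also have "\<dots> < (cmod a + 1) * d + e / 2"
    proof (rule add_le_less_mono)
      have "cmod a * fnorm ip (s m - s n) \<le> cmod a * d" using N1[of m n] that by (intro mult_left_mono) auto
      also have "\<dots> \<le> (cmod a + 1) * d" using d(1) by (intro mult_right_mono) auto
      finally show "cmod a * fnorm ip (s m - s n) \<le> (cmod a + 1) * d" .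
    qed (use N2[of m n] that in auto)
    finally show ?thesis using d(2) by simp
  qed
  then show "\<exists>N. \<forall>m\<ge>N. \<forall>n\<ge>N. fnorm ip (cscale a (s m) + t m - (cscale a (s n) + t n)) < e" by blast
qed

text \<open>Values of the form converge along Cauchy sequences even when the sequences themselves
  have no limit; this defines the inner product on a completion.\<close>

lemma fcauchy_ip_convergent:
  assumes s: "\<And>n. s n \<in> V" "fcauchy ip s" and t: "\<And>n. t n \<in> V" "fcauchy ip t"
  shows "convergent (\<lambda>n. ip (s n) (t n))"
proof -
  obtain B1 where B1: "\<And>n. fnorm ip (s n) \<le> B1" using fcauchy_bounded[OF s] by blast
  obtain B2 where B2: "\<And>n. fnorm ip (t n) \<le> B2" using fcauchy_bounded[OF t] by blast
  define B where "B = max (max B1 B2) 1"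
  have B: "B > 0" "\<And>n. fnorm ip (s n) \<le> B" "\<And>n. fnorm ip (t n) \<le> B"
    using B1 B2 by (auto simp: B_def le_max_iff_disj)
  have "Cauchy (\<lambda>n. ip (s n) (t n))"
    unfolding Cauchy_def dist_norm
  proof (intro allI impI)
    fix e :: real assume e: "e > 0"
    define d where "d = e / (2 * B)"
    have d: "d > 0" "B * d = e / 2" using e B(1) by (auto simp: d_def field_simps)
    obtain N1 where N1: "\<And>m n. m \<ge> N1 \<Longrightarrow> n \<ge> N1 \<Longrightarrow> fnorm ip (s m - s n) < d" using s(2) d(1) unfolding fcauchy_def by metis
    obtain N2 where N2: "\<And>m n. m \<ge> N2 \<Longrightarrow> n \<ge> N2 \<Longrightarrow> fnorm ip (t m - t n) < d" using t(2) d(1) unfolding fcauchy_def by metis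
    have "norm (ip (s m) (t m) - ip (s n) (t n)) < e" if "m \<ge> max N1 N2" "n \<ge> max N1 N2" for m n
    proof -
      have "ip (s m) (t m) - ip (s n) (t n) = ip (s m - s n) (t m) + ip (s n) (t m - t n)" using s(1) t(1) by simp
      also have "norm \<dots> \<le> fnorm ip (s m - s n) * fnorm ip (t m) + fnorm ip (s n) * fnorm ip (t m - t n)"
        using s(1) t(1) by (intro norm_triangle_le add_mono cauchy_schwarz) auto
      also have "\<dots> \<le> fnorm ip (s m - s n) * B + B * fnorm ip (t m - t n)"
        using B s(1) t(1) by (intro add_mono mult_left_mono mult_right_mono) auto
      also have "\<dots> < d * B + B * d"
        using N1[of m n] N2[of m n] that B(1) by (intro add_strict_mono mult_strict_right_mono mult_strict_left_mono) auto
      finally show ?thesis using d(2) by (simp add: mult.commute)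
    qed
    then show "\<exists>M. \<forall>m\<ge>M. \<forall>n\<ge>M. norm (ip (s m) (t m) - ip (s n) (t n)) < e" by blast
  qed
  then show ?thesis by (rule Cauchy_convergent)
qed

end

text \<open>H is the range of the square root of A. It is obtained without square roots as the set of limits
  of \<open>A (m n)\<close> over all sequences m that are Cauchy for the semi-inner product \<open>ip (A x) y\<close>.\<close>
theorem (in hilb) positive_kernel_space:
  assumes A_mem: "\<And>x. x \<in> V \<Longrightarrow> A x \<in> V"
    and A_lin: "\<And>x y a. x \<in> V \<Longrightarrow> y \<in> V \<Longrightarrow> A (cscale a x + y) = cscale a (A x) + A y"
    and A_sa: "\<And>x y. x \<in> V \<Longrightarrow> y \<in> V \<Longrightarrow> ip (A x) y = ip x (A y)"
    and A_pos: "\<And>x. x \<in> V \<Longrightarrow> 0 \<le> Re (ip (A x) x)"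
    and A_bound: "\<And>x. x \<in> V \<Longrightarrow> fnorm ip (A x) \<le> c * fnorm ip x"
  shows "\<exists>H h1. hilb H h1 \<and> H \<subseteq> V \<and> (\<forall>m\<in>V. A m \<in> H) \<and> (\<forall>u\<in>H. \<forall>m\<in>V. h1 u (A m) = ip u m)"
proof -
  define q where "q x y = ip (A x) y" for x y
  interpret q: herm_space V q
  proof (rule herm_spaceI[OF sub])
    show "q (cscale a x + y) z = a * q x z + q y z" if "x \<in> V" "y \<in> V" "z \<in> V" for x y z a
      using that by (simp add: q_def A_lin A_mem)
    show "q x y = cnj (q y x)" if "x \<in> V" "y \<in> V" for x y
      unfolding q_def A_sa[OF that] using that A_mem by (intro sym)
  qed
  interpret q: psd_space V q by unfold_locales (simp add: q_def A_pos)
  have A0: "A 0 = 0" using A_lin[of 0 0 1] by (simp add: cscale_one)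
  have A_diff: "A (x - y) = A x - A y" if "x \<in> V" "y \<in> V" for x y
    using A_lin[OF that(2,1), of "-1"] that by simp
  define C where "C = sqrt \<bar>c\<bar>"
  have C: "C \<ge> 0" "C * C = \<bar>c\<bar>" by (auto simp: C_def)
  \<comment> \<open>The square of the norm of \<open>A x\<close> equals \<open>q x (A x)\<close>.
    Cauchy-Schwarz for q bounds it by the q-seminorm of x times that of \<open>A x\<close>, and the
    latter is at most C times the norm of \<open>A x\<close>. The factor C plays the part of a norm
    of the square root of A.\<close>
  have bd: "fnorm ip (A x) \<le> C * fnorm q x" if x: "x \<in> V" for x
  proof -
    have Ax: "A x \<in> V" "A (A x) \<in> V" using x A_mem by auto
    have "(fnorm q (A x))\<^sup>2 = Re (ip (A (A x)) (A x))" using q.sq_fnorm[OF Ax(1)] by (simp add: q_def)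
    also have "\<dots> \<le> fnorm ip (A (A x)) * fnorm ip (A x)" 
      using cauchy_schwarz[OF Ax(2,1)] complex_Re_le_cmod order_trans by blast
    also have "\<dots> \<le> (c * fnorm ip (A x)) * fnorm ip (A x)" using A_bound[OF Ax(1)] Ax by (intro mult_right_mono) auto
    also have "\<dots> \<le> (\<bar>c\<bar> * fnorm ip (A x)) * fnorm ip (A x)" using Ax by (intro mult_right_mono) auto
    also have "\<dots> = (C * fnorm ip (A x))\<^sup>2" using C(2) by (simp add: power2_eq_square mult_ac)
    finally have qa: "fnorm q (A x) \<le> C * fnorm ip (A x)" by (rule power2_le_imp_le) (use C Ax in auto)
    have "fnorm ip (A x) * fnorm ip (A x) = Re (q x (A x))" using sq_fnorm[OF Ax(1)] by (simp add: q_def power2_eq_square)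
    also have "\<dots> \<le> fnorm q x * fnorm q (A x)" using q.cauchy_schwarz[OF x Ax(1)] complex_Re_le_cmod order_trans by blast
    also have "\<dots> \<le> fnorm q x * (C * fnorm ip (A x))" using qa x by (intro mult_left_mono) auto
    finally have "fnorm ip (A x) * fnorm ip (A x) \<le> (C * fnorm q x) * fnorm ip (A x)" by (simp add: mult_ac)
    then show ?thesis using C x Ax by (cases "fnorm ip (A x) = 0") (auto simp: mult_le_cancel_right less_le)
  qed
  \<comment> \<open>The point of the q-completion given by s is realized inside V as the limit u of
    the vectors \<open>A (s n)\<close>.\<close>
  define rep where "rep s u \<longleftrightarrow> (\<forall>n::nat. s n \<in> V) \<and> fcauchy q s \<and> u \<in> V \<and> fconv ip (\<lambda>n. A (s n)) u" for s u
  define H where "H = {u. \<exists>s. rep s u}"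
  have repV: "s n \<in> V" "u \<in> V" if "rep s u" for s u n using that by (auto simp: rep_def)
  have half: "\<exists>l. (\<lambda>n. q (s n) (t n)) \<longlonglongrightarrow> l \<and> (\<lambda>n. ip u (t n)) \<longlonglongrightarrow> l" if s: "rep s u" and t: "rep t w" for s u t w
  proof -
    obtain l where l: "(\<lambda>n. q (s n) (t n)) \<longlonglongrightarrow> l"
      using q.fcauchy_ip_convergent[of s t] s t unfolding rep_def convergent_def by blast
    obtain B where B: "\<And>n. fnorm q (t n) \<le> B" using q.fcauchy_bounded[of t] t unfolding rep_def by blast
    have B0: "B + 1 > 0" using B[of 0] q.fnorm_nonneg[OF repV(1)[OF t], of 0] by linarith
    \<comment> \<open>The error \<open>q (s k - s n) (t n)\<close> is small uniformly in k and n
      beyond N because t is bounded in the q-seminorm; for fixed n the limit in k replaces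
      \<open>A (s k)\<close> by u.\<close>
    have "(\<lambda>n. ip u (t n) - q (s n) (t n)) \<longlonglongrightarrow> 0"
      unfolding LIMSEQ_iff
    proof (intro allI impI)
      fix e :: real assume e: "e > 0"
      define d where "d = e / (2 * (B + 1))"
      have d: "d > 0" "(B + 1) * d = e / 2" using e B0 by (auto simp: d_def field_simps)
      obtain N where N: "\<And>m n. m \<ge> N \<Longrightarrow> n \<ge> N \<Longrightarrow> fnorm q (s m - s n) < d" 
        using s d(1) unfolding rep_def fcauchy_def by metis
      have "norm (ip u (t n) - q (s n) (t n)) \<le> e / 2" if n: "n \<ge> N" for n
      proof (rule LIMSEQ_le_const2)
        have "(\<lambda>k. ip (A (s k)) (t n)) \<longlonglongrightarrow> ip u (t n)"
          by (rule fconv_ip) (use s repV[OF s] repV[OF t] A_mem fconv_const in \<open>auto simp: rep_def\<close>)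
        then show "(\<lambda>k. norm (q (s k) (t n) - q (s n) (t n))) \<longlonglongrightarrow> norm (ip u (t n) - q (s n) (t n))"
          unfolding q_def by (intro tendsto_intros)
        have "norm (q (s k) (t n) - q (s n) (t n)) \<le> e / 2" if k: "k \<ge> N" for k
        proof -
          have "q (s k) (t n) - q (s n) (t n) = q (s k - s n) (t n)" using repV[OF s] repV[OF t] by simp
          also have "norm \<dots> \<le> fnorm q (s k - s n) * fnorm q (t n)" using repV[OF s] repV[OF t] by (intro q.cauchy_schwarz) auto
          also have "\<dots> \<le> d * (B + 1)"
            using N[OF k n] B[of n] repV[OF s] repV[OF t] d by (intro mult_mono) auto
          finally show ?thesis using d by (simp add: mult.commute)
        qed
        then show "\<exists>N. \<forall>k\<ge>N. norm (q (s k) (t n) - q (s n) (t n)) \<le> e / 2" by blast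
      qed
      then show "\<exists>no. \<forall>n\<ge>no. norm (ip u (t n) - q (s n) (t n) - 0) < e" using e by (intro exI[of _ N]) force
    qed
    from tendsto_add[OF this l] have "(\<lambda>n. ip u (t n)) \<longlonglongrightarrow> l" by simp
    then show ?thesis using l by blast
  qed
  have key: "\<exists>l. (\<lambda>n. q (s n) (t n)) \<longlonglongrightarrow> l \<and> (\<lambda>n. ip u (t n)) \<longlonglongrightarrow> l \<and> (\<lambda>n. ip (s n) w) \<longlonglongrightarrow> l" 
    if s: "rep s u" and t: "rep t w" for s u t w
  proof -
    obtain l where l: "(\<lambda>n. q (s n) (t n)) \<longlonglongrightarrow> l" "(\<lambda>n. ip u (t n)) \<longlonglongrightarrow> l" using half[OF s t] by blast
    obtain l' where l': "(\<lambda>n. q (t n) (s n)) \<longlonglongrightarrow> l'" "(\<lambda>n. ip w (s n)) \<longlonglongrightarrow> l'" using half[OF t s] by blast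
    have e1: "(\<lambda>n. cnj (q (t n) (s n))) = (\<lambda>n. q (s n) (t n))"
      using q.sym[of "s _" "t _"] repV[OF s] repV[OF t] by auto
    have e2: "(\<lambda>n. cnj (ip w (s n))) = (\<lambda>n. ip (s n) w)"
      using sym[of "s _" w] repV[OF s] repV[OF t] by auto
    have "(\<lambda>n. q (s n) (t n)) \<longlonglongrightarrow> cnj l'" using tendsto_cnj[OF l'(1)] by (simp only: e1)
    then have "cnj l' = l" using l(1) LIMSEQ_unique by blast
    moreover have "(\<lambda>n. ip (s n) w) \<longlonglongrightarrow> cnj l'" using tendsto_cnj[OF l'(2)] by (simp only: e2)
    ultimately show ?thesis using l by blast
  qed
  define r where "r u = (SOME s. rep s u)" for u
  have r: "rep (r u) u" if "u \<in> H" for u using that someI_ex[of "\<lambda>s. rep s u"] by (simp add: H_def r_def)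
  define h1 where "h1 u w = lim (\<lambda>n. ip u (r w n))" for u w
  have HI: "rep s u \<Longrightarrow> u \<in> H" for s u by (auto simp: H_def)
  \<comment> \<open>Independence of the representative: the limits for t and for the chosen
    \<open>r w\<close> both equal the limit of \<open>ip (s n) w\<close>, which involves w
    alone.\<close>
  have L: "(\<lambda>n. q (s n) (t n)) \<longlonglongrightarrow> h1 u w" "(\<lambda>n. ip u (t n)) \<longlonglongrightarrow> h1 u w" if s: "rep s u" and t: "rep t w" for s t u w
  proof -
    obtain l where l: "(\<lambda>n. ip u (r w n)) \<longlonglongrightarrow> l" "(\<lambda>n. ip (s n) w) \<longlonglongrightarrow> l"
      using key[OF s r[OF HI[OF t]]] by blast
    obtain l' where l': "(\<lambda>n. q (s n) (t n)) \<longlonglongrightarrow> l'" "(\<lambda>n. ip u (t n)) \<longlonglongrightarrow> l'" "(\<lambda>n. ip (s n) w) \<longlonglongrightarrow> l'"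
      using key[OF s t] by blast
    have "l' = l" using l(2) l'(3) LIMSEQ_unique by blast
    moreover have "h1 u w = l" unfolding h1_def using l(1) by (rule limI)
    ultimately show "(\<lambda>n. q (s n) (t n)) \<longlonglongrightarrow> h1 u w" "(\<lambda>n. ip u (t n)) \<longlonglongrightarrow> h1 u w" using l' by auto
  qed
  have rep_comb: "rep (\<lambda>n. cscale a (s n) + t n) (cscale a u + w)" if s: "rep s u" and t: "rep t w" for s t u w a
    unfolding rep_def
  proof (intro conjI allI)
    show "fcauchy q (\<lambda>n. cscale a (s n) + t n)" using s t by (intro q.fcauchy_comb) (auto simp: rep_def)
    have "fconv ip (\<lambda>n. cscale a (A (s n)) + A (t n)) (cscale a u + w)"
      using s t A_mem by (intro fconv_add fconv_scale) (auto simp: rep_def)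
    then show "fconv ip (\<lambda>n. A (cscale a (s n) + t n)) (cscale a u + w)"
      using s t A_lin by (simp add: rep_def)
  qed (use repV[OF s] repV[OF t] in auto)
  have rep_const: "rep (\<lambda>_. m) (A m)" if "m \<in> V" for m
    unfolding rep_def using that A_mem by (auto simp: fcauchy_def fconv_const)
  have rep_diff: "rep (\<lambda>n. s n - t n) (u - w)" if s: "rep s u" and t: "rep t w" for s t u w
  proof -
    have "rep (\<lambda>n. cscale (-1) (t n) + s n) (cscale (-1) w + u)" by (rule rep_comb[OF t s])
    then show ?thesis by simp
  qed
  have HV: "H \<subseteq> V" by (auto simp: H_def rep_def)
  have AH: "A m \<in> H" if "m \<in> V" for m using rep_const[OF that] by (rule HI)
  have h1A: "h1 u (A m) = ip u m" if "u \<in> H" "m \<in> V" for u m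
    using L(2)[OF r[OF that(1)] rep_const[OF that(2)]] by (simp add: LIMSEQ_const_iff)
  have subH: "csubspace H"
    unfolding csubspace_def
  proof (intro conjI ballI allI impI)
    show "0 \<in> H" using AH[OF zero_mem] by (simp add: A0)
    show "x + y \<in> H" if "x \<in> H" "y \<in> H" for x y using HI[OF rep_comb[OF r r, OF that, of 1]] by (simp add: cscale_one)
    show "cscale a x \<in> H" if "x \<in> H" for a x
      using HI[OF rep_comb[OF r rep_const, OF that zero_mem, of a]] by (simp add: A0)
  qed
  interpret h1: herm_space H h1
  proof (rule herm_spaceI[OF subH])
    show "h1 (cscale a x + y) z = a * h1 x z + h1 y z" if x: "x \<in> H" and y: "y \<in> H" and z: "z \<in> H" for x y z a
    proof (rule LIMSEQ_unique)
      show "(\<lambda>n. ip (cscale a x + y) (r z n)) \<longlonglongrightarrow> h1 (cscale a x + y) z"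
        by (rule L(2)[OF rep_comb[OF r[OF x] r[OF y]] r[OF z]])
      have "(\<lambda>n. a * ip x (r z n) + ip y (r z n)) \<longlonglongrightarrow> a * h1 x z + h1 y z"
        by (intro tendsto_intros L(2)[OF r[OF x] r[OF z]] L(2)[OF r[OF y] r[OF z]])
      moreover have "x \<in> V" "y \<in> V" "\<And>n. r z n \<in> V" using x y HV repV(1)[OF r[OF z]] by auto
      ultimately show "(\<lambda>n. ip (cscale a x + y) (r z n)) \<longlonglongrightarrow> a * h1 x z + h1 y z" by simp
    qed
    show "h1 x y = cnj (h1 y x)" if x: "x \<in> H" and y: "y \<in> H" for x y
    proof (rule LIMSEQ_unique)
      show "(\<lambda>n. q (r x n) (r y n)) \<longlonglongrightarrow> h1 x y" by (rule L(1)[OF r[OF x] r[OF y]])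
      have "(\<lambda>n. cnj (q (r y n) (r x n))) \<longlonglongrightarrow> cnj (h1 y x)" by (intro tendsto_cnj L(1)[OF r[OF y] r[OF x]])
      moreover have "(\<lambda>n. cnj (q (r y n) (r x n))) = (\<lambda>n. q (r x n) (r y n))"
        using q.sym[of "r x _" "r y _"] repV(1)[OF r[OF x]] repV(1)[OF r[OF y]] by auto
      ultimately show "(\<lambda>n. q (r x n) (r y n)) \<longlonglongrightarrow> cnj (h1 y x)" by simp
    qed
  qed
  have Lre: "(\<lambda>n. Re (q (s n) (s n))) \<longlonglongrightarrow> Re (h1 u u)" if "rep s u" for s u
    by (intro tendsto_Re L(1) that)
  interpret h1: psd_space H h1
  proof unfold_locales
    fix u assume "u \<in> H"
    from r[OF this] have ru: "rep (r u) u" .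
    show "0 \<le> Re (h1 u u)" 
      by (rule LIMSEQ_le_const[OF Lre[OF ru]]) (use q.nonneg repV(1)[OF ru] in blast)
  qed
  have approx: "(\<lambda>n. fnorm h1 (u - A (s n))) \<longlonglongrightarrow> 0" if s: "rep s u" for s u
    unfolding LIMSEQ_iff
  proof (intro allI impI)
    fix e :: real assume e: "e > 0"
    then obtain N where N: "\<And>m n. m \<ge> N \<Longrightarrow> n \<ge> N \<Longrightarrow> fnorm q (s m - s n) < e / 2" 
      using s unfolding rep_def fcauchy_def by (metis half_gt_zero)
    have "fnorm h1 (u - A (s n)) \<le> e / 2" if n: "n \<ge> N" for n
    proof -
      have rp: "rep (\<lambda>k. s k - s n) (u - A (s n))" by (intro rep_diff s rep_const repV[OF s])
      have "Re (h1 (u - A (s n)) (u - A (s n))) \<le> (e / 2)\<^sup>2"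
      proof (rule LIMSEQ_le_const2[OF Lre[OF rp]])
        have "Re (q (s k - s n) (s k - s n)) \<le> (e / 2)\<^sup>2" if k: "k \<ge> N" for k
        proof -
          have "s k - s n \<in> V" using repV(1)[OF s] by simp
          then have "Re (q (s k - s n) (s k - s n)) = (fnorm q (s k - s n))\<^sup>2" "0 \<le> fnorm q (s k - s n)"
            by (simp_all only: q.sq_fnorm q.fnorm_nonneg)
          then show ?thesis using N[OF k n] by (simp add: power_mono)
        qed
        then show "\<exists>N. \<forall>k\<ge>N. Re (q (s k - s n) (s k - s n)) \<le> (e / 2)\<^sup>2" by blast
      qed
      then show ?thesis using e unfolding fnorm_def by (intro real_le_lsqrt) auto
    qed
    then show "\<exists>no. \<forall>n\<ge>no. norm (fnorm h1 (u - A (s n)) - 0) < e"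
      using e HI[OF s] AH repV(1)[OF s] h1.diff_mem h1.fnorm_nonneg by (intro exI[of _ N]) force
  qed
  have "hilb H h1"
  proof (rule hilbI[OF h1.psd_space_axioms])
    fix u assume u: "u \<in> H" "Re (h1 u u) = 0"
    have ru: "rep (r u) u" using r u by blast
    \<comment> \<open>In the limit, \<open>bd\<close> bounds the norm of V by that of H, so a vector
      of zero H-norm vanishes.\<close>
    have "Re (ip u u) \<le> C\<^sup>2 * Re (h1 u u)"
    proof (rule LIMSEQ_le)
      have "(\<lambda>n. ip (A (r u n)) (A (r u n))) \<longlonglongrightarrow> ip u u"
        by (rule fconv_ip) (use ru repV[OF ru] A_mem in \<open>auto simp: rep_def\<close>)
      then show "(\<lambda>n. Re (ip (A (r u n)) (A (r u n)))) \<longlonglongrightarrow> Re (ip u u)" by (rule tendsto_Re)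
      show "(\<lambda>n. C\<^sup>2 * Re (q (r u n) (r u n))) \<longlonglongrightarrow> C\<^sup>2 * Re (h1 u u)" by (intro tendsto_intros Lre ru)
      have "Re (ip (A (r u n)) (A (r u n))) \<le> C\<^sup>2 * Re (q (r u n) (r u n))" for n
        using bd[OF repV(1)[OF ru], of n] power_mono[OF bd[OF repV(1)[OF ru], of n], of 2] repV(1)[OF ru, of n] A_mem
        by (simp add: sq_fnorm q.sq_fnorm power_mult_distrib)
      then show "\<exists>N. \<forall>n\<ge>N. Re (ip (A (r u n)) (A (r u n))) \<le> C\<^sup>2 * Re (q (r u n) (r u n))" by blast
    qed
    then have "Re (ip u u) = 0" using nonneg[of u] u HV by auto
    then show "u = 0" using definite[of u] u HV by auto
  next
    fix U assume U: "\<And>k. U k \<in> H" "fcauchy h1 U"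
    \<comment> \<open>Each \<open>U k\<close> is replaced by a vector \<open>A (m k)\<close> within
      \<open>1/(k+1)\<close>. As A is isometric from q to \<open>h1\<close>, the sequence m is
      q-Cauchy and represents the limit of U.\<close>
    have "\<exists>m\<in>V. fnorm h1 (U k - A m) < inverse (real (Suc k))" for k
    proof -
      have ru: "rep (r (U k)) (U k)" using r U by blast
      have "\<forall>\<^sub>F n in sequentially. fnorm h1 (U k - A (r (U k) n)) < inverse (real (Suc k))"
        using approx[OF ru] by (rule order_tendstoD) simp
      then obtain n where "fnorm h1 (U k - A (r (U k) n)) < inverse (real (Suc k))"
        by (auto simp: eventually_sequentially)
      then show ?thesis using repV(1)[OF ru] by blast
    qed
    then obtain m where m: "\<And>k. m k \<in> V" "\<And>k. fnorm h1 (U k - A (m k)) < inverse (real (Suc k))" by metis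
    have UAm: "fconv h1 (\<lambda>k. U k - A (m k)) 0"
      unfolding fconv_def
    proof (rule real_tendsto_sandwich[OF _ _ tendsto_const LIMSEQ_inverse_real_of_nat])
      show "\<forall>\<^sub>F n in sequentially. fnorm h1 (U n - A (m n) - 0) \<le> inverse (real (Suc n))"
        using m(2) by (auto intro!: always_eventually less_imp_le)
    qed (use U AH m(1) h1.diff_mem in auto)
    have "fcauchy h1 (\<lambda>k. cscale (-1) (U k - A (m k)) + U k)"
      by (rule h1.fcauchy_comb) (use U AH m(1) h1.diff_mem h1.fconv_cauchy[OF _ UAm] in auto)
    then have cA: "fcauchy h1 (\<lambda>k. A (m k))" by simp
    have fA: "fnorm h1 (A x) = fnorm q x" if "x \<in> V" for x
      unfolding fnorm_def using h1A[OF AH[OF that] that] by (simp add: q_def)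
    have cm: "fcauchy q m" using cA m(1) fA by (simp add: fcauchy_def A_diff[symmetric])
    have "fcauchy ip (\<lambda>k. A (m k))"
      unfolding fcauchy_def
    proof (intro allI impI)
      fix e :: real assume e: "e > 0"
      have "e / (C + 1) > 0" using e C by simp
      then obtain N where N: "\<And>i j. i \<ge> N \<Longrightarrow> j \<ge> N \<Longrightarrow> fnorm q (m i - m j) < e / (C + 1)"
        using cm unfolding fcauchy_def by metis
      have "fnorm ip (A (m i) - A (m j)) < e" if "i \<ge> N" "j \<ge> N" for i j
      proof -
        have "fnorm ip (A (m i) - A (m j)) \<le> C * fnorm q (m i - m j)"
          using bd[of "m i - m j"] m(1) by (simp add: A_diff)
        also have "\<dots> \<le> (C + 1) * fnorm q (m i - m j)" using m(1) by (intro mult_right_mono) auto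
        also have "\<dots> < (C + 1) * (e / (C + 1))" using N[OF that] C by (intro mult_strict_left_mono) auto
        also have "\<dots> = e" using C by simp
        finally show ?thesis .
      qed
      then show "\<exists>N. \<forall>i\<ge>N. \<forall>j\<ge>N. fnorm ip (A (m i) - A (m j)) < e" by blast
    qed
    then obtain u where u: "u \<in> V" "fconv ip (\<lambda>k. A (m k)) u" using complete[of "\<lambda>k. A (m k)"] A_mem m(1) by blast
    have ru: "rep m u" unfolding rep_def using m(1) cm u by blast
    have uH: "u \<in> H" by (rule HI[OF ru])
    have AmH: "A (m k) \<in> H" for k using AH m(1) by blast
    have "fconv h1 U u"
      unfolding fconv_def
    proof (rule real_tendsto_sandwich[OF _ _ tendsto_const])
      show "(\<lambda>k. fnorm h1 (U k - A (m k)) + fnorm h1 (u - A (m k))) \<longlonglongrightarrow> 0"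
        using tendsto_add[OF UAm[unfolded fconv_def] approx[OF ru]] by simp
      have "fnorm h1 (U k - u) \<le> fnorm h1 (U k - A (m k)) + fnorm h1 (u - A (m k))" for k
        using h1.fnorm_triangle3[OF U(1) AmH uH, of k k] h1.fnorm_commute[OF AmH uH, of k] by simp
      then show "\<forall>\<^sub>F k in sequentially. fnorm h1 (U k - u) \<le> fnorm h1 (U k - A (m k)) + fnorm h1 (u - A (m k))" by simp
    qed (use U uH in auto)
    then show "\<exists>y\<in>H. fconv h1 U y" using uH by blast
  qed
  then show ?thesis using HV AH h1A by blast
qed

section \<open>Resolvents of finite-rank perturbations of contractions\<close>

text \<open>Numerator and denominator of a meromorphic resolvent: where \<open>d l\<close> is
  nonzero, \<open>X l y\<close> divided by \<open>d l\<close> solves \<open>x - l A x = y\<close>.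
  Kept apart, both are holomorphic on the whole disc, and \<open>d 0 = 1\<close> excludes that d
  vanishes identically.\<close>

definition meromorphic_resolvent_pair ::
  "'a::cvec set \<Rightarrow> ('a \<Rightarrow> 'a \<Rightarrow> complex) \<Rightarrow> ('a \<Rightarrow> 'a) \<Rightarrow> (complex \<Rightarrow> complex) \<Rightarrow> (complex \<Rightarrow> 'a \<Rightarrow> 'a) \<Rightarrow> bool" where
  "meromorphic_resolvent_pair V ip A d X \<longleftrightarrow> d holomorphic_on ball 0 1 \<and> d 0 = 1 \<and>
     (\<forall>l\<in>ball 0 1. \<forall>y\<in>V. X l y \<in> V \<and> X l y - cscale l (A (X l y)) = cscale (d l) y) \<and>
     (\<forall>y\<in>V. \<forall>v\<in>V. (\<lambda>l. ip (X l y) v) holomorphic_on ball 0 1)"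

context hilb begin

text \<open>For a contraction the Neumann series converges throughout the open unit disc, so the
  denominator can be constant.\<close>

lemma neumann_resolvent:
  assumes A_mem: "\<And>x. x \<in> V \<Longrightarrow> A x \<in> V"
    and A_lin: "\<And>x y a. x \<in> V \<Longrightarrow> y \<in> V \<Longrightarrow> A (cscale a x + y) = cscale a (A x) + A y"
    and A_bound: "\<And>x. x \<in> V \<Longrightarrow> fnorm ip (A x) \<le> fnorm ip x"
  shows "\<exists>X. meromorphic_resolvent_pair V ip A (\<lambda>_. 1) X"
proof -
  have A0: "A 0 = 0" using A_lin[of 0 0 1] by (simp add: cscale_one)
  have A_add: "A (x + y) = A x + A y" if "x \<in> V" "y \<in> V" for x y using A_lin[OF that, of 1] by (simp add: cscale_one)
  have A_sc: "A (cscale a x) = cscale a (A x)" if "x \<in> V" for a x using A_lin[OF that zero_mem, of a] A0 by simp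
  have A_diff: "A (x - y) = A x - A y" if "x \<in> V" "y \<in> V" for x y
    using A_lin[OF that(2,1), of "-1"] that by simp
  have pw: "(A ^^ n) y \<in> V" "fnorm ip ((A ^^ n) y) \<le> fnorm ip y" if y: "y \<in> V" for n y
  proof -
    have *: "(A ^^ n) y \<in> V \<and> fnorm ip ((A ^^ n) y) \<le> fnorm ip y"
    proof (induction n)
      case (Suc n)
      then show ?case using A_mem[of "(A ^^ n) y"] A_bound[of "(A ^^ n) y"] by auto
    qed (use y in auto)
    then show "(A ^^ n) y \<in> V" "fnorm ip ((A ^^ n) y) \<le> fnorm ip y" by auto
  qed
  define S where "S l y N = (\<Sum>n<N. cscale (l ^ n) ((A ^^ n) y))" for l y and N :: nat
  have SV: "S l y N \<in> V" if "y \<in> V" for l y N unfolding S_def using pw that by simp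
  have ex: "\<exists>x\<in>V. fconv ip (S l y) x" if l: "l \<in> ball 0 1" and y: "y \<in> V" for l y
  proof (rule complete[OF SV[OF y]])
    define t where "t N = (\<Sum>n<N. cmod l ^ n * fnorm ip y)" for N :: nat
    have cl: "cmod l < 1" using l by simp
    have "summable (\<lambda>n. cmod l ^ n * fnorm ip y)" using cl by (intro summable_mult2 summable_geometric) auto
    then have "convergent t" unfolding t_def summable_iff_convergent .
    then have "Cauchy t" by (rule convergent_Cauchy)
    have le: "fnorm ip (S l y m - S l y n) \<le> t m - t n" if nm: "n \<le> m" for m n
    proof -
      have "S l y m - S l y n = (\<Sum>k\<in>{n..<m}. cscale (l ^ k) ((A ^^ k) y))"
        unfolding S_def lessThan_atLeast0 using sum_diff_nat_ivl[of 0 n m "\<lambda>k. cscale (l ^ k) ((A ^^ k) y)"] nm by simp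
      then have "fnorm ip (S l y m - S l y n) \<le> (\<Sum>k\<in>{n..<m}. fnorm ip (cscale (l ^ k) ((A ^^ k) y)))"
        using fnorm_sum[of "{n..<m}" "\<lambda>k. cscale (l ^ k) ((A ^^ k) y)"] pw y by simp
      also have "\<dots> \<le> (\<Sum>k\<in>{n..<m}. cmod l ^ k * fnorm ip y)"
        using pw y by (intro sum_mono) (auto simp: fnorm_scale norm_power intro!: mult_left_mono)
      also have "\<dots> = t m - t n"
        unfolding t_def lessThan_atLeast0 using sum_diff_nat_ivl[of 0 n m "\<lambda>k. cmod l ^ k * fnorm ip y"] nm by simp
      finally show ?thesis .
    qed
    show "fcauchy ip (S l y)"
      unfolding fcauchy_def
    proof (intro allI impI)
      fix e :: real assume "e > 0"
      then obtain N where N: "\<And>m n. m \<ge> N \<Longrightarrow> n \<ge> N \<Longrightarrow> dist (t m) (t n) < e"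
        using \<open>Cauchy t\<close> unfolding Cauchy_def by metis
      have "fnorm ip (S l y m - S l y n) < e" if "m \<ge> N" "n \<ge> N" for m n
      proof (cases "n \<le> m")
        case True
        then show ?thesis using le[OF True] N[OF that] by (simp add: dist_real_def)
      next
        case False
        then have "m \<le> n" by simp
        then show ?thesis using le[of m n] N[OF that] fnorm_commute[OF SV[OF y, of l m] SV[OF y, of l n]] by (simp add: dist_real_def)
      qed
      then show "\<exists>N. \<forall>m\<ge>N. \<forall>n\<ge>N. fnorm ip (S l y m - S l y n) < e" by blast
    qed
  qed
  define X where "X l y = (SOME x. x \<in> V \<and> fconv ip (S l y) x)" for l y
  have X: "X l y \<in> V" "fconv ip (S l y) (X l y)" if "l \<in> ball 0 1" "y \<in> V" for l y
    using someI_ex[of "\<lambda>x. x \<in> V \<and> fconv ip (S l y) x"] ex[OF that] unfolding X_def by blast+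
  have res: "X l y - cscale l (A (X l y)) = cscale 1 y" if l: "l \<in> ball 0 1" and y: "y \<in> V" for l y
  proof -
    \<comment> \<open>The partial sums solve the equation up to a remainder of size at most
      \<open>|l|^N\<close> times the norm of y.\<close>
    have tele: "S l y N - cscale l (A (S l y N)) = y - cscale (l ^ N) ((A ^^ N) y)" for N
    proof (induction N)
      case 0 then show ?case by (simp add: S_def A0 cscale_one)
    next
      case (Suc N)
      have "S l y (Suc N) = S l y N + cscale (l ^ N) ((A ^^ N) y)" by (simp add: S_def)
      then have "S l y (Suc N) - cscale l (A (S l y (Suc N))) = (S l y N - cscale l (A (S l y N))) + cscale (l ^ N) ((A ^^ N) y) - cscale (l * l ^ N) (A ((A ^^ N) y))"
        using A_add[OF SV[OF y] scale_mem[OF pw(1)[OF y]]] A_sc[OF pw(1)[OF y]] by (simp add: cscale_add_right cscale_mult algebra_simps)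
      then show ?case using Suc by simp
    qed
    have c1: "fconv ip (\<lambda>N. A (S l y N)) (A (X l y))"
      unfolding fconv_def
    proof (rule real_tendsto_sandwich[OF _ _ tendsto_const X(2)[OF l y, unfolded fconv_def]])
      show "\<forall>\<^sub>F n in sequentially. fnorm ip (A (S l y n) - A (X l y)) \<le> fnorm ip (S l y n - X l y)"
        using A_bound[of "S l y _ - X l y"] SV[OF y] X(1)[OF l y] by (simp add: A_diff)
    qed (use A_mem SV[OF y] X(1)[OF l y] in auto)
    have c2: "fconv ip (\<lambda>N. cscale (-l) (A (S l y N)) + S l y N) (cscale (-l) (A (X l y)) + X l y)"
      by (intro fconv_add fconv_scale c1 X(2)[OF l y]) (use A_mem SV[OF y] X(1)[OF l y] in auto)
    have c3: "fconv ip (\<lambda>N. y - cscale (l ^ N) ((A ^^ N) y)) y"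
      unfolding fconv_def
    proof (rule real_tendsto_sandwich[OF _ _ tendsto_const])
      have "(\<lambda>N. cmod l ^ N * fnorm ip y) \<longlonglongrightarrow> 0 * fnorm ip y"
        using l by (intro tendsto_intros LIMSEQ_power_zero) auto
      then show "(\<lambda>N. cmod l ^ N * fnorm ip y) \<longlonglongrightarrow> 0" by simp
      have "fnorm ip (y - cscale (l ^ n) ((A ^^ n) y) - y) \<le> cmod l ^ n * fnorm ip y" for n
        using pw[OF y, of n] by (simp add: fnorm_scale norm_power mult_left_mono)
      then show "\<forall>\<^sub>F n in sequentially. fnorm ip (y - cscale (l ^ n) ((A ^^ n) y) - y) \<le> cmod l ^ n * fnorm ip y" by simp
    qed (use pw y in auto)
    have "cscale (-l) (A (X l y)) + X l y = y"
    proof (rule fconv_unique[OF _ c2])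
      show "fconv ip (\<lambda>N. cscale (-l) (A (S l y N)) + S l y N) y" using c3 tele by simp
    qed (use A_mem SV[OF y] X(1)[OF l y] y in auto)
    then show ?thesis by (simp add: cscale_one)
  qed
  have hol: "(\<lambda>l. ip (X l y) v) holomorphic_on ball 0 1" if y: "y \<in> V" and v: "v \<in> V" for y v
  proof (rule power_series_holomorphic)
    fix l :: complex assume l: "l \<in> ball 0 1"
    have "(\<lambda>N. ip (S l y N) v) \<longlonglongrightarrow> ip (X l y) v"
      by (rule fconv_ip) (use SV[OF y] X[OF l y] v fconv_const in auto)
    moreover have "ip (S l y N) v = (\<Sum>n<N. ip ((A ^^ n) y) v * (l - 0) ^ n)" for N
      unfolding S_def using pw y v by (simp add: mult.commute)
    ultimately show "(\<lambda>n. ip ((A ^^ n) y) v * (l - 0) ^ n) sums ip (X l y) v" by (simp add: sums_def)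
  qed
  show ?thesis
    unfolding meromorphic_resolvent_pair_def using X(1) res hol by (intro exI[of _ X]) auto
qed

text \<open>The Sherman-Morrison formula, multiplied by its denominator.\<close>
lemma rank_one_resolvent:
  assumes A_mem: "\<And>x. x \<in> V \<Longrightarrow> A x \<in> V"
    and A_lin: "\<And>x y a. x \<in> V \<Longrightarrow> y \<in> V \<Longrightarrow> A (cscale a x + y) = cscale a (A x) + A y"
    and u: "u \<in> V" and w: "w \<in> V" and res: "meromorphic_resolvent_pair V ip A d X"
  shows "\<exists>d X. meromorphic_resolvent_pair V ip (\<lambda>x. A x + cscale (ip x u) w) d X"
proof -
  have A0: "A 0 = 0" using A_lin[of 0 0 1] by (simp add: cscale_one)
  have A_sc: "A (cscale a x) = cscale a (A x)" if "x \<in> V" for a x using A_lin[OF that zero_mem, of a] A0 by simp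
  have d: "d holomorphic_on ball 0 1" "d 0 = 1" and XV: "\<And>l y. l \<in> ball 0 1 \<Longrightarrow> y \<in> V \<Longrightarrow> X l y \<in> V"
    and X: "\<And>l y. l \<in> ball 0 1 \<Longrightarrow> y \<in> V \<Longrightarrow> X l y - cscale l (A (X l y)) = cscale (d l) y"
    and hol: "\<And>y v. y \<in> V \<Longrightarrow> v \<in> V \<Longrightarrow> (\<lambda>l. ip (X l y) v) holomorphic_on ball 0 1"
    using res unfolding meromorphic_resolvent_pair_def by blast+
  \<comment> \<open>\<open>al / d\<close> is the denominator
    \<open>1 - l [(I - l A)^-1 w, u]\<close> of the formula; multiplying by one more factor d clears
    the denominators of both resolvent terms.\<close>
  define al where "al l = d l - l * ip (X l w) u" for l
  define X1 where "X1 l y = cscale (al l) (X l y) + cscale (l * ip (X l y) u) (X l w)" for l y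
  have "meromorphic_resolvent_pair V ip (\<lambda>x. A x + cscale (ip x u) w) (\<lambda>l. al l * d l) X1"
    unfolding meromorphic_resolvent_pair_def
  proof (intro conjI ballI)
    show "(\<lambda>l. al l * d l) holomorphic_on ball 0 1" unfolding al_def by (intro holomorphic_intros d hol u w)
    show "al 0 * d 0 = 1" by (simp add: al_def d)
    fix l :: complex and y assume l: "l \<in> ball 0 1" and y: "y \<in> V"
    note XV' = XV[OF l y] XV[OF l w]
    show "X1 l y \<in> V" unfolding X1_def using XV' by simp
    define be where "be = l * ip (X l y) u"
    have "A (X1 l y) = cscale (al l) (A (X l y)) + cscale be (A (X l w))"
      unfolding X1_def be_def[symmetric] using XV' A_lin[of "X l y" "cscale be (X l w)" "al l"] A_sc[of "X l w" be] by simp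
    then have "X1 l y - cscale l (A (X1 l y) + cscale (ip (X1 l y) u) w)
      = cscale (al l) (X l y - cscale l (A (X l y))) + cscale be (X l w - cscale l (A (X l w))) - cscale (l * ip (X1 l y) u) w"
      unfolding X1_def be_def[symmetric]
      by (simp add: cv.scale_right_diff_distrib cscale_add_right cscale_mult mult_ac)
    also have "\<dots> = cscale (al l * d l) y + cscale (be * d l - l * ip (X1 l y) u) w"
      by (simp add: X[OF l y] X[OF l w] cscale_mult cv.scale_left_diff_distrib)
    \<comment> \<open>\<open>al\<close> is chosen precisely so that this coefficient of w
      cancels.\<close>
    also have "be * d l - l * ip (X1 l y) u = 0"
      unfolding X1_def be_def[symmetric] using XV' u by (simp add: be_def al_def algebra_simps)
    finally show "X1 l y - cscale l (A (X1 l y) + cscale (ip (X1 l y) u) w) = cscale (al l * d l) y" by simp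
  next
    fix y v assume y: "y \<in> V" and v: "v \<in> V"
    have "(\<lambda>l. al l * ip (X l y) v + (l * ip (X l y) u) * ip (X l w) v) holomorphic_on ball 0 1"
      unfolding al_def by (intro holomorphic_intros d hol u w y v)
    moreover have "al l * ip (X l y) v + (l * ip (X l y) u) * ip (X l w) v = ip (X1 l y) v" if l: "l \<in> ball 0 1" for l
      unfolding X1_def using XV[OF l y] XV[OF l w] v by simp
    ultimately show "(\<lambda>l. ip (X1 l y) v) holomorphic_on ball 0 1" by (rule holomorphic_transform)
  qed
  then show ?thesis by blast
qed

text \<open>Induction on the number of functionals measuring the failure of contractivity. With Q
  the projection off the line of \<open>g K\<close>, the operator \<open>A Q\<close> satisfies the
  bound with one functional fewer, and A differs from it by the rank-one operator
  \<open>x \<mapsto> cscale (ip x u) (A u)\<close>, which \<open>rank_one_resolvent\<close>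
  handles.\<close>

theorem finite_rank_perturbation_resolvent:
  assumes A_mem: "\<And>x. x \<in> V \<Longrightarrow> A x \<in> V"
    and A_lin: "\<And>x y a. x \<in> V \<Longrightarrow> y \<in> V \<Longrightarrow> A (cscale a x + y) = cscale a (A x) + A y"
    and g: "\<And>k. k < K \<Longrightarrow> g k \<in> V"
    and A_bound: "\<And>x. x \<in> V \<Longrightarrow> (fnorm ip (A x))\<^sup>2 \<le> (fnorm ip x)\<^sup>2 + (\<Sum>k<(K::nat). (cmod (ip x (g k)))\<^sup>2)"
  shows "\<exists>d X. meromorphic_resolvent_pair V ip A d X"
  using assms
proof (induction K arbitrary: A g)
  case 0
  have "fnorm ip (A x) \<le> fnorm ip x" if "x \<in> V" for x
  proof (rule power2_le_imp_le)
    show "(fnorm ip (A x))\<^sup>2 \<le> (fnorm ip x)\<^sup>2"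
      using 0(4)[OF that] by (simp only: lessThan_0 sum.empty add_0_right)
  qed (rule fnorm_nonneg[OF that])
  from neumann_resolvent[OF 0(1,2) this] show ?case by blast
next
  case (Suc K)
  note A_mem = Suc.prems(1) and A_lin = Suc.prems(2) and g = Suc.prems(3) and A_bound = Suc.prems(4)
  have gK: "g K \<in> V" using g by simp
  show ?case
  proof (cases "g K = 0")
    case True
    then show ?thesis using Suc.IH[of A g] A_mem A_lin g A_bound by simp
  next
    case False
    define c where "c = fnorm ip (g K)"
    have c: "c > 0" "c * c = Re (ip (g K) (g K))"
      using definite_fnorm[OF gK] fnorm_nonneg[OF gK] False sq_fnorm[OF gK] unfolding c_def by (force, simp add: power2_eq_square)
    define u where "u = cscale (of_real (1 / c)) (g K)"
    have u: "u \<in> V" using gK by (simp add: u_def)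
    have gu: "g K = cscale (of_real c) u" using c by (simp add: u_def cscale_mult cscale_one)
    have "(1 / c) * (1 / c) * Re (ip (g K) (g K)) = 1" by (subst c(2)[symmetric]) (use c(1) in simp)
    then have uu: "ip u u = 1" unfolding u_def scale_real_self[OF gK] by (simp only: of_real_1)
    define Q where "Q x = x - cscale (ip x u) u" for x
    have QV: "Q x \<in> V" if "x \<in> V" for x using that u by (simp add: Q_def)
    have Qlin: "Q (cscale a x + y) = cscale a (Q x) + Q y" if "x \<in> V" "y \<in> V" for a x y
      using that u by (simp add: Q_def cscale_add_left cv.scale_right_diff_distrib cscale_mult algebra_simps)
    have Qu: "ip (Q x) u = 0" if "x \<in> V" for x using that u uu by (simp add: Q_def)
    have Qsa: "ip (Q x) y = ip x (Q y)" if "x \<in> V" "y \<in> V" for x y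
    proof -
      have "cnj (ip y u) = ip u y" using sym[OF u that(2)] by simp
      then show ?thesis using that u by (simp add: Q_def)
    qed
    have QQ: "fnorm ip (Q x) \<le> fnorm ip x" if x: "x \<in> V" for x
    proof -
      have "ip (Q x) (Q x) = ip (Q x) x - cnj (ip x u) * ip (Q x) u" by (subst (2) Q_def) (use x u QV in simp)
      also have "\<dots> = ip x x - ip x u * ip u x" using x u Qu by (simp add: Q_def)
      also have "ip x u * ip u x = of_real ((cmod (ip x u))\<^sup>2)" by (rule mult_sym[OF x u])
      finally have "Re (ip (Q x) (Q x)) \<le> Re (ip x x)" by (simp del: of_real_power)
      then show ?thesis by (simp add: fnorm_def)
    qed
    define A' where "A' x = A (Q x)" for x
    \<comment> \<open>The remaining functionals are evaluated at \<open>Q x\<close>; since Q is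
      self-adjoint, this replaces \<open>g k\<close> by \<open>Q (g k)\<close>.\<close>
    define g' where "g' k = Q (g k)" for k
    have "(fnorm ip (A' x))\<^sup>2 \<le> (fnorm ip x)\<^sup>2 + (\<Sum>k<K. (cmod (ip x (g' k)))\<^sup>2)" if x: "x \<in> V" for x
    proof -
      have "(fnorm ip (A' x))\<^sup>2 \<le> (fnorm ip (Q x))\<^sup>2 + (\<Sum>k<Suc K. (cmod (ip (Q x) (g k)))\<^sup>2)"
        unfolding A'_def by (rule A_bound[OF QV[OF x]])
      also have "(\<Sum>k<Suc K. (cmod (ip (Q x) (g k)))\<^sup>2) = (\<Sum>k<K. (cmod (ip (Q x) (g k)))\<^sup>2)"
        using Qu[OF x] QV[OF x] u by (simp add: gu)
      also have "\<dots> = (\<Sum>k<K. (cmod (ip x (g' k)))\<^sup>2)"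
        using x g by (intro sum.cong refl) (simp add: Qsa g'_def)
      also have "(fnorm ip (Q x))\<^sup>2 \<le> (fnorm ip x)\<^sup>2" using QQ[OF x] QV[OF x] by (intro power_mono) auto
      finally show ?thesis by simp
    qed
    then have "\<exists>d X. meromorphic_resolvent_pair V ip A' d X"
      by (intro Suc.IH[of A' g']) (use A_mem A_lin QV Qlin g in \<open>auto simp: A'_def g'_def\<close>)
    then obtain d X where "meromorphic_resolvent_pair V ip A' d X" by blast
    from rank_one_resolvent[OF _ _ u A_mem[OF u] this]
    obtain d X where r: "meromorphic_resolvent_pair V ip (\<lambda>x. A' x + cscale (ip x u) (A u)) d X"
      using A_mem A_lin QV Qlin by (auto simp: A'_def)
    have "A' x + cscale (ip x u) (A u) = A x" if x: "x \<in> V" for x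
    proof -
      have "A (cscale (ip x u) u + Q x) = cscale (ip x u) (A u) + A (Q x)" by (rule A_lin[OF u QV[OF x]])
      then show ?thesis by (simp add: A'_def Q_def add.commute)
    qed
    then have "meromorphic_resolvent_pair V ip A d X"
      using r unfolding meromorphic_resolvent_pair_def by (metis (no_types, lifting))
    then show ?thesis by blast
  qed
qed

end

section \<open>Concatenated negative families and orthogonal sums\<close>

lemma sum_append:
  "(\<Sum>i<m + (n::nat). if i < m then f i else g (i - m)) = (\<Sum>i<m. f i) + (\<Sum>i<n. g i :: 'b::comm_monoid_add)"
  by (induction n) (auto simp: add.assoc)

lemma negfam_append:
  assumes f: "negfam V ip m f" and g: "negfam V ip n g"
    and orth: "\<And>i j. i < m \<Longrightarrow> j < n \<Longrightarrow> ip (f i) (g j) = 0" "\<And>i j. i < m \<Longrightarrow> j < n \<Longrightarrow> ip (g j) (f i) = 0"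
  shows "negfam V ip (m + n) (\<lambda>i. if i < m then f i else g (i - m))"
  using assms unfolding negfam_def by auto

lemma hform_append:
  "hform ip (m + n) (\<lambda>i. if i < m then f i else g (i - m)) x y
     = ip x y + 2 * (\<Sum>i<m. ip x (f i) * ip (f i) y) + 2 * (\<Sum>i<n. ip x (g i) * ip (g i) y)"
proof -
  have "(\<Sum>i<m + n. ip x (if i < m then f i else g (i - m)) * ip (if i < m then f i else g (i - m)) y)
      = (\<Sum>i<m + n. if i < m then ip x (f i) * ip (f i) y else ip x (g (i - m)) * ip (g (i - m)) y)"
    by (intro sum.cong) auto
  also have "\<dots> = (\<Sum>i<m. ip x (f i) * ip (f i) y) + (\<Sum>i<n. ip x (g i) * ip (g i) y)" by (rule sum_append)
  finally show ?thesis unfolding hform_def by (simp add: distrib_left)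
qed

definition sum_form :: "('a \<Rightarrow> 'a \<Rightarrow> complex) \<Rightarrow> ('b \<Rightarrow> 'b \<Rightarrow> complex) \<Rightarrow> 'a \<times> 'b \<Rightarrow> 'a \<times> 'b \<Rightarrow> complex" where
  "sum_form ip1 ip2 x y = ip1 (fst x) (fst y) + ip2 (snd x) (snd y)"

lemma fst_cscale[simp]: "fst (cscale a x) = cscale a (fst x)" and snd_cscale[simp]: "snd (cscale a x) = cscale a (snd x)"
  by (simp_all add: cscale_prod_def)

lemma herm_space_sum:
  assumes "herm_space V1 ip1" "herm_space V2 ip2" shows "herm_space (V1 \<times> V2) (sum_form ip1 ip2)"
proof -
  interpret A: herm_space V1 ip1 by fact
  interpret B: herm_space V2 ip2 by fact
  show ?thesis
  proof (rule herm_spaceI)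
    show "csubspace (V1 \<times> V2)" by (auto simp: csubspace_def mem_Times_iff)
    show "sum_form ip1 ip2 x y = cnj (sum_form ip1 ip2 y x)" if "x \<in> V1 \<times> V2" "y \<in> V1 \<times> V2" for x y
    proof -
      have "ip1 (fst x) (fst y) = cnj (ip1 (fst y) (fst x))" "ip2 (snd x) (snd y) = cnj (ip2 (snd y) (snd x))"
        using that by (auto intro: A.sym B.sym)
      then show ?thesis by (simp add: sum_form_def)
    qed
  qed (auto simp: sum_form_def algebra_simps)
qed

lemma hilb_sum:
  assumes "hilb V1 h1" "hilb V2 h2" shows "hilb (V1 \<times> V2) (sum_form h1 h2)"
proof -
  interpret A: hilb V1 h1 by fact
  interpret B: hilb V2 h2 by fact
  interpret S: herm_space "V1 \<times> V2" "sum_form h1 h2"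
    by (rule herm_space_sum) (rule A.herm_space_axioms B.herm_space_axioms)+
  interpret S: psd_space "V1 \<times> V2" "sum_form h1 h2"
    by unfold_locales (auto simp: sum_form_def A.nonneg B.nonneg)
  have n1: "fnorm h1 (fst x) \<le> fnorm (sum_form h1 h2) x" if "x \<in> V1 \<times> V2" for x
    using that B.nonneg[of "snd x"] by (auto simp: fnorm_def sum_form_def)
  have n2: "fnorm h2 (snd x) \<le> fnorm (sum_form h1 h2) x" if "x \<in> V1 \<times> V2" for x
    using that A.nonneg[of "fst x"] by (auto simp: fnorm_def sum_form_def)
  show ?thesis
  proof (rule hilbI[OF S.psd_space_axioms])
    fix x assume x: "x \<in> V1 \<times> V2" "Re (sum_form h1 h2 x x) = 0"
    then have V: "fst x \<in> V1" "snd x \<in> V2" by auto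
    have "Re (h1 (fst x) (fst x)) = 0" "Re (h2 (snd x) (snd x)) = 0"
      using x(2) A.nonneg[OF V(1)] B.nonneg[OF V(2)] by (auto simp: sum_form_def)
    then show "x = 0" using A.definite[OF V(1)] B.definite[OF V(2)] by (simp add: prod_eq_iff)
  next
    fix s assume s: "\<And>n. s n \<in> V1 \<times> V2" "fcauchy (sum_form h1 h2) s"
    have V: "fst (s n) \<in> V1" "snd (s n) \<in> V2" for n using s(1)[of n] by auto
    have "fcauchy h1 (\<lambda>n. fst (s n))" "fcauchy h2 (\<lambda>n. snd (s n))"
      using s(2) n1[OF S.diff_mem, OF s(1) s(1)] n2[OF S.diff_mem, OF s(1) s(1)]
      unfolding fcauchy_def fst_diff snd_diff by (meson le_less_trans)+
    then obtain y1 y2 where y: "y1 \<in> V1" "fconv h1 (\<lambda>n. fst (s n)) y1" "y2 \<in> V2" "fconv h2 (\<lambda>n. snd (s n)) y2"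
      using A.complete[of "\<lambda>n. fst (s n)"] B.complete[of "\<lambda>n. snd (s n)"] V by blast
    have yV: "(y1, y2) \<in> V1 \<times> V2" using y by simp
    have "(\<lambda>n. Re (sum_form h1 h2 (s n - (y1, y2)) (s n - (y1, y2)))) \<longlonglongrightarrow> 0"
    proof -
      have "(\<lambda>n. (fnorm h1 (fst (s n) - y1))\<^sup>2 + (fnorm h2 (snd (s n) - y2))\<^sup>2) \<longlonglongrightarrow> 0\<^sup>2 + 0\<^sup>2"
        using y(2,4) unfolding fconv_def by (intro tendsto_intros)
      then show ?thesis using V y A.sq_fnorm[OF A.diff_mem, OF V(1) y(1)] B.sq_fnorm[OF B.diff_mem, OF V(2) y(3)]
        by (simp add: sum_form_def del: A.diff_left A.diff_right B.diff_left B.diff_right)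
    qed
    then have "fconv (sum_form h1 h2) s (y1, y2)"
      using sq_fconv_iff[OF S.psd_space_axioms, of s "(y1, y2)", OF s(1) yV] by simp
    then show "\<exists>y\<in>V1 \<times> V2. fconv (sum_form h1 h2) s y" using yV by blast
  qed
qed

lemma hform_sum:
  assumes "herm_space V1 ip1" "herm_space V2 ip2"
    and e: "\<And>i. i < n1 \<Longrightarrow> e1 i \<in> V1" "\<And>i. i < n2 \<Longrightarrow> e2 i \<in> V2"
    and xy: "x \<in> V1 \<times> V2" "y \<in> V1 \<times> V2"
  shows "hform (sum_form ip1 ip2) (n1 + n2) (\<lambda>i. if i < n1 then (e1 i, 0) else (0, e2 (i - n1))) x y
    = hform ip1 n1 e1 (fst x) (fst y) + hform ip2 n2 e2 (snd x) (snd y)"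
proof -
  interpret A: herm_space V1 ip1 by fact
  interpret B: herm_space V2 ip2 by fact
  let ?e = "\<lambda>i. if i < n1 then (e1 i, 0) else (0, e2 (i - n1))"
  have V: "fst x \<in> V1" "snd x \<in> V2" "fst y \<in> V1" "snd y \<in> V2" using xy by auto
  have s1: "(\<Sum>i<n1. sum_form ip1 ip2 x (e1 i, 0) * sum_form ip1 ip2 (e1 i, 0) y) = (\<Sum>i<n1. ip1 (fst x) (e1 i) * ip1 (e1 i) (fst y))"
    and s2: "(\<Sum>i<n2. sum_form ip1 ip2 x (0, e2 i) * sum_form ip1 ip2 (0, e2 i) y) = (\<Sum>i<n2. ip2 (snd x) (e2 i) * ip2 (e2 i) (snd y))"
    using V by (simp_all add: sum_form_def)
  have "hform (sum_form ip1 ip2) (n1 + n2) ?e x y = sum_form ip1 ip2 x y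
    + 2 * (\<Sum>i<n1. sum_form ip1 ip2 x (e1 i, 0) * sum_form ip1 ip2 (e1 i, 0) y)
    + 2 * (\<Sum>i<n2. sum_form ip1 ip2 x (0, e2 i) * sum_form ip1 ip2 (0, e2 i) y)"
    by (rule hform_append)
  then show ?thesis unfolding s1 s2 by (simp add: sum_form_def hform_def)
qed

lemma pont_sum:
  assumes "pont V1 ip1 n1 e1" "pont V2 ip2 n2 e2"
  shows "pont (V1 \<times> V2) (sum_form ip1 ip2) (n1 + n2) (\<lambda>i. if i < n1 then (e1 i, 0) else (0, e2 (i - n1)))"
proof -
  interpret A: pont V1 ip1 n1 e1 by fact
  interpret B: pont V2 ip2 n2 e2 by fact
  interpret S: herm_space "V1 \<times> V2" "sum_form ip1 ip2"
    by (rule herm_space_sum) (rule A.herm_space_axioms B.herm_space_axioms)+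
  let ?e = "\<lambda>i. if i < n1 then (e1 i, 0) else (0, e2 (i - n1))"
  have "negfam (V1 \<times> V2) (sum_form ip1 ip2) (n1 + n2) ?e"
    by (rule negfam_append) (use A.neg B.neg in \<open>auto simp: negfam_def sum_form_def\<close>)
  moreover have "hilb (V1 \<times> V2) (hform (sum_form ip1 ip2) (n1 + n2) ?e)"
  proof (rule hilb_cong[OF hilb_sum[OF A.hilb_hform B.hilb_hform]])
    fix x y assume "x \<in> V1 \<times> V2" "y \<in> V1 \<times> V2"
    from hform_sum[OF A.herm_space_axioms B.herm_space_axioms A.e_mem B.e_mem this]
    show "hform (sum_form ip1 ip2) (n1 + n2) ?e x y = sum_form (hform ip1 n1 e1) (hform ip2 n2 e2) x y"
      by (simp only: sum_form_def[of "hform ip1 n1 e1"])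
  qed
  ultimately show ?thesis by unfold_locales (auto simp: hilb_def)
qed

section \<open>Complementary spaces\<close>

lemma (in pont) eqI_right: 
  assumes "x \<in> V" "y \<in> V" "\<And>z. z \<in> V \<Longrightarrow> ip z x = ip z y" shows "x = y"
proof (rule eqI[OF assms(1,2)])
  fix z assume "z \<in> V"
  then show "ip x z = ip y z" using sym[of x z] sym[of y z] assms by simp
qed

lemma cscale_two: "cscale 2 x = x + x"
  using cscale_add_left[of 1 1 x] by (simp add: cscale_one)

text \<open>Adjoints refer to the indefinite forms, norms to the Hilbert forms. As the fundamental
  symmetry preserves the norm, testing the adjoint relation on \<open>J g\<close> with
  \<open>g = Gs m\<close> transfers the bound.\<close>

lemma adjoint_bound:
  assumes "pont P ip \<kappa> e" "pont M ipM \<mu> e'"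
    and G: "\<And>x. x \<in> P \<Longrightarrow> G x \<in> M" and Gs: "\<And>m. m \<in> M \<Longrightarrow> Gs m \<in> P"
    and adj: "\<And>x m. x \<in> P \<Longrightarrow> m \<in> M \<Longrightarrow> ipM (G x) m = ip x (Gs m)"
    and c: "c \<ge> 0" and bnd: "\<And>x. x \<in> P \<Longrightarrow> fnorm (hform ipM \<mu> e') (G x) \<le> c * fnorm (hform ip \<kappa> e) x"
    and m: "m \<in> M"
  shows "fnorm (hform ip \<kappa> e) (Gs m) \<le> c * fnorm (hform ipM \<mu> e') m"
proof -
  interpret P: pont P ip \<kappa> e by fact
  interpret M: pont M ipM \<mu> e' by fact
  define g where "g = Gs m"
  have g: "g \<in> P" using Gs m by (simp add: g_def)
  have "P.h g g = P.h g (P.J (P.J g))" using g by simp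
  also have "\<dots> = ip g (P.J g)" using g by (intro P.h_J) auto
  also have "\<dots> = cnj (ip (P.J g) g)" using g by (intro P.sym) auto
  also have "ip (P.J g) g = ipM (G (P.J g)) m" unfolding g_def using adj[of "P.J (Gs m)" m] Gs m by simp
  finally have "cmod (P.h g g) = cmod (ipM (G (P.J g)) m)" by simp
  also have "\<dots> \<le> fnorm M.h (G (P.J g)) * fnorm M.h m" using G g m by (intro M.ip_bound) auto
  also have "\<dots> \<le> (c * fnorm P.h g) * fnorm M.h m"
    using bnd[of "P.J g"] P.J_norm[OF g] g m by (intro mult_right_mono) auto
  finally have "Re (P.h g g) \<le> (c * fnorm P.h g) * fnorm M.h m"
    using complex_Re_le_cmod order_trans by blast
  then have le: "fnorm P.h g * fnorm P.h g \<le> (c * fnorm M.h m) * fnorm P.h g"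
    using P.H.sq_fnorm[OF g] by (simp add: power2_eq_square mult_ac)
  show ?thesis unfolding g_def[symmetric]
  proof (cases "fnorm P.h g = 0")
    case True
    then show "fnorm P.h g \<le> c * fnorm M.h m" using c m by simp
  next
    case False
    then have "fnorm P.h g > 0" using P.H.fnorm_nonneg[OF g] by linarith
    then show "fnorm P.h g \<le> c * fnorm M.h m" using le by simp
  qed
qed

text \<open>The defect of a contraction into a space whose index is larger by \<nu> has exactly
  \<nu> negative squares. Inertia on the larger space \<open>M \<times> P\<close> finds this number;
  the complete space is then built by flipping the \<nu> negative directions, applying the positive
  case and flipping back.\<close>

theorem complementary_space:
  assumes Pp: "pont P ip \<kappa> e" and Mp: "pont M ipM (\<kappa> + \<nu>) e'"
    and G: "\<And>x. x \<in> P \<Longrightarrow> G x \<in> M" 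
    and Glin: "\<And>x y a. x \<in> P \<Longrightarrow> y \<in> P \<Longrightarrow> G (cscale a x + y) = cscale a (G x) + G y"
    and Gs: "\<And>m. m \<in> M \<Longrightarrow> Gs m \<in> P"
    and adj: "\<And>x m. x \<in> P \<Longrightarrow> m \<in> M \<Longrightarrow> ipM (G x) m = ip x (Gs m)"
    and c: "c \<ge> 0" and bnd: "\<And>x. x \<in> P \<Longrightarrow> fnorm (hform ipM (\<kappa> + \<nu>) e') (G x) \<le> c * fnorm (hform ip \<kappa> e) x"
    and contr: "\<And>x. x \<in> P \<Longrightarrow> Re (ipM (G x) (G x)) \<le> Re (ip x x)"
  shows "\<exists>C1 ip1 b. pont C1 ip1 \<nu> b \<and> C1 \<subseteq> M \<and> (\<forall>m\<in>M. m - G (Gs m) \<in> C1) \<and>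
    (\<forall>u\<in>C1. \<forall>m\<in>M. ip1 u (m - G (Gs m)) = ipM u m)"
proof -
  interpret P: pont P ip \<kappa> e by fact
  interpret M: pont M ipM "\<kappa> + \<nu>" e' by fact
  have Gslin: "Gs (cscale a x + y) = cscale a (Gs x) + Gs y" if "x \<in> M" "y \<in> M" for a x y
    by (rule P.eqI_right) (use that Gs G in \<open>simp_all add: adj[symmetric]\<close>)
  have adj': "ipM m (G x) = ip (Gs m) x" if "x \<in> P" "m \<in> M" for x m
    using adj[OF that] M.sym[of m "G x"] P.sym[of "Gs m" x] that G Gs by simp
  define T where "T m = m - G (Gs m)" for m
  have TM: "T m \<in> M" if "m \<in> M" for m using that G Gs by (simp add: T_def)
  have Tlin: "T (cscale a x + y) = cscale a (T x) + T y" if "x \<in> M" "y \<in> M" for a x y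
    using that Gs by (simp add: T_def Gslin Glin cv.scale_right_diff_distrib)
  have Tbnd: "fnorm M.h (T m) \<le> (1 + c * c) * fnorm M.h m" if m: "m \<in> M" for m
  proof -
    have "fnorm M.h (T m) \<le> fnorm M.h m + fnorm M.h (G (Gs m))"
      unfolding T_def using m G Gs by (intro M.H.fnorm_triangle_diff) auto
    also have "fnorm M.h (G (Gs m)) \<le> c * fnorm P.h (Gs m)" using bnd Gs m by blast
    also have "\<dots> \<le> c * (c * fnorm M.h m)"
      by (intro mult_left_mono adjoint_bound[OF Pp Mp G Gs adj c bnd m] c)
    finally show ?thesis by (simp add: algebra_simps)
  qed
  define t where "t m n = ipM (T m) n" for m n
  have t_alt: "t m n = ipM m n - ip (Gs m) (Gs n)" if "m \<in> M" "n \<in> M" for m n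
    using that G Gs by (simp add: t_def T_def adj)
  interpret t: herm_space M t
  proof (rule herm_spaceI[OF M.sub])
    show "t (cscale a x + y) z = a * t x z + t y z" if "x \<in> M" "y \<in> M" "z \<in> M" for x y z a
      using that TM by (simp add: t_def Tlin)
    show "t x y = cnj (t y x)" if "x \<in> M" "y \<in> M" for x y
      using that Gs M.sym[of x y] P.sym[of "Gs x" "Gs y"] by (simp add: t_alt)
  qed
  \<comment> \<open>The form F on \<open>M \<times> P\<close> is congruent both to \<open>t \<oplus> ip\<close> and to \<open>ipM \<oplus> (ip - G\<^sup>*ipM)\<close>, and the last
    summand is nonnegative; comparing negative indices determines that of t.\<close>
  define X where "X = M \<times> P"
  define F where "F x y = t (fst x) (fst y) + ip (snd x + Gs (fst x)) (snd y + Gs (fst y))" for x y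
  have GsM: "Gs 0 = 0" using Gslin[of 0 0 1] by (simp add: cscale_one)
  have Gsneg: "Gs (- m) = - Gs m" if "m \<in> M" for m using Gslin[OF that M.zero_mem, of "-1"] GsM by simp
  have Gsadd: "Gs (m + n) = Gs m + Gs n" if "m \<in> M" "n \<in> M" for m n using Gslin[OF that, of 1] by (simp add: cscale_one)
  interpret X: herm_space X F
  proof (rule herm_spaceI)
    show "csubspace X" unfolding X_def by (auto simp: csubspace_def mem_Times_iff)
    fix x y assume xy: "x \<in> X" "y \<in> X"
    then have V: "fst x \<in> M" "snd x \<in> P" "fst y \<in> M" "snd y \<in> P" by (auto simp: X_def)
    show "F x y = cnj (F y x)"
      unfolding F_def using t.sym[OF V(1,3)] P.sym[of "snd x + Gs (fst x)" "snd y + Gs (fst y)"] V Gs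
      by (simp del: P.add_left P.add_right)
    fix z a assume z: "z \<in> X"
    then have Z: "fst z \<in> M" "snd z \<in> P" by (auto simp: X_def)
    have e: "cscale a (snd x) + snd y + (cscale a (Gs (fst x)) + Gs (fst y)) = cscale a (snd x + Gs (fst x)) + (snd y + Gs (fst y))"
      by (simp add: cscale_add_right algebra_simps)
    show "F (cscale a x + y) z = a * F x z + F y z"
      unfolding F_def fst_add snd_add fst_cscale snd_cscale Gslin[OF V(1,3)] e
      using V Z Gs P.lin[of "snd x + Gs (fst x)" "snd y + Gs (fst y)" "snd z + Gs (fst z)" a] t.lin[OF V(1,3) Z(1), of a]
      by (simp add: algebra_simps del: P.add_left P.add_right P.scale_left t.add_left t.scale_left)
  qed
  have F_alt: "F x y = ipM (fst x + G (snd x)) (fst y + G (snd y)) + (ip (snd x) (snd y) - ipM (G (snd x)) (G (snd y)))"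
    if "x \<in> X" "y \<in> X" for x y
  proof -
    have V: "fst x \<in> M" "snd x \<in> P" "fst y \<in> M" "snd y \<in> P" using that by (auto simp: X_def)
    show ?thesis using V G Gs by (simp add: F_def t_alt adj adj' Gsadd)
  qed
  \<comment> \<open>In the decomposition with \<open>ipM\<close> the second summand is nonnegative
    by contractivity, so the family of M remains maximal.\<close>
  have max1: "maxneg X F (\<kappa> + \<nu>) (\<lambda>i. (e' i, 0))"
    unfolding maxneg_def
  proof (intro conjI ballI)
    have G0: "G 0 = 0" using Glin[of 0 0 1] by (simp add: cscale_one)
    show ng: "negfam X F (\<kappa> + \<nu>) (\<lambda>i. (e' i, 0))"
      unfolding negfam_def using M.neg M.e_mem by (auto simp: F_alt X_def G0 negfam_def)
    fix x assume x: "x \<in> X"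
    then have V: "fst x \<in> M" "snd x \<in> P" by (auto simp: X_def)
    define m where "m = fst x + G (snd x)"
    have m: "m \<in> M" using V G by (simp add: m_def)
    have Fe: "F x (e' i, 0) = ipM m (e' i)" if "i < \<kappa> + \<nu>" for i
      using x M.e_mem[OF that] V G by (subst F_alt) (auto simp: X_def G0 m_def)
    have "Re (hform F (\<kappa> + \<nu>) (\<lambda>i. (e' i, 0)) x x) = Re (F x x) + 2 * (\<Sum>i<\<kappa> + \<nu>. (cmod (F x (e' i, 0)))\<^sup>2)"
      using ng by (subst X.hform_self) (auto simp: negfam_def x)
    also have "\<dots> = (Re (ipM m m) + 2 * (\<Sum>i<\<kappa> + \<nu>. (cmod (ipM m (e' i)))\<^sup>2)) + (Re (ip (snd x) (snd x)) - Re (ipM (G (snd x)) (G (snd x))))"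
      using F_alt[OF x x] by (simp add: Fe m_def[symmetric])
    also have "\<dots> = (fnorm M.h m)\<^sup>2 + (Re (ip (snd x) (snd x)) - Re (ipM (G (snd x)) (G (snd x))))"
      using M.h_self[OF m] by simp
    finally show "0 \<le> Re (hform F (\<kappa> + \<nu>) (\<lambda>i. (e' i, 0)) x x)" using contr[OF V(2)] by simp
  qed
  \<comment> \<open>The correction \<open>- Gs (f i)\<close> annihilates the second term of F, so a
    family negative for t of length k and the \<kappa> vectors of \<open>e\<close> are orthogonal
    and combine to length \<kappa> + k.\<close>
  define fam where "fam f = (\<lambda>i. if i < \<kappa> then (0, e i) else (f (i - \<kappa>), - Gs (f (i - \<kappa>))))" for f :: "nat \<Rightarrow> 'b"
  have famneg: "negfam X F (\<kappa> + k) (fam f)" if f: "negfam M t k f" for k f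
    unfolding fam_def
    by (rule negfam_append[where g = "\<lambda>i. (f i, - Gs (f i))"])
      (use f P.neg P.e_mem Gs in \<open>auto simp: negfam_def F_def GsM X_def t.zero_left\<close>)
  have "k \<le> \<nu>" if f: "negfam M t k f" for k f
    using X.inertia[OF max1 famneg[OF f]] by simp
  then obtain k f where mf: "maxneg M t k f" using t.maxneg_exists by blast
  then have nf: "negfam M t k f" by (simp add: maxneg_def)
  have fM: "f i \<in> M" if "i < k" for i using nf that by (simp add: negfam_def)
  have "maxneg X F (\<kappa> + k) (fam f)"
    unfolding maxneg_def
  proof (intro conjI ballI famneg[OF nf])
    fix x assume x: "x \<in> X"
    then have V: "fst x \<in> M" "snd x \<in> P" by (auto simp: X_def)
    define y where "y = snd x + Gs (fst x)"
    have y: "y \<in> P" using V Gs by (simp add: y_def)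
    have f1: "F x (0, e i) * F (0, e i) x = of_real ((cmod (ip y (e i)))\<^sup>2)" if i: "i < \<kappa>" for i
    proof -
      have "F x (0, e i) = ip y (e i)" "F (0, e i) x = ip (e i) y" using V by (simp_all add: F_def GsM y_def)
      then show ?thesis using P.mult_sym[OF y P.e_mem[OF i]] by simp
    qed
    have f2: "F x (f i, - Gs (f i)) * F (f i, - Gs (f i)) x = of_real ((cmod (t (fst x) (f i)))\<^sup>2)" if i: "i < k" for i
    proof -
      have "F x (f i, - Gs (f i)) = t (fst x) (f i)" "F (f i, - Gs (f i)) x = t (f i) (fst x)"
        using y V Gs by (simp_all add: F_def y_def[symmetric])
      then show ?thesis using t.mult_sym[OF V(1) fM[OF i]] by simp
    qed
    have "hform F (\<kappa> + k) (fam f) x x = F x x + 2 * (\<Sum>i<\<kappa>. F x (0, e i) * F (0, e i) x)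
       + 2 * (\<Sum>i<k. F x (f i, - Gs (f i)) * F (f i, - Gs (f i)) x)"
      unfolding fam_def by (rule hform_append[where g = "\<lambda>i. (f i, - Gs (f i))"])
    also have "\<dots> = (ip y y + 2 * of_real (\<Sum>i<\<kappa>. (cmod (ip y (e i)))\<^sup>2))
       + (t (fst x) (fst x) + 2 * of_real (\<Sum>i<k. (cmod (t (fst x) (f i)))\<^sup>2))"
    proof -
      have "(\<Sum>i<\<kappa>. F x (0, e i) * F (0, e i) x) = of_real (\<Sum>i<\<kappa>. (cmod (ip y (e i)))\<^sup>2)"
        using f1 by (simp del: of_real_power)
      moreover have "(\<Sum>i<k. F x (f i, - Gs (f i)) * F (f i, - Gs (f i)) x) = of_real (\<Sum>i<k. (cmod (t (fst x) (f i)))\<^sup>2)"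
        using f2 by (simp del: of_real_power)
      moreover have "F x x = t (fst x) (fst x) + ip y y" by (simp only: F_def y_def)
      ultimately show ?thesis by (simp only: add_ac)
    qed
    also have "\<dots> = P.h y y + hform t k f (fst x) (fst x)"
      using y V by (simp add: P.hform_self P.e_mem t.hform_self fM del: of_real_power of_real_sum)
    finally have "Re (hform F (\<kappa> + k) (fam f) x x) = Re (P.h y y) + Re (hform t k f (fst x) (fst x))" by simp
    then show "0 \<le> Re (hform F (\<kappa> + k) (fam f) x x)"
      using P.H.nonneg[OF y] mf V(1) by (auto simp: maxneg_def)
  qed
  from X.inertia_eq[OF max1 this] have k: "k = \<nu>" by simp
  have tf: "t (f i) (f j) = (if i = j then -1 else 0)" if "i < \<nu>" "j < \<nu>" for i j
    using nf that k by (simp add: negfam_def)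
  note fM = fM[unfolded k]
  define b where "b i = T (f i)" for i
  have bM: "b i \<in> M" if "i < \<nu>" for i using TM fM that by (simp add: b_def)
  \<comment> \<open>The kernel operator of the flipped defect form \<open>hform t \<nu> f\<close>,
    which is nonnegative because \<open>f\<close> is maximal.\<close>
  define T' where "T' m = T m + cscale 2 (\<Sum>i<\<nu>. cscale (t m (f i)) (b i))" for m
  have T'M: "T' m \<in> M" if "m \<in> M" for m using TM bM that by (simp add: T'_def)
  have T'lin: "T' (cscale a x + y) = cscale a (T' x) + T' y" if "x \<in> M" "y \<in> M" for a x y
    using that fM by (simp add: T'_def Tlin cscale_add_right cscale_add_left cscale_mult sum.distrib cv.scale_sum_right mult_ac)
  have ipT': "ipM (T' m) n = hform t \<nu> f m n" if "m \<in> M" "n \<in> M" for m n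
    using that TM bM by (simp add: T'_def hform_def t_def b_def)
  interpret tf: herm_space M "hform t \<nu> f" by (rule t.hform_herm) (use fM in auto)
  have tfpos: "0 \<le> Re (hform t \<nu> f m m)" if "m \<in> M" for m using mf that by (simp add: maxneg_def k)
  define B where "B = (1 + c * c) + 2 * (\<Sum>i<\<nu>. (1 + c * c) * fnorm M.h (f i) * fnorm M.h (b i))"
  have T'bnd: "fnorm M.h (T' m) \<le> B * fnorm M.h m" if m: "m \<in> M" for m
  proof -
    have s: "(\<Sum>i<\<nu>. cscale (t m (f i)) (b i)) \<in> M" using bM by simp
    have "fnorm M.h (T' m) \<le> fnorm M.h (T m) + fnorm M.h (cscale 2 (\<Sum>i<\<nu>. cscale (t m (f i)) (b i)))"
      unfolding T'_def using TM m s by (intro M.H.fnorm_triangle) auto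
    also have "fnorm M.h (cscale 2 (\<Sum>i<\<nu>. cscale (t m (f i)) (b i))) = 2 * fnorm M.h (\<Sum>i<\<nu>. cscale (t m (f i)) (b i))"
      using M.H.fnorm_scale[OF s, of 2] by simp
    also have "fnorm M.h (\<Sum>i<\<nu>. cscale (t m (f i)) (b i)) \<le> (\<Sum>i<\<nu>. fnorm M.h (cscale (t m (f i)) (b i)))"
      using bM by (intro M.H.fnorm_sum) auto
    also have "\<dots> \<le> (\<Sum>i<\<nu>. ((1 + c * c) * fnorm M.h (f i) * fnorm M.h (b i)) * fnorm M.h m)"
    proof (rule sum_mono)
      fix i assume "i \<in> {..<\<nu>}"
      then have i: "i < \<nu>" by simp
      have "cmod (t m (f i)) \<le> fnorm M.h (T m) * fnorm M.h (f i)"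
        unfolding t_def using TM m fM i by (intro M.ip_bound) auto
      also have "\<dots> \<le> ((1 + c * c) * fnorm M.h m) * fnorm M.h (f i)" using Tbnd[OF m] fM[OF i] by (intro mult_right_mono) auto
      finally have "cmod (t m (f i)) * fnorm M.h (b i) \<le> ((1 + c * c) * fnorm M.h m) * fnorm M.h (f i) * fnorm M.h (b i)"
        using bM[OF i] by (intro mult_right_mono) auto
      then show "fnorm M.h (cscale (t m (f i)) (b i)) \<le> ((1 + c * c) * fnorm M.h (f i) * fnorm M.h (b i)) * fnorm M.h m"
        using M.H.fnorm_scale[OF bM[OF i]] by (simp add: mult_ac)
    qed
    finally have "fnorm M.h (T' m) \<le> fnorm M.h (T m) + 2 * (\<Sum>i<\<nu>. ((1 + c * c) * fnorm M.h (f i) * fnorm M.h (b i)) * fnorm M.h m)" by simp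
    then show ?thesis using Tbnd[OF m] by (simp add: B_def distrib_right sum_distrib_right mult.assoc)
  qed
  have hA: "M.h (T' (M.J x)) y = hform t \<nu> f (M.J x) (M.J y)" if "x \<in> M" "y \<in> M" for x y
    using M.ip_J[of "T' (M.J x)" y] ipT'[of "M.J x" "M.J y"] that T'M by simp
  \<comment> \<open>Composition with \<open>M.J\<close> makes \<open>T'\<close> self-adjoint and
    nonnegative for the Hilbert form of M, as \<open>hA\<close> shows.\<close>
  have "\<exists>H h1. hilb H h1 \<and> H \<subseteq> M \<and> (\<forall>m\<in>M. T' (M.J m) \<in> H) \<and> (\<forall>u\<in>H. \<forall>m\<in>M. h1 u (T' (M.J m)) = M.h u m)"
  proof (rule M.H.positive_kernel_space)
    show "T' (M.J (cscale a x + y)) = cscale a (T' (M.J x)) + T' (M.J y)" if "x \<in> M" "y \<in> M" for x y a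
      using that M.J_add T'lin by simp
    show "M.h (T' (M.J x)) y = M.h x (T' (M.J y))" if "x \<in> M" "y \<in> M" for x y
      using hA[OF that] hA[OF that(2,1)] tf.sym[of "M.J x" "M.J y"] M.H.sym[of x "T' (M.J y)"] that T'M by simp
    show "0 \<le> Re (M.h (T' (M.J x)) x)" if "x \<in> M" for x using hA[OF that that] tfpos that by simp
    show "fnorm M.h (T' (M.J x)) \<le> B * fnorm M.h x" if "x \<in> M" for x
      using T'bnd[of "M.J x"] M.J_norm[OF that] that by simp
  qed (use T'M in auto)
  then obtain H h1 where H: "hilb H h1" "H \<subseteq> M" and TJ: "\<And>m. m \<in> M \<Longrightarrow> T' (M.J m) \<in> H"
    "\<And>u m. u \<in> H \<Longrightarrow> m \<in> M \<Longrightarrow> h1 u (T' (M.J m)) = M.h u m" by blast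
  interpret H: hilb H h1 by fact
  have HM: "u \<in> M" if "u \<in> H" for u using that H by blast
  have T'H: "T' m \<in> H" if "m \<in> M" for m using TJ(1)[of "M.J m"] that by simp
  have hT': "h1 u (T' m) = ipM u m" if "u \<in> H" "m \<in> M" for u m
    using TJ(2)[of u "M.J m"] M.h_J[of u m] that HM by simp
  \<comment> \<open>On the negative directions \<open>T'\<close> is \<open>- T\<close>; therefore
    the vectors \<open>b j\<close> belong to H and are orthonormal for \<open>h1\<close>.\<close>
  have T'f: "T' (f j) = - b j" if j: "j < \<nu>" for j
  proof -
    have "(\<Sum>i<\<nu>. cscale (t (f j) (f i)) (b i)) = (\<Sum>i<\<nu>. if i = j then - b j else 0)"
      using tf j by (intro sum.cong) auto
    then show ?thesis using j by (simp add: T'_def b_def[symmetric] cv.scale_minus_right cscale_two)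
  qed
  have bH: "b i \<in> H" if "i < \<nu>" for i using T'H[OF fM[OF that]] T'f[OF that] H.minus_mem[of "- b i"] by simp
  have hb: "h1 u (b i) = - ipM u (f i)" if "u \<in> H" "i < \<nu>" for u i
  proof -
    have "- h1 u (b i) = ipM u (f i)"
      using hT'[OF that(1) fM[OF that(2)]] T'f[OF that(2)] bH[OF that(2)] that(1) by simp
    then show ?thesis by (metis minus_minus)
  qed
  have hb': "h1 (b i) u = - ipM (f i) u" if "u \<in> H" "i < \<nu>" for u i
    using hb[OF that] H.sym[OF bH[OF that(2)] that(1)] M.sym[OF fM[OF that(2)] HM[OF that(1)]] by simp
  have hbb: "h1 (b i) (b j) = (if i = j then 1 else 0)" if "i < \<nu>" "j < \<nu>" for i j
    using hb[OF bH[OF that(1)] that(2)] tf[OF that] by (simp add: b_def t_def)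
  \<comment> \<open>The sign is flipped back along the \<open>b i\<close>, which makes
    \<open>h1\<close> the Hilbert form \<open>hform ip1 \<nu> b\<close> of the new space.\<close>
  define ip1 where "ip1 u v = h1 u v - 2 * (\<Sum>i<\<nu>. h1 u (b i) * h1 (b i) v)" for u v
  have ip1b: "ip1 u (b j) = - h1 u (b j)" if "u \<in> H" "j < \<nu>" for u j
  proof -
    have "(\<Sum>i<\<nu>. h1 u (b i) * h1 (b i) (b j)) = (\<Sum>i<\<nu>. if i = j then h1 u (b j) else 0)"
      using hbb that by (intro sum.cong) auto
    then show ?thesis using that by (simp add: ip1_def)
  qed
  have ip1b': "ip1 (b j) u = - h1 (b j) u" if "u \<in> H" "j < \<nu>" for u j
  proof -
    have "(\<Sum>i<\<nu>. h1 (b j) (b i) * h1 (b i) u) = (\<Sum>i<\<nu>. if i = j then h1 (b j) u else 0)"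
      using hbb that by (intro sum.cong) auto
    then show ?thesis using that by (simp add: ip1_def)
  qed
  have hform1: "hform ip1 \<nu> b u v = h1 u v" if "u \<in> H" "v \<in> H" for u v
    using that by (simp add: hform_def ip1b ip1b') (simp add: ip1_def)
  interpret I: herm_space H ip1
  proof (rule herm_spaceI[OF H.sub])
    show "ip1 (cscale a x + y) z = a * ip1 x z + ip1 y z" if "x \<in> H" "y \<in> H" "z \<in> H" for x y z a
      using that bH by (simp add: ip1_def sum.distrib sum_distrib_left algebra_simps)
    show "ip1 x y = cnj (ip1 y x)" if xy: "x \<in> H" "y \<in> H" for x y
    proof -
      have "(\<Sum>i<\<nu>. h1 x (b i) * h1 (b i) y) = (\<Sum>i<\<nu>. cnj (h1 y (b i) * h1 (b i) x))"
        using H.sym[OF xy(1) bH] H.sym[OF bH xy(2)] by (intro sum.cong) (auto simp: mult.commute)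
      then show ?thesis using H.sym[OF xy] by (simp add: ip1_def)
    qed
  qed
  have "pont H ip1 \<nu> b"
  proof unfold_locales
    show "negfam H ip1 \<nu> b" unfolding negfam_def using bH ip1b hbb by auto
    show "hilbert_wrt H (hform ip1 \<nu> b)" using hilb_cong[OF H.hilb_axioms hform1] by (simp add: hilb_def)
  qed
  moreover have T_alt: "T m = T' m - cscale 2 (\<Sum>i<\<nu>. cscale (t m (f i)) (b i))" for m by (simp add: T'_def)
  have TH: "T m \<in> H" if "m \<in> M" for m unfolding T_alt using T'H that bH by simp
  \<comment> \<open>The finite-rank difference between \<open>T\<close> and \<open>T'\<close> and
    the one between \<open>ip1\<close> and \<open>h1\<close> cancel.\<close>
  moreover have "ip1 u (T m) = ipM u m" if u: "u \<in> H" and m: "m \<in> M" for u m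
  proof -
    have tc: "cnj (t m (f i)) = t (f i) m" if "i < \<nu>" for i using t.sym[OF fM[OF that] m] by simp
    have hT: "h1 v (T m) = ipM v m + 2 * (\<Sum>i<\<nu>. t (f i) m * ipM v (f i))" if v: "v \<in> H" for v
      unfolding T_alt using v T'H[OF m] bH by (simp add: hT' m tc hb sum_negf)
    have "h1 (b i) (T m) = - t (f i) m" if i: "i < \<nu>" for i
    proof -
      have "(\<Sum>j<\<nu>. t (f j) m * ipM (b i) (f j)) = (\<Sum>j<\<nu>. if j = i then - t (f i) m else 0)"
        using tf i by (intro sum.cong) (auto simp: b_def t_def)
      then show ?thesis using hT[OF bH[OF i]] i by (simp add: b_def t_def)
    qed
    then show ?thesis using hT[OF u] hb[OF u] by (simp add: ip1_def mult.commute)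
  qed
  ultimately show ?thesis using H(2) unfolding T_def by (intro exI[of _ H] exI[of _ ip1] exI[of _ b]) blast
qed

section \<open>Reproducing kernel spaces satisfying the resolvent inequality\<close>

lemma convex_right_half_plane: "convex right_half_plane"
  unfolding right_half_plane_def by (rule convex_halfspace_Re_gt)
lemma open_right_half_plane: "open right_half_plane"
  unfolding right_half_plane_def by (rule open_halfspace_Re_gt)
lemma connected_right_half_plane: "connected right_half_plane"
  by (rule convex_connected[OF convex_right_half_plane])

text \<open>The identity theorem is applied to the scalar functions \<open>ip (g z) c\<close>:
  removing the discrete exceptional sets keeps U connected and W nonempty. Nondegeneracy of the form
  then recovers the vectors.\<close>

lemma (in pont) wk_meromorphic_unique:
  assumes g1: "wk_meromorphic_on V ip U g1 E1" and g2: "wk_meromorphic_on V ip U g2 E2"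
    and U: "open U" "connected U" and W: "open W" "W \<subseteq> U" "W \<noteq> {}"
    and eq: "\<And>z. z \<in> W - (E1 \<union> E2) \<Longrightarrow> g1 z = g2 z" and z: "z \<in> U - (E1 \<union> E2)"
  shows "g1 z = g2 z"
proof -
  have sp: "(E1 \<union> E2) sparse_in U"
    using g1 g2 sparse_in_open[OF U(1)] unfolding wk_meromorphic_on_def
    by (intro sparse_in_union') blast+
  let ?U = "U - (E1 \<union> E2)"
  have oU: "open ?U" by (rule open_diff_sparse_pts[OF U(1) sp])
  have cU: "connected ?U" by (rule sparse_imp_connected[OF _ U(2,1) sp]) simp
  have "(E1 \<union> E2) sparse_in W" using sp W(2) by (rule sparse_in_subset)
  then have oW: "open (W - (E1 \<union> E2))" by (rule open_diff_sparse_pts[OF W(1)])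
  have nW: "W - (E1 \<union> E2) \<noteq> {}"
  proof
    assume "W - (E1 \<union> E2) = {}"
    obtain w where w: "w \<in> W" using W(3) by blast
    have "w islimpt W" using interior_limit_point[of w W] interior_open[OF W(1)] w by simp
    then have "w islimpt (E1 \<union> E2)" using \<open>W - (E1 \<union> E2) = {}\<close> by (meson Diff_eq_empty_iff islimpt_subset)
    then show False using sp w W(2) sparse_in_open[OF U(1)] by blast
  qed
  have V: "g1 w \<in> V" "g2 w \<in> V" if "w \<in> ?U" for w
    using g1 g2 that unfolding wk_meromorphic_on_def wk_analytic_def by blast+
  have "ip (g1 z) c = ip (g2 z) c" if c: "c \<in> V" for c
  proof (rule analytic_continuation_open[OF oW oU nW cU _ _ _ _ z])
    show "(\<lambda>z. ip (g1 z) c) holomorphic_on ?U" "(\<lambda>z. ip (g2 z) c) holomorphic_on ?U"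
      using g1 g2 c unfolding wk_meromorphic_on_def wk_analytic_def
      by (auto intro: holomorphic_on_subset[of _ "U - _"])
  qed (use W eq in auto)
  then show ?thesis using eqI V z by blast
qed

lemma neg_squares_cong:
  assumes "neg_squares C ip U k n" "\<And>z w c. z \<in> U \<Longrightarrow> w \<in> U \<Longrightarrow> c \<in> C \<Longrightarrow> k' z w c = k z w c"
  shows "neg_squares C ip U k' n"
proof -
  have g: "gram_mat ip k' N ws cs = gram_mat ip k N ws cs" if "\<forall>i<N. ws i \<in> U \<and> cs i \<in> C" for N ws cs
    unfolding gram_mat_def using that assms(2) by (intro cong_mat) auto
  show ?thesis
    using assms(1) unfolding neg_squares_def
    by (simp add: assms(2) g cong: conj_cong imp_cong)
qed

locale rk_setting = P: pont P ipP \<kappa> eP + C: pont C ipC \<nu> eC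
  for P :: "(complex \<Rightarrow> 'c::cvec) set" and ipP \<kappa> eP and C :: "'c set" and ipC \<nu> eC +
  fixes \<Omega> :: "complex set" and \<alpha> :: complex and K :: "complex \<Rightarrow> complex \<Rightarrow> 'c \<Rightarrow> 'c"
  assumes \<Omega>_open: "open \<Omega>" and \<Omega>_sub: "\<Omega> \<subseteq> right_half_plane" and \<alpha>_in: "\<alpha> \<in> \<Omega>"
    and P_analytic: "\<forall>f\<in>P. wk_analytic C ipC \<Omega> f \<and> (\<forall>z. z \<notin> \<Omega> \<longrightarrow> f z = 0)"
    and K_rk: "is_rep_kernel P ipP C ipC \<Omega> K"
    and R_inv: "\<forall>f\<in>P. Rop C ipC \<Omega> \<alpha> f \<in> P"
    and ineq: "\<forall>f\<in>P. Re (complex_of_real (2 * Re \<alpha>) * ipP (Rop C ipC \<Omega> \<alpha> f) (Rop C ipC \<Omega> \<alpha> f)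
                 + ipP (Rop C ipC \<Omega> \<alpha> f) f + ipP f (Rop C ipC \<Omega> \<alpha> f)
                 + 2 * complex_of_real pi * ipC (f \<alpha>) (f \<alpha>)) \<le> 0"
begin

abbreviation "R \<equiv> Rop C ipC \<Omega> \<alpha>"
abbreviation "a \<equiv> Re \<alpha>"

definition kz :: "complex \<Rightarrow> 'c \<Rightarrow> complex \<Rightarrow> 'c" where
  "kz w c = (\<lambda>z. if z \<in> \<Omega> then K z w c else 0)"

lemma a_pos: "a > 0" using \<alpha>_in \<Omega>_sub by (auto simp: right_half_plane_def)

lemma val_mem: "f \<in> P \<Longrightarrow> z \<in> \<Omega> \<Longrightarrow> f z \<in> C" using P_analytic by (auto simp: wk_analytic_def)
lemma val_out: "f \<in> P \<Longrightarrow> z \<notin> \<Omega> \<Longrightarrow> f z = 0" using P_analytic by auto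
lemma val_hol: "f \<in> P \<Longrightarrow> c \<in> C \<Longrightarrow> (\<lambda>z. ipC (f z) c) holomorphic_on \<Omega>" using P_analytic by (auto simp: wk_analytic_def)

lemma kz_mem: "w \<in> \<Omega> \<Longrightarrow> c \<in> C \<Longrightarrow> kz w c \<in> P" using K_rk by (auto simp: is_rep_kernel_def kz_def)
lemma kz_rep: "w \<in> \<Omega> \<Longrightarrow> c \<in> C \<Longrightarrow> f \<in> P \<Longrightarrow> ipP f (kz w c) = ipC (f w) c"
  using K_rk by (auto simp: is_rep_kernel_def kz_def)
lemma K_mem: "z \<in> \<Omega> \<Longrightarrow> w \<in> \<Omega> \<Longrightarrow> c \<in> C \<Longrightarrow> K z w c \<in> C"
  using val_mem[OF kz_mem] by (force simp: kz_def)
lemma kz_kz: "z \<in> \<Omega> \<Longrightarrow> w \<in> \<Omega> \<Longrightarrow> c \<in> C \<Longrightarrow> d \<in> C \<Longrightarrow> ipP (kz w c) (kz z d) = ipC (K z w c) d"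
  using kz_rep[of z d "kz w c"] kz_mem by (simp add: kz_def)

text \<open>The value at \<alpha> is forced by continuity of the scalar functions. Identities in P
  therefore need checking only off \<alpha>, where R is an explicit difference quotient and not a
  derivative.\<close>

lemma P_zeroI:
  assumes d: "d \<in> P" and z: "\<And>z. z \<in> \<Omega> \<Longrightarrow> z \<noteq> \<alpha> \<Longrightarrow> d z = 0"
  shows "d = 0"
proof
  fix w
  show "d w = 0 w"
  proof (cases "w = \<alpha>")
    case True
    have "ipC (d \<alpha>) c = 0" if c: "c \<in> C" for c
    proof (rule LIM_unique)
      have "isCont (\<lambda>z. ipC (d z) c) \<alpha>"
        using holomorphic_on_imp_continuous_on[OF val_hol[OF d c]] \<Omega>_open \<alpha>_in
        by (simp add: continuous_on_eq_continuous_at)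
      then show "(\<lambda>z. ipC (d z) c) \<midarrow>\<alpha>\<rightarrow> ipC (d \<alpha>) c" by (simp add: isCont_def)
      have "\<forall>\<^sub>F z in at \<alpha>. 0 = ipC (d z) c"
        unfolding eventually_at_topological using \<Omega>_open \<alpha>_in z c by (intro exI[of _ \<Omega>]) auto
      then show "(\<lambda>z. ipC (d z) c) \<midarrow>\<alpha>\<rightarrow> 0" by (rule Lim_transform_eventually[OF tendsto_const])
    qed
    then show ?thesis using C.nondeg[OF val_mem[OF d \<alpha>_in]] True by simp
  qed (use z val_out[OF d] in \<open>cases "w \<in> \<Omega>"; auto\<close>)
qed

lemma P_eqI:
  assumes "f \<in> P" "g \<in> P" "\<And>z. z \<in> \<Omega> \<Longrightarrow> z \<noteq> \<alpha> \<Longrightarrow> f z = g z"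
  shows "f = g"
  using P_zeroI[of "f - g"] assms by simp

lemma R_mem: "f \<in> P \<Longrightarrow> R f \<in> P" using R_inv by blast

lemma R_val: "z \<noteq> \<alpha> \<Longrightarrow> z \<in> \<Omega> \<Longrightarrow> R f z = cscale (inverse (z - \<alpha>)) (f z - f \<alpha>)" by (simp add: Rop_def)

text \<open>At \<alpha> both sides vanish, whatever value the derivative takes there.\<close>

lemma R_diff: "z \<in> \<Omega> \<Longrightarrow> cscale (z - \<alpha>) (R f z) = f z - f \<alpha>"
  by (cases "z = \<alpha>") (auto simp: R_val cscale_mult cscale_one)

lemma R_lin: "f \<in> P \<Longrightarrow> g \<in> P \<Longrightarrow> R (cscale b f + g) = cscale b (R f) + R g"
proof (rule P_eqI)
  assume fg: "f \<in> P" "g \<in> P"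
  then show "R (cscale b f + g) \<in> P" "cscale b (R f) + R g \<in> P" by (simp_all add: R_mem)
  show "R (cscale b f + g) z = (cscale b (R f) + R g) z" if "z \<in> \<Omega>" "z \<noteq> \<alpha>" for z
    using that by (simp add: R_val cscale_fun_def cscale_add_right cv.scale_right_diff_distrib cscale_mult mult.commute)
qed

definition A :: "(complex \<Rightarrow> 'c) \<Rightarrow> complex \<Rightarrow> 'c" where "A f = f + cscale (of_real (2 * a)) (R f)"

lemma A_mem: "f \<in> P \<Longrightarrow> A f \<in> P" by (simp add: A_def R_mem)
lemma A_lin: "f \<in> P \<Longrightarrow> g \<in> P \<Longrightarrow> A (cscale b f + g) = cscale b (A f) + A g"
  unfolding A_def by (subst R_lin) (simp_all add: cscale_add_right cscale_mult mult.commute add_ac)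

lemma energy: 
  assumes f: "f \<in> P" 
  shows "Re (ipP (A f) (A f)) \<le> Re (ipP f f) - 4 * pi * a * Re (ipC (f \<alpha>) (f \<alpha>))"
proof -
  \<comment> \<open>The left side of the hypothesis on R; expanding \<open>[A f, A f]\<close>
    produces it with the factor \<open>2a\<close>.\<close>
  define E where "E = complex_of_real (2 * a) * ipP (R f) (R f) + ipP (R f) f + ipP f (R f) + 2 * complex_of_real pi * ipC (f \<alpha>) (f \<alpha>)"
  have E: "Re E \<le> 0" using ineq f by (simp add: E_def)
  have "ipP (A f) (A f) = ipP f f + of_real (2 * a) * E - of_real (4 * pi * a) * ipC (f \<alpha>) (f \<alpha>)"
    using f R_mem[OF f] by (simp add: A_def E_def algebra_simps)
  then have "Re (ipP (A f) (A f)) = Re (ipP f f) + 2 * a * Re E - 4 * pi * a * Re (ipC (f \<alpha>) (f \<alpha>))"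
    by simp
  moreover have "2 * a * Re E \<le> 0" using E a_pos by (simp add: mult_nonneg_nonpos)
  ultimately show ?thesis by linarith
qed

text \<open>The evaluation term has the wrong sign at most on the negative part of C, which costs
  \<nu> scalar functionals; \<open>[f, f]\<close> is bounded by the squared Hilbert norm.\<close>

lemma energy_norm:
  assumes f: "f \<in> P"
  shows "Re (ipP (A f) (A f)) \<le> (fnorm P.h f)\<^sup>2 + 8 * pi * a * (\<Sum>j<\<nu>. (cmod (ipC (f \<alpha>) (eC j)))\<^sup>2)"
proof -
  have "- Re (ipC (f \<alpha>) (f \<alpha>)) \<le> 2 * (\<Sum>j<\<nu>. (cmod (ipC (f \<alpha>) (eC j)))\<^sup>2)"
    using C.h_self[OF val_mem[OF f \<alpha>_in]] by (smt (verit) zero_le_power2)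
  then have "(4 * pi * a) * (- Re (ipC (f \<alpha>) (f \<alpha>))) \<le> (4 * pi * a) * (2 * (\<Sum>j<\<nu>. (cmod (ipC (f \<alpha>) (eC j)))\<^sup>2))"
    using a_pos by (intro mult_left_mono) auto
  then have "- (4 * pi * a * Re (ipC (f \<alpha>) (f \<alpha>))) \<le> 8 * pi * a * (\<Sum>j<\<nu>. (cmod (ipC (f \<alpha>) (eC j)))\<^sup>2)" by simp
  then show ?thesis using energy[OF f] P.ip_self_le[OF f] by linarith
qed

text \<open>Sum of the squared norms of the functionals
  \<open>x \<mapsto> ipC (x \<alpha>) (eC j)\<close>, each represented by a kernel function at
  \<alpha>.\<close>

definition Z :: real where "Z = (\<Sum>j<\<nu>. (fnorm P.h (kz \<alpha> (eC j)))\<^sup>2)"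

lemma Z_nonneg: "Z \<ge> 0" by (auto simp: Z_def intro: sum_nonneg)

lemma ev_neg_bound:
  assumes x: "x \<in> P" shows "(\<Sum>j<\<nu>. (cmod (ipC (x \<alpha>) (eC j)))\<^sup>2) \<le> (fnorm P.h x)\<^sup>2 * Z"
  unfolding Z_def sum_distrib_left
proof (rule sum_mono)
  fix j assume "j \<in> {..<\<nu>}"
  then have j: "eC j \<in> C" using C.e_mem by simp
  have "cmod (ipC (x \<alpha>) (eC j)) \<le> fnorm P.h x * fnorm P.h (kz \<alpha> (eC j))"
    unfolding kz_rep[OF \<alpha>_in j x, symmetric] using x j \<alpha>_in by (intro P.ip_bound kz_mem)
  then have "(cmod (ipC (x \<alpha>) (eC j)))\<^sup>2 \<le> (fnorm P.h x * fnorm P.h (kz \<alpha> (eC j)))\<^sup>2" by (intro power_mono) auto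
  then show "(cmod (ipC (x \<alpha>) (eC j)))\<^sup>2 \<le> (fnorm P.h x)\<^sup>2 * (fnorm P.h (kz \<alpha> (eC j)))\<^sup>2"
    by (simp add: power_mult_distrib)
qed

text \<open>The point \<open>\<alpha>\<close> is left out: \<open>R f\<close> takes a derivative as its value there, so it is not yet clear
  that this kernel function lies in the domain of the adjoint of A.\<close>
definition X0 :: "(complex \<Rightarrow> 'c) set" where "X0 = {kz w c | w c. w \<in> \<Omega> \<and> w \<noteq> \<alpha> \<and> c \<in> C}"

lemma X0_P: "X0 \<subseteq> P" by (auto simp: X0_def kz_mem)
lemma spanX0_P: "cv.span X0 \<subseteq> P" by (intro cv.span_minimal X0_P P.subspaceV)
lemma spanX0_sub: "csubspace (cv.span X0)" by (simp add: csubspace_iff)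

lemma spanX0_orth:
  assumes y: "y \<in> P" and o: "\<And>x. x \<in> cv.span X0 \<Longrightarrow> ipP y x = 0" shows "y = 0"
proof (rule P_zeroI[OF y])
  fix z assume z: "z \<in> \<Omega>" "z \<noteq> \<alpha>"
  have "ipC (y z) c = 0" if "c \<in> C" for c
    using o[of "kz z c"] kz_rep[OF z(1) that y] z that by (auto simp: X0_def intro: cv.span_base)
  then show "y z = 0" using C.nondeg val_mem[OF y z(1)] by blast
qed

text \<open>Orthogonality to y in the Hilbert form is orthogonality to \<open>P.J y\<close> in
  \<open>ipP\<close>, which the reproducing property turns into vanishing of \<open>P.J y\<close>
  off \<alpha>.\<close>

lemma spanX0_dense: 
  assumes v: "v \<in> P" shows "\<exists>s. (\<forall>n::nat. s n \<in> cv.span X0) \<and> fconv P.h s v"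
proof (rule P.H.dense_if_orth_trivial[OF spanX0_sub spanX0_P v])
  fix y assume y: "y \<in> P" and o: "\<And>x. x \<in> cv.span X0 \<Longrightarrow> P.h y x = 0"
  have "P.J y = 0"
  proof (rule spanX0_orth)
    fix x assume x: "x \<in> cv.span X0"
    then have xP: "x \<in> P" using spanX0_P by blast
    have "ipP (P.J y) x = cnj (ipP x (P.J y))" using xP y by (intro P.sym) auto
    also have "ipP x (P.J y) = P.h x y" by (rule P.ip_J[OF xP y])
    also have "cnj (P.h x y) = P.h y x" using P.H.sym[OF y xP] by simp
    finally show "ipP (P.J y) x = 0" using o[OF x] by simp
  qed (use y in simp)
  moreover have "P.J 0 = 0" using P.J_e by (simp add: Jop_def P.e_mem)
  ultimately show "y = 0" using P.JJ[OF y] by simp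
qed

text \<open>For \<open>w \<noteq> \<alpha>\<close> the value of \<open>A x\<close> at w is a
  combination of \<open>x w\<close> and \<open>x \<alpha>\<close>, so the adjoint vector of
  \<open>kz w c\<close> is a combination of kernel functions at w and \<alpha>. This is available
  before A is known to be bounded.\<close>

lemma A_adjoint_on_spanX0:
  assumes "k \<in> cv.span X0" shows "\<exists>y\<in>P. \<forall>x\<in>P. ipP (A x) k = ipP x y"
proof -
  define D where "D = {k \<in> P. \<exists>y\<in>P. \<forall>x\<in>P. ipP (A x) k = ipP x y}"
  have "cv.span X0 \<subseteq> D"
  proof (rule cv.span_minimal)
    show "X0 \<subseteq> D"
    proof
      fix k assume "k \<in> X0"
      then obtain w c where k: "k = kz w c" "w \<in> \<Omega>" "w \<noteq> \<alpha>" "c \<in> C" by (auto simp: X0_def)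
      define b where "b = of_real (2 * a) * inverse (w - \<alpha>)"
      have "ipP (A x) k = ipP x (kz w c + cscale (cnj b) (kz w c - kz \<alpha> c))" if x: "x \<in> P" for x
      proof -
        have xC: "x w \<in> C" "x \<alpha> \<in> C" using x k \<alpha>_in by (auto intro: val_mem)
        have "ipP (A x) k = ipC (x w) c + b * (ipC (x w) c - ipC (x \<alpha>) c)"
          using k x xC by (simp add: kz_rep A_mem) (simp add: A_def cscale_fun_def R_val b_def)
        then show ?thesis using x k \<alpha>_in kz_mem by (simp add: kz_rep)
      qed
      moreover have "kz w c + cscale (cnj b) (kz w c - kz \<alpha> c) \<in> P" using k kz_mem \<alpha>_in by simp
      ultimately show "k \<in> D" unfolding D_def using k kz_mem by blast
    qed
    show "cv.subspace D"
    proof (rule cv.subspaceI)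
      show "0 \<in> D" unfolding D_def by (auto intro!: bexI[of _ 0] simp: A_mem)
    next
      fix k l assume "k \<in> D" "l \<in> D"
      then obtain y z where "k \<in> P" "y \<in> P" "\<forall>x\<in>P. ipP (A x) k = ipP x y" "l \<in> P" "z \<in> P" "\<forall>x\<in>P. ipP (A x) l = ipP x z"
        by (auto simp: D_def)
      then show "k + l \<in> D" unfolding D_def by (auto intro!: bexI[of _ "y + z"] simp: A_mem)
    next
      fix b k assume "k \<in> D"
      then obtain y where "k \<in> P" "y \<in> P" "\<forall>x\<in>P. ipP (A x) k = ipP x y" by (auto simp: D_def)
      then show "cscale b k \<in> D" unfolding D_def by (auto intro!: bexI[of _ "cscale b y"] simp: A_mem)
    qed
  qed
  then show ?thesis using assms by (auto simp: D_def)
qed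

text \<open>The energy estimate controls \<open>[A x, A x]\<close>, but the Hilbert norm of
  \<open>A x\<close> also contains its pairings with the negative vectors \<open>eP i\<close>, for
  which no adjoint vector is at hand yet. They are replaced by nearby vectors \<open>k i\<close> in
  the span of kernel functions, where adjoint vectors exist, and the error is absorbed into the norm
  of \<open>A x\<close>.\<close>

lemma A_bounded: "\<exists>c\<ge>0. \<forall>x\<in>P. fnorm P.h (A x) \<le> c * fnorm P.h x"
proof -
  \<comment> \<open>With M the norm of \<open>A x\<close>, the total error
    \<open>4 \<kappa> \<epsilon>^2 M^2\<close> becomes at most \<open>M^2 / 2\<close>; the added 1
    covers \<kappa> = 0.\<close>
  define \<epsilon> where "\<epsilon> = sqrt (1 / (8 * (real \<kappa> + 1)))"
  have e: "\<epsilon> > 0" "\<epsilon>\<^sup>2 = 1 / (8 * (real \<kappa> + 1))" by (auto simp: \<epsilon>_def)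
  have "\<exists>k y. k \<in> P \<and> y \<in> P \<and> fnorm P.h (eP i - k) < \<epsilon> \<and> (\<forall>x\<in>P. ipP (A x) k = ipP x y)" if i: "i < \<kappa>" for i
  proof -
    obtain s where s: "\<And>n::nat. s n \<in> cv.span X0" "fconv P.h s (eP i)"
      using spanX0_dense[OF P.e_mem[OF i]] by blast
    have "\<forall>\<^sub>F n in sequentially. fnorm P.h (s n - eP i) < \<epsilon>"
      using s(2) e unfolding fconv_def by (intro order_tendstoD) auto
    then obtain n where n: "fnorm P.h (s n - eP i) < \<epsilon>" by (auto simp: eventually_sequentially)
    have "s n \<in> P" using s spanX0_P by blast
    then show ?thesis using n A_adjoint_on_spanX0[OF s(1)[of n]] P.H.fnorm_commute[OF _ P.e_mem[OF i], of "s n"] by metis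
  qed
  then obtain k y where ky: "\<And>i. i < \<kappa> \<Longrightarrow> k i \<in> P" "\<And>i. i < \<kappa> \<Longrightarrow> y i \<in> P" "\<And>i. i < \<kappa> \<Longrightarrow> fnorm P.h (eP i - k i) < \<epsilon>"
    "\<And>i x. i < \<kappa> \<Longrightarrow> x \<in> P \<Longrightarrow> ipP (A x) (k i) = ipP x (y i)" by metis
  define Y where "Y = (\<Sum>i<\<kappa>. (fnorm P.h (y i))\<^sup>2)"
  define c where "c = sqrt (2 * (1 + 8 * pi * a * Z + 4 * Y))"
  have Y: "Y \<ge> 0" by (auto simp: Y_def intro: sum_nonneg)
  have c: "c \<ge> 0" "c\<^sup>2 = 2 * (1 + 8 * pi * a * Z + 4 * Y)"
    using Y Z_nonneg a_pos by (auto simp: c_def)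
  have "fnorm P.h (A x) \<le> c * fnorm P.h x" if x: "x \<in> P" for x
  proof (rule power2_le_imp_le)
    define N where "N = fnorm P.h x"
    define M where "M = fnorm P.h (A x)"
    have Ax: "A x \<in> P" using x by (rule A_mem)
    have NM: "N \<ge> 0" "M \<ge> 0" using x Ax by (auto simp: N_def M_def)
    have t: "(cmod (ipP (A x) (eP i)))\<^sup>2 \<le> 2 * N\<^sup>2 * (fnorm P.h (y i))\<^sup>2 + 2 * M\<^sup>2 * \<epsilon>\<^sup>2" if i: "i < \<kappa>" for i
    proof -
      have "ipP (A x) (eP i) = ipP x (y i) + ipP (A x) (eP i - k i)"
        using ky(4)[OF i x] ky(1)[OF i] P.e_mem[OF i] Ax by simp
      then have "cmod (ipP (A x) (eP i)) \<le> cmod (ipP x (y i)) + cmod (ipP (A x) (eP i - k i))"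
        by (metis norm_triangle_ineq)
      also have "\<dots> \<le> N * fnorm P.h (y i) + M * fnorm P.h (eP i - k i)"
        unfolding N_def M_def using x Ax ky i P.e_mem[OF i] by (intro add_mono P.ip_bound) auto
      also have "\<dots> \<le> N * fnorm P.h (y i) + M * \<epsilon>"
        using ky(3)[OF i] NM by (intro add_left_mono mult_left_mono) auto
      finally have "(cmod (ipP (A x) (eP i)))\<^sup>2 \<le> (N * fnorm P.h (y i) + M * \<epsilon>)\<^sup>2" by (intro power_mono) auto
      also have "\<dots> \<le> 2 * (N * fnorm P.h (y i))\<^sup>2 + 2 * (M * \<epsilon>)\<^sup>2"
        using sum_squares_bound[of "N * fnorm P.h (y i)" "M * \<epsilon>"] by (simp add: power2_sum)
      finally show ?thesis by (simp add: power_mult_distrib)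
    qed
    have "(\<Sum>i<\<kappa>. (cmod (ipP (A x) (eP i)))\<^sup>2) \<le> (\<Sum>i<\<kappa>. 2 * N\<^sup>2 * (fnorm P.h (y i))\<^sup>2 + 2 * M\<^sup>2 * \<epsilon>\<^sup>2)"
      using t by (intro sum_mono) auto
    also have "\<dots> = 2 * N\<^sup>2 * Y + real \<kappa> * (2 * M\<^sup>2 * \<epsilon>\<^sup>2)" by (simp add: sum.distrib Y_def sum_distrib_left)
    also have "real \<kappa> * (2 * M\<^sup>2 * \<epsilon>\<^sup>2) \<le> M\<^sup>2 / 4"
    proof -
      have "real \<kappa> * \<epsilon>\<^sup>2 \<le> 1 / 8" unfolding e(2) by (simp add: field_simps)
      then have "(real \<kappa> * \<epsilon>\<^sup>2) * (2 * M\<^sup>2) \<le> (1 / 8) * (2 * M\<^sup>2)" by (rule mult_right_mono) simp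
      then show ?thesis by (simp add: mult_ac)
    qed
    finally have s1: "(\<Sum>i<\<kappa>. (cmod (ipP (A x) (eP i)))\<^sup>2) \<le> 2 * N\<^sup>2 * Y + M\<^sup>2 / 4" by simp
    have "8 * pi * a * (\<Sum>j<\<nu>. (cmod (ipC (x \<alpha>) (eC j)))\<^sup>2) \<le> 8 * pi * a * (N\<^sup>2 * Z)"
      unfolding N_def using ev_neg_bound[OF x] a_pos by (intro mult_left_mono) auto
    then have s2: "Re (ipP (A x) (A x)) \<le> N\<^sup>2 + 8 * pi * a * (N\<^sup>2 * Z)"
      using energy_norm[OF x] unfolding N_def by linarith
    have "M\<^sup>2 = Re (ipP (A x) (A x)) + 2 * (\<Sum>i<\<kappa>. (cmod (ipP (A x) (eP i)))\<^sup>2)"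
      unfolding M_def by (rule P.h_self[OF Ax])
    also have "\<dots> \<le> N\<^sup>2 + 8 * pi * a * (N\<^sup>2 * Z) + 2 * (2 * N\<^sup>2 * Y + M\<^sup>2 / 4)"
      using s1 s2 by (intro add_mono mult_left_mono) auto
    finally have "M\<^sup>2 / 2 \<le> N\<^sup>2 * (1 + 8 * pi * a * Z + 4 * Y)" by (simp add: algebra_simps)
    then show "(fnorm P.h (A x))\<^sup>2 \<le> (c * fnorm P.h x)\<^sup>2"
      unfolding power_mult_distrib c(2) N_def[symmetric] M_def[symmetric] by (simp add: algebra_simps)
    show "0 \<le> c * fnorm P.h x" using c x by simp
  qed
  then show ?thesis using c(1) by blast
qed

lemma A_adjoint_exists: "\<exists>As. \<forall>y\<in>P. As y \<in> P \<and> (\<forall>x\<in>P. ipP (A x) y = ipP x (As y))"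
proof -
  obtain c where c: "c \<ge> 0" "\<And>x. x \<in> P \<Longrightarrow> fnorm P.h (A x) \<le> c * fnorm P.h x" using A_bounded by blast
  have "\<exists>z\<in>P. \<forall>x\<in>P. ipP (A x) y = ipP x z" if y: "y \<in> P" for y
  proof (rule P.riesz_ip)
    show "ipP (A (cscale b x + x')) y = b * ipP (A x) y + ipP (A x') y" if "x \<in> P" "x' \<in> P" for b x x'
      using that y by (simp add: A_lin A_mem)
    show "cmod (ipP (A x) y) \<le> (c * fnorm P.h y) * fnorm P.h x" if x: "x \<in> P" for x
    proof -
      have "cmod (ipP (A x) y) \<le> fnorm P.h (A x) * fnorm P.h y" using x y A_mem by (intro P.ip_bound)
      also have "\<dots> \<le> (c * fnorm P.h x) * fnorm P.h y" using c(2)[OF x] y by (intro mult_right_mono) auto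
      finally show ?thesis by (simp add: mult_ac)
    qed
  qed
  then show ?thesis by metis
qed

definition As :: "(complex \<Rightarrow> 'c) \<Rightarrow> complex \<Rightarrow> 'c" where
  "As = (SOME As. \<forall>y\<in>P. As y \<in> P \<and> (\<forall>x\<in>P. ipP (A x) y = ipP x (As y)))"

lemma As_mem: "y \<in> P \<Longrightarrow> As y \<in> P" and A_adj: "x \<in> P \<Longrightarrow> y \<in> P \<Longrightarrow> ipP (A x) y = ipP x (As y)"
  using someI_ex[OF A_adjoint_exists] unfolding As_def by blast+

section \<open>The number of negative squares of the reproducing kernel\<close>

lemma kernel_negfam: "\<exists>f. negfam (cv.span X0) ipP \<kappa> f"
proof -
  interpret X: herm_space "cv.span X0" ipP by (rule P.herm_space_sub[OF spanX0_sub spanX0_P])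
  have negP: "negfam P ipP k f" if "negfam (cv.span X0) ipP k f" for k f
    using that spanX0_P by (auto simp: negfam_def)
  obtain k f where mf: "maxneg (cv.span X0) ipP k f"
    using X.maxneg_exists[of \<kappa>] P.inertia[OF P.maxneg negP] by blast
  then have f: "negfam (cv.span X0) ipP k f" by (simp add: maxneg_def)
  have fP: "f i \<in> P" if "i < k" for i using negP[OF f] that by (simp add: negfam_def)
  \<comment> \<open>The flipped form is continuous, so maximality passes from the dense span of
    kernel functions to P; inertia then forces the length \<kappa>.\<close>
  have "0 \<le> Re (hform ipP k f x x)" if x: "x \<in> P" for x
  proof -
    obtain s where s: "\<And>n::nat. s n \<in> cv.span X0" "fconv P.h s x" using spanX0_dense[OF x] by blast
    have sP: "s n \<in> P" for n using s(1) spanX0_P by blast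
    have "(\<lambda>n. ipP (s n) (s n) + 2 * (\<Sum>i<k. ipP (s n) (f i) * ipP (f i) (s n))) \<longlonglongrightarrow> ipP x x + 2 * (\<Sum>i<k. ipP x (f i) * ipP (f i) x)"
    proof (intro tendsto_intros)
      show "(\<lambda>n. ipP (s n) (s n)) \<longlonglongrightarrow> ipP x x" by (rule P.fconv_ip'[OF sP s(2) x sP s(2) x])
      fix i assume "i \<in> {..<k}"
      then have i: "f i \<in> P" using fP by simp
      show "(\<lambda>n. ipP (s n) (f i)) \<longlonglongrightarrow> ipP x (f i)" "(\<lambda>n. ipP (f i) (s n)) \<longlonglongrightarrow> ipP (f i) x"
        using P.fconv_ip'[OF sP s(2) x i P.H.fconv_const[OF i] i] P.fconv_ip'[OF i P.H.fconv_const[OF i] i sP s(2) x] by auto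
    qed
    then have lim: "(\<lambda>n. Re (hform ipP k f (s n) (s n))) \<longlonglongrightarrow> Re (hform ipP k f x x)"
      unfolding hform_def by (rule tendsto_Re)
    show ?thesis by (rule LIMSEQ_le_const[OF lim]) (use mf s(1) in \<open>auto simp: maxneg_def\<close>)
  qed
  then have "maxneg P ipP k f" using negP[OF f] by (simp add: maxneg_def)
  then have "k = \<kappa>" using P.inertia_eq[OF _ P.maxneg] by blast
  then show ?thesis using f by blast
qed

lemma gram_K: 
  assumes "\<forall>i<N. ws i \<in> \<Omega> \<and> cs i \<in> C"
  shows "gram_mat ipC K N ws cs = mat N N (\<lambda>(l, j). ipP (kz (ws j) (cs j)) (kz (ws l) (cs l)))"
  unfolding gram_mat_def using assms by (intro cong_mat) (auto simp: kz_kz)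

lemma num_neg_le:
  assumes "\<forall>i<N. ws i \<in> \<Omega> \<and> cs i \<in> C" shows "num_neg_eig (gram_mat ipC K N ws cs) \<le> \<kappa>"
proof -
  define v where "v i = kz (ws i) (cs i)" for i
  have v: "v i \<in> P" if "i < N" for i using assms that kz_mem by (simp add: v_def)
  obtain e where e: "maxneg (cv.span (v ` {..<N})) ipP (num_neg_eig (gram_mat ipC K N ws cs)) e"
    using P.gram_maxneg[of N v, OF v] unfolding gram_K[OF assms] v_def by blast
  have "cv.span (v ` {..<N}) \<subseteq> P" using v by (intro cv.span_minimal P.subspaceV) auto
  then have "negfam P ipP (num_neg_eig (gram_mat ipC K N ws cs)) e" using e by (auto simp: maxneg_def negfam_def)
  then show ?thesis by (rule P.inertia[OF P.maxneg])
qed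

text \<open>A negative family of length \<kappa> in the span of kernel functions involves only
  finitely many of them. On their span the negative eigenvalues of the Gram matrix give a maximal
  family, so inertia bounds their number below by \<kappa>.\<close>

lemma num_neg_attained:
  "\<exists>N ws cs. (\<forall>i<N. ws i \<in> \<Omega> \<and> cs i \<in> C) \<and> num_neg_eig (gram_mat ipC K N ws cs) = \<kappa>"
proof -
  obtain f where f: "negfam (cv.span X0) ipP \<kappa> f" using kernel_negfam by blast
  have "\<exists>t. finite t \<and> t \<subseteq> X0 \<and> f i \<in> cv.span t" if "i < \<kappa>" for i
  proof -
    have "f i \<in> cv.span X0" using f that by (simp add: negfam_def)
    then obtain t r where "finite t" "t \<subseteq> X0" "f i = (\<Sum>a\<in>t. cscale (r a) a)" unfolding cv.span_explicit by blast
    moreover have "(\<Sum>a\<in>t. cscale (r a) a) \<in> cv.span t" by (intro cv.span_sum cv.span_scale cv.span_base)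
    ultimately show ?thesis by (intro exI[of _ t]) simp
  qed
  then obtain t where t: "\<And>i. i < \<kappa> \<Longrightarrow> finite (t i) \<and> t i \<subseteq> X0 \<and> f i \<in> cv.span (t i)" by metis
  define F where "F = (\<Union>i<\<kappa>. t i)"
  have F: "finite F" "F \<subseteq> X0" using t by (auto simp: F_def)
  have fF: "f i \<in> cv.span F" if "i < \<kappa>" for i
    using t[OF that] cv.span_mono[of "t i" F] that by (auto simp: F_def)
  obtain N v where v: "F = v ` {i. i < (N::nat)}" using F(1) unfolding finite_conv_nat_seg_image by blast
  have "\<exists>w c. v i = kz w c \<and> w \<in> \<Omega> \<and> c \<in> C" if "i < N" for i
  proof -
    have "v i \<in> F" using v that by auto
    then show ?thesis using F(2) unfolding X0_def by blast
  qed
  then obtain ws cs where wc: "\<And>i. i < N \<Longrightarrow> v i = kz (ws i) (cs i) \<and> ws i \<in> \<Omega> \<and> cs i \<in> C" by metis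
  then have wc': "\<forall>i<N. ws i \<in> \<Omega> \<and> cs i \<in> C" by blast
  have vP: "v i \<in> P" if "i < N" for i using wc[OF that] kz_mem by simp
  have F': "F = v ` {..<N}" unfolding v by (simp add: lessThan_def)
  have M: "gram_mat ipC K N ws cs = mat N N (\<lambda>(l, j). ipP (v j) (v l))"
    unfolding gram_K[OF wc'] using wc by (intro cong_mat) auto
  obtain e where e: "maxneg (cv.span F) ipP (num_neg_eig (gram_mat ipC K N ws cs)) e"
    using P.gram_maxneg[of N v, OF vP] unfolding M F' by blast
  have FP: "cv.span F \<subseteq> P" using vP unfolding F' by (intro cv.span_minimal P.subspaceV) auto
  interpret Y: herm_space "cv.span F" ipP
    by (rule P.herm_space_sub[OF _ FP]) (simp add: csubspace_iff)
  have "negfam (cv.span F) ipP \<kappa> f" using f fF by (simp add: negfam_def)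
  from Y.inertia[OF e this] have "\<kappa> \<le> num_neg_eig (gram_mat ipC K N ws cs)" .
  then have "num_neg_eig (gram_mat ipC K N ws cs) = \<kappa>" using num_neg_le[OF wc'] by simp
  then show ?thesis using wc' by blast
qed

lemma K_neg_squares: "neg_squares C ipC \<Omega> K \<kappa>"
  unfolding neg_squares_def
proof (intro conjI ballI allI impI)
  fix z w c d assume zw: "z \<in> \<Omega>" "w \<in> \<Omega>" "c \<in> C" "d \<in> C"
  have "ipC (K z w c) d = cnj (ipP (kz z d) (kz w c))"
    using zw kz_mem P.sym[of "kz w c" "kz z d"] by (simp add: kz_kz)
  also have "\<dots> = ipC c (K w z d)"
    using zw K_mem C.sym[of c "K w z d"] by (simp add: kz_kz)
  finally show "ipC (K z w c) d = ipC c (K w z d)" .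
qed (use K_mem num_neg_le num_neg_attained in auto)

end

section \<open>Meromorphic extension and the Schur function\<close>

context rk_setting begin

text \<open>The squared norm of \<open>A x\<close> is \<open>[A x, A x]\<close> plus twice the
  squared pairings with the \<open>eP i\<close>. The adjoint moves these pairings onto x, and
  \<open>energy_norm\<close> contributes the evaluations at \<alpha>. \<open>P.J\<close> rewrites
  everything in the Hilbert form, and the square roots absorb the weights 2 and
  \<open>8 \<pi> a\<close>.\<close>

lemma A_finite_rank_bound:
  assumes x: "x \<in> P"
  shows "(fnorm P.h (A x))\<^sup>2 \<le> (fnorm P.h x)\<^sup>2 + (\<Sum>k<\<kappa> + \<nu>. (cmod (P.h x
    (if k < \<kappa> then cscale (of_real (sqrt 2)) (P.J (As (eP k))) 
     else cscale (of_real (sqrt (8 * pi * a))) (P.J (kz \<alpha> (eC (k - \<kappa>)))))))\<^sup>2)"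
proof -
  let ?s1 = "\<Sum>i<\<kappa>. (cmod (ipP x (As (eP i))))\<^sup>2" and ?s2 = "\<Sum>j<\<nu>. (cmod (ipC (x \<alpha>) (eC j)))\<^sup>2"
  have t: "(cmod (P.h x (cscale (of_real (sqrt r)) (P.J v))))\<^sup>2 = r * (cmod (ipP x v))\<^sup>2" if "v \<in> P" "r \<ge> 0" for v r
    using x that P.h_J[OF x that(1)] by (simp add: norm_mult power_mult_distrib)
  have "(\<Sum>k<\<kappa> + \<nu>. (cmod (P.h x
    (if k < \<kappa> then cscale (of_real (sqrt 2)) (P.J (As (eP k))) 
     else cscale (of_real (sqrt (8 * pi * a))) (P.J (kz \<alpha> (eC (k - \<kappa>)))))))\<^sup>2)
    = (\<Sum>k<\<kappa> + \<nu>. if k < \<kappa> then (cmod (P.h x (cscale (of_real (sqrt 2)) (P.J (As (eP k))))))\<^sup>2 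
     else (cmod (P.h x (cscale (of_real (sqrt (8 * pi * a))) (P.J (kz \<alpha> (eC (k - \<kappa>)))))))\<^sup>2)"
    by (intro sum.cong) auto
  also have "\<dots> = (\<Sum>i<\<kappa>. (cmod (P.h x (cscale (of_real (sqrt 2)) (P.J (As (eP i))))))\<^sup>2)
    + (\<Sum>j<\<nu>. (cmod (P.h x (cscale (of_real (sqrt (8 * pi * a))) (P.J (kz \<alpha> (eC j))))))\<^sup>2)"
    by (rule sum_append)
  also have "(\<Sum>i<\<kappa>. (cmod (P.h x (cscale (of_real (sqrt 2)) (P.J (As (eP i))))))\<^sup>2) = 2 * ?s1"
    unfolding sum_distrib_left by (intro sum.cong refl t As_mem P.e_mem) auto
  also have "(\<Sum>j<\<nu>. (cmod (P.h x (cscale (of_real (sqrt (8 * pi * a))) (P.J (kz \<alpha> (eC j))))))\<^sup>2) = 8 * pi * a * ?s2"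
    unfolding sum_distrib_left
  proof (intro sum.cong refl)
    fix j assume "j \<in> {..<\<nu>}"
    then have j: "eC j \<in> C" using C.e_mem by simp
    show "(cmod (P.h x (cscale (of_real (sqrt (8 * pi * a))) (P.J (kz \<alpha> (eC j))))))\<^sup>2 = 8 * pi * a * (cmod (ipC (x \<alpha>) (eC j)))\<^sup>2"
      using t[OF kz_mem[OF \<alpha>_in j], of "8 * pi * a"] a_pos kz_rep[OF \<alpha>_in j x] by simp
  qed
  finally have s: "(\<Sum>k<\<kappa> + \<nu>. (cmod (P.h x
    (if k < \<kappa> then cscale (of_real (sqrt 2)) (P.J (As (eP k))) 
     else cscale (of_real (sqrt (8 * pi * a))) (P.J (kz \<alpha> (eC (k - \<kappa>)))))))\<^sup>2) = 2 * ?s1 + 8 * pi * a * ?s2" .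
  have e1: "(fnorm P.h (A x))\<^sup>2 = Re (ipP (A x) (A x)) + 2 * ?s1"
    using P.h_self[OF A_mem[OF x]] x by (simp add: A_adj P.e_mem)
  show ?thesis unfolding s e1 using energy_norm[OF x] by simp
qed

lemma denom_nonzero: "z \<in> right_half_plane \<Longrightarrow> w \<in> right_half_plane \<Longrightarrow> z + cnj w \<noteq> 0"
  by (auto simp: right_half_plane_def complex_eq_iff)

lemma \<alpha>_rhp: "\<alpha> \<in> right_half_plane" using \<alpha>_in \<Omega>_sub by blast

lemma cayley_ball: 
  assumes z: "z \<in> right_half_plane" shows "(z - \<alpha>) / (z + cnj \<alpha>) \<in> ball 0 1"
proof -
  have "(cmod (z + cnj \<alpha>))\<^sup>2 - (cmod (z - \<alpha>))\<^sup>2 = 4 * Re z * a"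
    unfolding cmod_power2 by (simp add: power2_eq_square algebra_simps)
  moreover have "4 * Re z * a > 0" using z a_pos by (simp add: right_half_plane_def)
  ultimately have "(cmod (z - \<alpha>))\<^sup>2 < (cmod (z + cnj \<alpha>))\<^sup>2" by linarith
  then have "cmod (z - \<alpha>) < cmod (z + cnj \<alpha>)" by (rule power_less_imp_less_base) simp
  moreover have "cmod (z + cnj \<alpha>) > 0" using denom_nonzero[OF z \<alpha>_rhp] by simp
  ultimately show ?thesis by (simp add: norm_divide)
qed

text \<open>With \<open>y = (I - \<lambda> A)^-1 f\<close>, the identity \<open>I - \<lambda> A =
  2a/(z + cnj \<alpha>) (I - (z - \<alpha>) R)\<close> evaluated at z gives
  \<open>f z = 2a/(z + cnj \<alpha>) y \<alpha>\<close>. Only the value of y at \<alpha> enters, so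
  the right side makes sense for z outside \<Omega>.\<close>

theorem meromorphic_extension:
  assumes f: "f \<in> P"
  shows "\<exists>g E. wk_meromorphic_on C ipC right_half_plane g E \<and> (\<forall>z\<in>\<Omega> - E. g z = f z)"
proof -
  have "\<exists>d X. meromorphic_resolvent_pair P P.h A d X"
    by (rule P.H.finite_rank_perturbation_resolvent[OF A_mem A_lin _ A_finite_rank_bound])
      (auto simp: As_mem P.e_mem C.e_mem kz_mem \<alpha>_in)
  then obtain d X where d: "d holomorphic_on ball 0 1" "d 0 = 1" 
    and XP: "\<And>l. l \<in> ball 0 1 \<Longrightarrow> X l f \<in> P"
    and X: "\<And>l. l \<in> ball 0 1 \<Longrightarrow> X l f - cscale l (A (X l f)) = cscale (d l) f"
    and hol: "\<And>v. v \<in> P \<Longrightarrow> (\<lambda>l. P.h (X l f) v) holomorphic_on ball 0 1"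
    using f unfolding meromorphic_resolvent_pair_def by blast
  let ?H = right_half_plane
  define lam where "lam z = (z - \<alpha>) / (z + cnj \<alpha>)" for z
  have den: "z + cnj \<alpha> \<noteq> 0" if "z \<in> ?H" for z using denom_nonzero[OF that \<alpha>_rhp] .
  have lam: "lam z \<in> ball 0 1" if "z \<in> ?H" for z unfolding lam_def by (rule cayley_ball[OF that])
  have lam_hol: "lam holomorphic_on ?H" unfolding lam_def by (intro holomorphic_intros den)
  have comp: "(\<lambda>z. F (lam z)) holomorphic_on ?H" if "F holomorphic_on ball 0 1" for F
  proof -
    have "lam ` ?H \<subseteq> ball 0 1" using lam by blast
    from holomorphic_on_compose_gen[OF lam_hol that this] show ?thesis by (simp add: o_def)
  qed
  define Y where "Y z = X (lam z) f" for z
  have YP: "Y z \<in> P" if "z \<in> ?H" for z unfolding Y_def by (rule XP[OF lam[OF that]])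
  define D where "D z = d (lam z)" for z
  have D_hol: "D holomorphic_on ?H" unfolding D_def by (rule comp[OF d(1)])
  have D\<alpha>: "D \<alpha> = 1" by (simp add: D_def lam_def d(2))
  \<comment> \<open>All poles lie among the zeros of the denominator, which cannot accumulate in the
    half plane because D equals 1 at \<alpha>.\<close>
  define E where "E = {z \<in> ?H. D z = 0}"
  \<comment> \<open>The numerator of the extension, holomorphic on the whole half plane.\<close>
  define g0 where "g0 z = cscale (of_real (2 * a) / (z + cnj \<alpha>)) (Y z \<alpha>)" for z
  have g0C: "g0 z \<in> C" if "z \<in> ?H" for z unfolding g0_def using val_mem[OF YP[OF that] \<alpha>_in] by simp
  have g0_hol: "(\<lambda>z. ipC (g0 z) c) holomorphic_on ?H" if c: "c \<in> C" for c
  proof -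
    have "(\<lambda>z. of_real (2 * a) / (z + cnj \<alpha>) * P.h (Y z) (P.J (kz \<alpha> c))) holomorphic_on ?H"
      unfolding Y_def by (intro holomorphic_intros den comp hol) (use kz_mem[OF \<alpha>_in c] in simp_all)
    moreover have "of_real (2 * a) / (z + cnj \<alpha>) * P.h (Y z) (P.J (kz \<alpha> c)) = ipC (g0 z) c" if z: "z \<in> ?H" for z
      using P.h_J[OF YP[OF z] kz_mem[OF \<alpha>_in c]] kz_rep[OF \<alpha>_in c YP[OF z]] val_mem[OF YP[OF z] \<alpha>_in] c by (simp add: g0_def)
    ultimately show ?thesis by (rule holomorphic_transform)
  qed
  have g0_f: "g0 z = cscale (D z) (f z)" if z: "z \<in> \<Omega>" for z
  proof -
    have zH: "z \<in> ?H" using z \<Omega>_sub by blast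
    have "cscale (D z) (f z) = (Y z - cscale (lam z) (A (Y z))) z"
      using fun_cong[OF X[OF lam[OF zH]], of z] by (simp add: cscale_fun_def Y_def D_def)
    also have "\<dots> = cscale (1 - lam z) (Y z z) - cscale (of_real (2 * a) * lam z) (R (Y z) z)"
      by (simp add: A_def cscale_fun_def cscale_add_right cscale_mult cv.scale_left_diff_distrib cscale_one mult.commute)
    also have "1 - lam z = of_real (2 * a) / (z + cnj \<alpha>)"
      using den[OF zH] complex_add_cnj[of \<alpha>] by (simp add: lam_def field_simps)
    also have "of_real (2 * a) * lam z = of_real (2 * a) / (z + cnj \<alpha>) * (z - \<alpha>)" by (simp add: lam_def)
    also have "cscale (of_real (2 * a) / (z + cnj \<alpha>) * (z - \<alpha>)) (R (Y z) z) = cscale (of_real (2 * a) / (z + cnj \<alpha>)) (Y z z - Y z \<alpha>)"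
      by (simp only: cscale_mult[symmetric] R_diff[OF z])
    finally show ?thesis by (simp add: g0_def cv.scale_right_diff_distrib)
  qed
  define g where "g z = cscale (inverse (D z)) (g0 z)" for z
  have "wk_meromorphic_on C ipC ?H g E"
    unfolding wk_meromorphic_on_def
  proof (intro conjI ballI)
    show "E \<subseteq> ?H" by (auto simp: E_def)
    fix z assume z: "z \<in> ?H"
    show "\<not> z islimpt E"
    proof
      assume "z islimpt E"
      have "D \<alpha> = 0"
      proof (rule analytic_continuation[OF D_hol open_right_half_plane connected_right_half_plane _ z \<open>z islimpt E\<close> _ \<alpha>_rhp])
        show "E \<subseteq> ?H" by (auto simp: E_def)
        show "D w = 0" if "w \<in> E" for w using that by (simp add: E_def)
      qed
      then show False by (simp add: D\<alpha>)
    qed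
  next
    show "wk_analytic C ipC (?H - E) g"
      unfolding wk_analytic_def
    proof (intro conjI ballI)
      show "g z \<in> C" if "z \<in> ?H - E" for z using that g0C by (simp add: g_def)
      fix c assume c: "c \<in> C"
      have "(\<lambda>z. inverse (D z) * ipC (g0 z) c) holomorphic_on ?H - E"
        by (intro holomorphic_intros holomorphic_on_subset[OF D_hol] holomorphic_on_subset[OF g0_hol[OF c]]) (auto simp: E_def)
      then show "(\<lambda>z. ipC (g z) c) holomorphic_on ?H - E"
        by (rule holomorphic_transform) (use g0C c in \<open>simp add: g_def\<close>)
    qed
  next
    fix z0 assume "z0 \<in> E"
    then have z0: "z0 \<in> ?H" "D z0 = 0" by (auto simp: E_def)
    have "\<not> D constant_on ?H" using z0 D\<alpha> \<alpha>_rhp unfolding constant_on_def by (metis zero_neq_one)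
    from holomorphic_factor_zero_nonconstant[OF D_hol open_right_half_plane connected_right_half_plane z0 this]
    obtain \<delta> r n where r: "0 < r" "ball z0 r \<subseteq> ?H" and del: "\<delta> holomorphic_on ball z0 r"
      "\<And>w. w \<in> ball z0 r \<Longrightarrow> D w = (w - z0) ^ n * \<delta> w" "\<And>w. w \<in> ball z0 r \<Longrightarrow> \<delta> w \<noteq> 0" by metis
    \<comment> \<open>Dividing by the nonvanishing factor \<delta> of D instead of D itself clears
      the pole at \<open>z0\<close>.\<close>
    define h where "h w = cscale (inverse (\<delta> w)) (g0 w)" for w
    have "wk_analytic C ipC (ball z0 r) h"
      unfolding wk_analytic_def
    proof (intro conjI ballI)
      show "h w \<in> C" if "w \<in> ball z0 r" for w using that r g0C by (auto simp: h_def)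
      fix c assume c: "c \<in> C"
      have "(\<lambda>w. inverse (\<delta> w) * ipC (g0 w) c) holomorphic_on ball z0 r"
        by (intro holomorphic_intros del holomorphic_on_subset[OF g0_hol[OF c]] r)
      then show "(\<lambda>w. ipC (h w) c) holomorphic_on ball z0 r"
        by (rule holomorphic_transform) (use g0C c r in \<open>auto simp: h_def\<close>)
    qed
    moreover have "h w = cscale ((w - z0) ^ n) (g w)" if "w \<in> ball z0 r - {z0}" for w
      using that del(2)[of w] by (simp add: h_def g_def cscale_mult)
    ultimately show "\<exists>n. \<exists>r>0. \<exists>h. ball z0 r \<subseteq> ?H \<and> wk_analytic C ipC (ball z0 r) h \<and> (\<forall>z\<in>ball z0 r - {z0}. h z = cscale ((z - z0) ^ n) (g z))"
      using r by blast
  qed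
  moreover have "g z = f z" if "z \<in> \<Omega> - E" for z
  proof -
    have "D z \<noteq> 0" using that \<Omega>_sub by (auto simp: E_def)
    then show ?thesis using that g0_f[of z] by (simp add: g_def cscale_mult cscale_one)
  qed
  ultimately show ?thesis by blast
qed

section \<open>The contraction into the direct sum and its defect space\<close>

definition ipM :: "(complex \<Rightarrow> 'c) \<times> 'c \<Rightarrow> (complex \<Rightarrow> 'c) \<times> 'c \<Rightarrow> complex" where "ipM = sum_form ipP ipC"
definition G :: "(complex \<Rightarrow> 'c) \<Rightarrow> (complex \<Rightarrow> 'c) \<times> 'c" where
  "G x = (A x, cscale (of_real (sqrt (4 * pi * a))) (x \<alpha>))"
text \<open>The adjoint of G: the kernel function \<open>kz \<alpha>\<close> supplies the adjoint of
  evaluation at \<alpha>.\<close>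

definition Gs :: "(complex \<Rightarrow> 'c) \<times> 'c \<Rightarrow> complex \<Rightarrow> 'c" where
  "Gs m = As (fst m) + cscale (of_real (sqrt (4 * pi * a))) (kz \<alpha> (snd m))"

lemma G_mem: "x \<in> P \<Longrightarrow> G x \<in> P \<times> C" by (simp add: G_def A_mem val_mem \<alpha>_in)
lemma Gs_mem: "m \<in> P \<times> C \<Longrightarrow> Gs m \<in> P" by (auto simp: Gs_def As_mem kz_mem \<alpha>_in)
lemma G_adj: "x \<in> P \<Longrightarrow> m \<in> P \<times> C \<Longrightarrow> ipM (G x) m = ipP x (Gs m)"
  by (auto simp: ipM_def sum_form_def G_def Gs_def A_adj As_mem kz_mem \<alpha>_in val_mem kz_rep)

text \<open>The energy inequality, read backwards, bounds
  \<open>4\<pi>a [x \<alpha>, x \<alpha>]\<close> by \<open>[x, x] - [A x, A x]\<close>, hence by a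
  multiple of the squared norm of x. The negative part of C is controlled through finitely many
  kernel functions, and together they bound evaluation at \<alpha>.\<close>

lemma G_bounded: "\<exists>c\<ge>0. \<forall>x\<in>P. fnorm (hform ipM (\<kappa> + \<nu>) (\<lambda>i. if i < \<kappa> then (eP i, 0) else (0, eC (i - \<kappa>)))) (G x) \<le> c * fnorm P.h x"
proof -
  obtain c where c: "c \<ge> 0" "\<And>x. x \<in> P \<Longrightarrow> fnorm P.h (A x) \<le> c * fnorm P.h x" using A_bounded by blast
  define B where "B = c\<^sup>2 + (1 + c\<^sup>2) + 8 * pi * a * Z"
  have B: "B \<ge> 0" using Z_nonneg a_pos by (simp add: B_def)
  let ?h = "hform ipM (\<kappa> + \<nu>) (\<lambda>i. if i < \<kappa> then (eP i, 0) else (0, eC (i - \<kappa>)))"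
  have "fnorm ?h (G x) \<le> sqrt B * fnorm P.h x" if x: "x \<in> P" for x
  proof -
    have Ax: "A x \<in> P" and xC: "x \<alpha> \<in> C" using x \<alpha>_in by (auto intro: A_mem val_mem)
    define N where "N = fnorm P.h x"
    define \<beta> where "\<beta> = sqrt (4 * pi * a)"
    have b: "\<beta> * \<beta> = 4 * pi * a" using a_pos by (simp add: \<beta>_def)
    have AN: "(fnorm P.h (A x))\<^sup>2 \<le> c\<^sup>2 * N\<^sup>2" 
      using power_mono[OF c(2)[OF x], of 2] Ax by (simp add: N_def power_mult_distrib)
    have "?h (G x) (G x) = P.h (A x) (A x) + C.h (cscale (of_real \<beta>) (x \<alpha>)) (cscale (of_real \<beta>) (x \<alpha>))"
      using hform_sum[OF P.herm_space_axioms C.herm_space_axioms P.e_mem C.e_mem G_mem[OF x] G_mem[OF x]]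
      by (simp add: ipM_def G_def \<beta>_def)
    also have "C.h (cscale (of_real \<beta>) (x \<alpha>)) (cscale (of_real \<beta>) (x \<alpha>)) = of_real (\<beta> * \<beta>) * C.h (x \<alpha>) (x \<alpha>)"
      using xC by (simp add: mult_ac)
    finally have "Re (?h (G x) (G x)) = (fnorm P.h (A x))\<^sup>2 + 4 * pi * a * (fnorm C.h (x \<alpha>))\<^sup>2"
      using P.H.sq_fnorm[OF Ax] C.H.sq_fnorm[OF xC] by (simp only: b) simp
    also have "4 * pi * a * (fnorm C.h (x \<alpha>))\<^sup>2 = 4 * pi * a * Re (ipC (x \<alpha>) (x \<alpha>)) + 8 * pi * a * (\<Sum>j<\<nu>. (cmod (ipC (x \<alpha>) (eC j)))\<^sup>2)"
      unfolding C.h_self[OF xC] by (simp add: distrib_left)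
    also have "4 * pi * a * Re (ipC (x \<alpha>) (x \<alpha>)) \<le> (1 + c\<^sup>2) * N\<^sup>2"
    proof -
      have "Re (ipP x x) \<le> N\<^sup>2" unfolding N_def by (rule P.ip_self_le[OF x])
      moreover have "- Re (ipP (A x) (A x)) \<le> (fnorm P.h (A x))\<^sup>2"
        using P.ip_bound[OF Ax Ax] abs_Re_le_cmod[of "ipP (A x) (A x)"] by (simp add: power2_eq_square)
      ultimately show ?thesis using energy[OF x] AN by (simp add: algebra_simps)
    qed
    also have "(\<Sum>j<\<nu>. (cmod (ipC (x \<alpha>) (eC j)))\<^sup>2) \<le> N\<^sup>2 * Z" unfolding N_def by (rule ev_neg_bound[OF x])
    also note AN
    finally have "Re (?h (G x) (G x)) \<le> c\<^sup>2 * N\<^sup>2 + ((1 + c\<^sup>2) * N\<^sup>2 + 8 * pi * a * (N\<^sup>2 * Z))"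
      using a_pos by simp
    also have "\<dots> = B * N\<^sup>2" by (simp add: B_def algebra_simps)
    finally have "sqrt (Re (?h (G x) (G x))) \<le> sqrt (B * N\<^sup>2)" by (rule real_sqrt_le_mono)
    also have "\<dots> = sqrt B * N" using x by (simp add: real_sqrt_mult N_def)
    finally show ?thesis by (simp add: fnorm_def[of ?h] N_def)
  qed
  then show ?thesis using B by (intro exI[of _ "sqrt B"]) auto
qed

lemma complementary_space_exists:
  "\<exists>C1 ip1 b. pont C1 ip1 \<nu> b \<and> C1 \<subseteq> P \<times> C \<and> (\<forall>m\<in>P \<times> C. m - G (Gs m) \<in> C1) \<and>
    (\<forall>u\<in>C1. \<forall>m\<in>P \<times> C. ip1 u (m - G (Gs m)) = ipM u m)"
proof -
  obtain c where c: "c \<ge> 0" "\<And>x. x \<in> P \<Longrightarrow> fnorm (hform ipM (\<kappa> + \<nu>) (\<lambda>i. if i < \<kappa> then (eP i, 0) else (0, eC (i - \<kappa>)))) (G x) \<le> c * fnorm P.h x"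
    using G_bounded by blast
  have M: "pont (P \<times> C) ipM (\<kappa> + \<nu>) (\<lambda>i. if i < \<kappa> then (eP i, 0) else (0, eC (i - \<kappa>)))"
    unfolding ipM_def by (rule pont_sum) (rule P.pont_axioms C.pont_axioms)+
  show ?thesis
  proof (rule complementary_space[OF P.pont_axioms M G_mem _ Gs_mem G_adj c])
    show "G (cscale b x + y) = cscale b (G x) + G y" if "x \<in> P" "y \<in> P" for x y b
    proof (rule prod_eqI)
      show "fst (G (cscale b x + y)) = fst (cscale b (G x) + G y)" using that by (simp add: G_def A_lin)
      show "snd (G (cscale b x + y)) = snd (cscale b (G x) + G y)"
        by (simp add: G_def cscale_fun_def cscale_add_right cscale_mult mult.commute)
    qed
    show "Re (ipM (G x) (G x)) \<le> Re (ipP x x)" if x: "x \<in> P" for x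
    proof -
      define \<beta> where "\<beta> = complex_of_real (sqrt (4 * pi * a))"
      have b: "\<beta> * \<beta> = of_real (4 * pi * a)" "cnj \<beta> = \<beta>"
        using a_pos unfolding \<beta>_def by (simp_all only: of_real_mult[symmetric] real_sqrt_mult_self complex_cnj_complex_of_real) simp
      have Gx: "G x = (A x, cscale \<beta> (x \<alpha>))" unfolding G_def \<beta>_def ..
      have "ipM (G x) (G x) = ipP (A x) (A x) + (\<beta> * \<beta>) * ipC (x \<alpha>) (x \<alpha>)"
        using val_mem[OF x \<alpha>_in] by (simp add: ipM_def sum_form_def Gx b(2) mult.assoc)
      then show ?thesis using energy[OF x] by (simp add: b(1))
    qed
  qed
qed

definition s :: "complex \<Rightarrow> complex" where "s z = of_real (sqrt (pi / a)) * (z - \<alpha>)"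
definition S :: "complex \<Rightarrow> (complex \<Rightarrow> 'c) \<times> 'c \<Rightarrow> 'c" where "S z u = snd u + cscale (s z) (fst u z)"
text \<open>The adjoint of the formula \<open>S w\<close> regarded on all of
  \<open>P \<times> C\<close>.\<close>

definition L :: "complex \<Rightarrow> 'c \<Rightarrow> (complex \<Rightarrow> 'c) \<times> 'c" where "L w c = (cscale (cnj (s w)) (kz w c), c)"

lemma L_mem: "w \<in> \<Omega> \<Longrightarrow> c \<in> C \<Longrightarrow> L w c \<in> P \<times> C" by (simp add: L_def kz_mem)

lemma S_L: 
  assumes u: "u \<in> P \<times> C" and z: "z \<in> \<Omega>" and c: "c \<in> C" shows "ipC (S z u) c = ipM u (L z c)"
  using u z c val_mem[of "fst u" z] kz_mem[OF z c] kz_rep[OF z c, of "fst u"]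
  by (auto simp: S_def L_def ipM_def sum_form_def)

text \<open>Dual form of the identity
  \<open>S w (G f) = \<surd>(\<pi>/a) (w + cnj \<alpha>) f w\<close>. Because of
  \<open>\<surd>(4\<pi>a) = 2a \<surd>(\<pi>/a)\<close>, the value f(\<alpha>) in the second
  component of \<open>G f\<close> cancels the one coming from
  \<open>(w - \<alpha>) R f\<close>.\<close>

lemma Gs_L:
  assumes w: "w \<in> \<Omega>" and c: "c \<in> C"
  shows "Gs (L w c) = cscale (of_real (sqrt (pi / a)) * (cnj w + \<alpha>)) (kz w c)"
proof (rule P.eqI_right)
  show "Gs (L w c) \<in> P" using L_mem[OF w c] by (rule Gs_mem)
  show "cscale (of_real (sqrt (pi / a)) * (cnj w + \<alpha>)) (kz w c) \<in> P" using kz_mem[OF w c] by simp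
  fix f assume f: "f \<in> P"
  define r where "r = sqrt (pi / a)"
  have "sqrt (4 * pi * a) = sqrt ((2 * a)\<^sup>2 * (pi / a))" using a_pos by (simp add: power2_eq_square)
  also have "\<dots> = sqrt ((2 * a)\<^sup>2) * r" unfolding r_def by (rule real_sqrt_mult)
  also have "sqrt ((2 * a)\<^sup>2) = 2 * a" using a_pos by (intro real_sqrt_unique) auto
  finally have b: "sqrt (4 * pi * a) = 2 * a * r" .
  have Gf: "G f = (A f, cscale (of_real (2 * a * r)) (f \<alpha>))" unfolding G_def b ..
  have "S w (G f) = cscale (of_real (2 * a * r)) (f \<alpha>) + cscale (s w) (f w) + cscale (of_real (2 * a * r)) (cscale (w - \<alpha>) (R f w))"
    by (simp add: S_def Gf A_def s_def r_def cscale_fun_def cscale_add_right cscale_mult mult_ac)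
  also have "\<dots> = cscale (s w + of_real (2 * a * r)) (f w)"
    by (simp add: R_diff[OF w] cv.scale_right_diff_distrib cscale_add_left)
  also have "s w + of_real (2 * a * r) = of_real r * (w + cnj \<alpha>)"
  proof -
    have "s w + of_real (2 * a * r) = of_real r * (w - \<alpha> + of_real (2 * a))" by (simp add: s_def r_def algebra_simps)
    also have "w - \<alpha> + of_real (2 * a) = w + cnj \<alpha>" using complex_add_cnj[of \<alpha>] by (simp add: algebra_simps)
    finally show ?thesis .
  qed
  finally have SG: "S w (G f) = cscale (of_real r * (w + cnj \<alpha>)) (f w)" .
  have "ipP f (Gs (L w c)) = ipM (G f) (L w c)" using G_adj[OF f L_mem[OF w c]] by simp
  also have "\<dots> = ipC (S w (G f)) c" using S_L[OF G_mem[OF f] w c] by simp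
  also have "\<dots> = of_real r * (w + cnj \<alpha>) * ipP f (kz w c)" 
    unfolding SG using val_mem[OF f w] c kz_rep[OF w c f] by simp
  also have "\<dots> = ipP f (cscale (of_real (sqrt (pi / a)) * (cnj w + \<alpha>)) (kz w c))"
    using f kz_mem[OF w c] by (simp add: r_def)
  finally show "ipP f (Gs (L w c)) = ipP f (cscale (of_real (sqrt (pi / a)) * (cnj w + \<alpha>)) (kz w c))" .
qed

text \<open>Paired with d, the defect of \<open>L w c\<close> gives
  \<open>[L w c, L z d] - [Gs (L w c), Gs (L z d)]\<close>, where apart from \<open>[c, d]\<close>
  every term is a multiple of \<open>[K z w c, d]\<close>. The remaining scalar is
  \<open>\<pi>/a\<close> times \<open>(cnj w + \<alpha>) (z + cnj \<alpha>) - (cnj w - cnj \<alpha>)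
  (z - \<alpha>)\<close>, and this difference is \<open>2a (z + cnj w)\<close>.\<close>

lemma kernel_identity:
  assumes z: "z \<in> \<Omega>" and w: "w \<in> \<Omega>" and c: "c \<in> C"
  shows "K z w c = cscale (inverse (2 * complex_of_real pi * (z + cnj w))) (c - S z (L w c - G (Gs (L w c))))"
proof -
  have zr: "z \<in> right_half_plane" "w \<in> right_half_plane" using z w \<Omega>_sub by auto
  define T where "T = L w c - G (Gs (L w c))"
  have GL: "G (Gs (L w c)) \<in> P \<times> C" by (intro G_mem Gs_mem L_mem w c)
  interpret M: herm_space "P \<times> C" ipM
    unfolding ipM_def by (rule herm_space_sum) (rule P.herm_space_axioms C.herm_space_axioms)+
  have T: "T \<in> P \<times> C" unfolding T_def using L_mem[OF w c] GL by (rule M.diff_mem)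
  have SC: "S z T \<in> C" using T val_mem[of "fst T" z] z by (auto simp: S_def)
  have Kc: "K z w c \<in> C" by (rule K_mem[OF z w c])
  define r where "r = complex_of_real (sqrt (pi / a))"
  have rr: "r * r = of_real (pi / a)" using a_pos unfolding r_def by (simp only: of_real_mult[symmetric] real_sqrt_mult_self) simp
  have cr: "cnj r = r" by (simp add: r_def)
  have eq: "c - S z T = cscale (2 * complex_of_real pi * (z + cnj w)) (K z w c)"
  proof (rule C.eqI)
    fix d assume d: "d \<in> C"
    have "ipC (S z T) d = ipM (L w c) (L z d) - ipM (G (Gs (L w c))) (L z d)"
      unfolding S_L[OF T z d] unfolding T_def by (rule M.diff_left[OF L_mem[OF w c] GL L_mem[OF z d]])
    also have "ipM (G (Gs (L w c))) (L z d) = ipP (Gs (L w c)) (Gs (L z d))"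
      by (intro G_adj Gs_mem L_mem z w c d)
    also have "\<dots> = (r * (cnj w + \<alpha>)) * (r * (z + cnj \<alpha>)) * ipC (K z w c) d"
      unfolding Gs_L[OF w c] Gs_L[OF z d] using kz_mem[OF w c] kz_mem[OF z d] by (simp add: kz_kz[OF z w c d] r_def[symmetric] cr)
    also have "ipM (L w c) (L z d) = cnj (s w) * s z * ipC (K z w c) d + ipC c d"
      using kz_mem[OF w c] kz_mem[OF z d] by (simp add: ipM_def sum_form_def L_def kz_kz[OF z w c d])
    also have "cnj (s w) * s z = (r * (cnj w - cnj \<alpha>)) * (r * (z - \<alpha>))" by (simp add: s_def r_def)
    finally have "ipC (c - S z T) d = (r * r) * ((cnj w + \<alpha>) * (z + cnj \<alpha>) - (cnj w - cnj \<alpha>) * (z - \<alpha>)) * ipC (K z w c) d"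
      using c d SC by (simp add: algebra_simps)
    also have "(cnj w + \<alpha>) * (z + cnj \<alpha>) - (cnj w - cnj \<alpha>) * (z - \<alpha>) = (\<alpha> + cnj \<alpha>) * (z + cnj w)"
      by (simp add: algebra_simps)
    also have "\<alpha> + cnj \<alpha> = of_real (2 * a)" by (rule complex_add_cnj)
    also have "r * r * (of_real (2 * a) * (z + cnj w)) = 2 * complex_of_real pi * (z + cnj w)"
      unfolding rr using a_pos by simp
    finally show "ipC (c - S z T) d = ipC (cscale (2 * complex_of_real pi * (z + cnj w)) (K z w c)) d"
      using Kc d by simp
  qed (use c SC Kc in auto)
  have q: "2 * complex_of_real pi * (z + cnj w) \<noteq> 0" using denom_nonzero[OF zr] by simp
  show ?thesis unfolding T_def[symmetric] eq cscale_mult left_inverse[OF q] cscale_one ..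
qed

theorem schur_realization:
  "\<exists>(C1 :: ((complex \<Rightarrow> 'c) \<times> 'c) set) ip1 (S :: complex \<Rightarrow> (complex \<Rightarrow> 'c) \<times> 'c \<Rightarrow> 'c).
    pontryagin C1 ip1 \<and> ind_minus C1 ip1 = ind_minus C ipC \<and> gen_schur \<kappa> C1 ip1 C ipC S \<Omega> \<and>
    (\<forall>z\<in>\<Omega>. \<forall>w\<in>\<Omega>. \<forall>c\<in>C. K z w c = KS C1 ip1 C ipC S z w c)"
proof -
  obtain C1 ip1 b where C1: "pont C1 ip1 \<nu> b" "C1 \<subseteq> P \<times> C" 
    and T: "\<And>m. m \<in> P \<times> C \<Longrightarrow> m - G (Gs m) \<in> C1"
    and rep: "\<And>u m. u \<in> C1 \<Longrightarrow> m \<in> P \<times> C \<Longrightarrow> ip1 u (m - G (Gs m)) = ipM u m"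
    using complementary_space_exists by blast
  interpret C1: pont C1 ip1 \<nu> b by fact
  have CM: "u \<in> P \<times> C" if "u \<in> C1" for u using that C1(2) by blast
  define Sa where "Sa w c = L w c - G (Gs (L w c))" for w c
  have Sa: "Sa w c \<in> C1" if "w \<in> \<Omega>" "c \<in> C" for w c unfolding Sa_def by (intro T L_mem that)
  have Sadj: "ipC (S w u) c = ip1 u (Sa w c)" if "w \<in> \<Omega>" "c \<in> C" "u \<in> C1" for w c u
    unfolding Sa_def rep[OF that(3) L_mem[OF that(1,2)]] by (rule S_L[OF CM[OF that(3)] that(1,2)])
  have isadj: "is_adjoint C1 ip1 C ipC (S w) (Sa w)" if "w \<in> \<Omega>" for w
    unfolding is_adjoint_def using Sa[OF that] Sadj[OF that] by auto
  \<comment> \<open>\<open>adj\<close> is a choice among adjoints; nondegeneracy of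
    \<open>C1\<close> makes each of them agree with \<open>Sa w\<close> on C.\<close>
  have adj: "adj C1 ip1 C ipC (S w) c = Sa w c" if w: "w \<in> \<Omega>" and c: "c \<in> C" for w c
  proof -
    have "is_adjoint C1 ip1 C ipC (S w) (adj C1 ip1 C ipC (S w))"
      unfolding adj_def by (rule someI[where P = "is_adjoint C1 ip1 C ipC (S w)", OF isadj[OF w]])
    then show ?thesis unfolding is_adjoint_def using Sadj[OF w c] Sa[OF w c] c
      by (intro C1.eqI_right) auto
  qed
  have KK: "K z w c = KS C1 ip1 C ipC S z w c" if "z \<in> \<Omega>" "w \<in> \<Omega>" "c \<in> C" for z w c
    unfolding KS_def adj[OF that(2,3)] Sa_def by (rule kernel_identity[OF that])
  have SC: "S z u \<in> C" if "z \<in> \<Omega>" "u \<in> C1" for z u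
    using CM[OF that(2)] val_mem[of "fst u" z] that(1) by (auto simp: S_def)
  have ind: "ind_minus C1 ip1 = ind_minus C ipC" by (simp add: C1.ind_minus C.ind_minus)
  have "gen_schur \<kappa> C1 ip1 C ipC S \<Omega>"
    unfolding gen_schur_def
  proof (intro conjI ballI)
    show "pontryagin C1 ip1" "pontryagin C ipC" by (rule C1.pontryagin C.pontryagin)+
    show "ind_minus C1 ip1 = ind_minus C ipC" by (rule ind)
    show "open \<Omega>" "\<Omega> \<subseteq> right_half_plane" by (rule \<Omega>_open \<Omega>_sub)+
    show "\<Omega> \<noteq> {}" using \<alpha>_in by blast
    show "bounded_op C1 ip1 C ipC (S z)" if z: "z \<in> \<Omega>" for z
      unfolding bounded_op_def
    proof (intro conjI ballI allI)
      show "\<exists>T'. is_adjoint C1 ip1 C ipC (S z) T'" using isadj[OF z] by blast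
      show "S z (cscale k x + y) = cscale k (S z x) + S z y" for x y k
        by (simp add: S_def cscale_fun_def cscale_add_right cscale_mult mult.commute add_ac)
    qed (rule SC[OF z])
    show "wk_analytic C ipC \<Omega> (\<lambda>z. S z u)" if u: "u \<in> C1" for u
      unfolding wk_analytic_def
    proof (intro conjI ballI)
      fix c assume c: "c \<in> C"
      have V: "fst u \<in> P" "snd u \<in> C" using CM[OF u] by auto
      have "(\<lambda>z. ipC (snd u) c + s z * ipC (fst u z) c) holomorphic_on \<Omega>"
        unfolding s_def by (intro holomorphic_intros val_hol V c)
      then show "(\<lambda>z. ipC (S z u) c) holomorphic_on \<Omega>"
        by (rule holomorphic_transform) (use V c val_mem in \<open>auto simp: S_def\<close>)
    qed (rule SC[OF _ u])
    show "neg_squares C ipC \<Omega> (KS C1 ip1 C ipC S) \<kappa>"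
      by (rule neg_squares_cong[OF K_neg_squares]) (simp add: KK)
  qed
  then show ?thesis using KK ind C1.pontryagin by blast
qed

end

text \<open>A meromorphic function has arbitrary values on its exceptional set in this encoding, so
  uniqueness compares two extensions off both exceptional sets. The realization lives on pairs
  because \<open>C1\<close> is found inside \<open>P \<times> C\<close>.\<close>

theorem theorem2p5:
  fixes C :: "'c::cvec set" and ipC :: "'c \<Rightarrow> 'c \<Rightarrow> complex"
    and \<Omega> :: "complex set" and \<alpha> :: complex
    and P :: "(complex \<Rightarrow> 'c) set" and ipP :: "(complex \<Rightarrow> 'c) \<Rightarrow> (complex \<Rightarrow> 'c) \<Rightarrow> complex"
    and K :: "complex \<Rightarrow> complex \<Rightarrow> 'c \<Rightarrow> 'c"
  assumes C_pont: "pontryagin C ipC"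
    and \<Omega>_open: "open \<Omega>" and \<Omega>_sub: "\<Omega> \<subseteq> right_half_plane" and \<alpha>_in: "\<alpha> \<in> \<Omega>"
    and P_pont: "pontryagin P ipP"
    and P_analytic: "\<forall>f\<in>P. wk_analytic C ipC \<Omega> f \<and> (\<forall>z. z \<notin> \<Omega> \<longrightarrow> f z = 0)"
    and K_rk: "is_rep_kernel P ipP C ipC \<Omega> K"
    and R_inv: "\<forall>f\<in>P. Rop C ipC \<Omega> \<alpha> f \<in> P"
    and ineq: "\<forall>f\<in>P. Re (complex_of_real (2 * Re \<alpha>) * ipP (Rop C ipC \<Omega> \<alpha> f) (Rop C ipC \<Omega> \<alpha> f)
                 + ipP (Rop C ipC \<Omega> \<alpha> f) f + ipP f (Rop C ipC \<Omega> \<alpha> f)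
                 + 2 * complex_of_real pi * ipC (f \<alpha>) (f \<alpha>)) \<le> 0"
  shows "(\<forall>f\<in>P. (\<exists>g E. wk_meromorphic_on C ipC right_half_plane g E \<and> (\<forall>z\<in>\<Omega> - E. g z = f z)) \<and>
            (\<forall>g1 E1 g2 E2.
               wk_meromorphic_on C ipC right_half_plane g1 E1 \<and> (\<forall>z\<in>\<Omega> - E1. g1 z = f z) \<and>
               wk_meromorphic_on C ipC right_half_plane g2 E2 \<and> (\<forall>z\<in>\<Omega> - E2. g2 z = f z)
               \<longrightarrow> (\<forall>z\<in>right_half_plane - (E1 \<union> E2). g1 z = g2 z)))
       \<and> (\<exists>(C1 :: ((complex \<Rightarrow> 'c) \<times> 'c) set) ip1 (S :: complex \<Rightarrow> (complex \<Rightarrow> 'c) \<times> 'c \<Rightarrow> 'c).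
            pontryagin C1 ip1 \<and> ind_minus C1 ip1 = ind_minus C ipC \<and>
            gen_schur (ind_minus P ipP) C1 ip1 C ipC S \<Omega> \<and>
            (\<forall>z\<in>\<Omega>. \<forall>w\<in>\<Omega>. \<forall>c\<in>C. K z w c = KS C1 ip1 C ipC S z w c))"
proof -
  obtain \<kappa> eP where P: "pont P ipP \<kappa> eP" using pontryagin_imp_pont[OF P_pont] by blast
  obtain \<nu> eC where C: "pont C ipC \<nu> eC" using pontryagin_imp_pont[OF C_pont] by blast
  interpret rk_setting P ipP \<kappa> eP C ipC \<nu> eC \<Omega> \<alpha> K
    by (intro rk_setting.intro P C rk_setting_axioms.intro) (fact assms)+
  have "g1 z = g2 z"
    if "wk_meromorphic_on C ipC right_half_plane g1 E1" "\<forall>z\<in>\<Omega> - E1. g1 z = f z"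
      "wk_meromorphic_on C ipC right_half_plane g2 E2" "\<forall>z\<in>\<Omega> - E2. g2 z = f z"
      "z \<in> right_half_plane - (E1 \<union> E2)" for f g1 E1 g2 E2 z
    by (rule C.wk_meromorphic_unique[OF that(1,3) open_right_half_plane connected_right_half_plane \<Omega>_open \<Omega>_sub])
      (use that(2,4,5) \<alpha>_in in auto)
  then show ?thesis
    using meromorphic_extension schur_realization unfolding P.ind_minus by blast
qed

end
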